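(* Suppose $Y_{N,n}=m_{N,n}+u_n$, $1\le n\le N$, $N\in\mathbb{N}$, where $\{u_n\}$ is a weakly stationary mean-zero $I(0)$ process such that $\{u_n^2\}$ is weakly stationary and $\operatorname{Cov}(u_1^2,u_{1+k}^2)\to0$ as $|k|\to\infty$, and where $\{m_{N,n}\}$ is an array of non-negative constants with $m_{N,n}\le M$ for all $N,n$ and some constant $M$, such that (i) $N^{-1/2}\sum_{i=1}^{\lfloor Ns\rfloor}u_i\Rightarrow\sigma B(s)$ as $N\to\infty$, for some $0<\sigma<\infty$; (ii) $\sup_{0\le s\le1}\left|N^{-1/2}\sum_{i=1}^{\lfloor Ns\rfloor}m_{N,i}-\mu(s)\right|\to0$ as $N\to\infty$, for some deterministic drift $\mu\in D[0,1]$ which is continuous at $0$. Let $\kappa\in(0,1)$. Then $$\lfloor Ns\rfloor\,U_N(s)\Rightarrow\mathcal{U}_2^\mu(s)=\frac{1}{s\,E(u_1^2)}\,\zeta\int_0^s[\mu(r)+\sigma B(r)]^2K(\zeta(r-s))\,dr\qquad\text{in }D[\kappa,1],$$ as $N\to\infty$. If $\mu\in C[0,1]$, then $\mathcal{U}_2^\mu$ has continuous sample paths with probability $1$.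
   Context: $B$ denotes standard Brownian motion on $[0,1]$; $\Rightarrow$ denotes weak convergence in the space of right-continuous functions with left-hand limits on the indicated interval ($D[0,1]$ unless stated otherwise), equipped with the Skorohod topology; $\lfloor x\rfloor$ is the floor function. A series $\{u_n\}$ is called $I(0)$ if the convergence in (i) holds in $D[0,1]$ for some $0<\sigma<\infty$. Kernel and bandwidth: $K:\mathbb{R}\to[0,\infty)$ is a Lipschitz continuous probability density, symmetric around $0$, with mean $0$ and finite variance; $h=h_N>0$ is a sequence of bandwidths with $N/h_N\to\zeta\in[1,\infty)$ as $N\to\infty$; $K_h(x)=K(x/h)/h$. The process $U_N$, computed from $Y_{N,1},\dots,Y_{N,N}$, is $U_N(s)=0$ for $s\in[0,1/N)$ and $$U_N(s)=\frac{\lfloor Ns\rfloor^{-3}\sum_{i=1}^{\lfloor Ns\rfloor}\left(\sum_{j=1}^i Y_{N,j}\right)^2K_h(i-\lfloor Ns\rfloor)}{\lfloor Ns\rfloor^{-2}\sum_{j=1}^{\lfloor Ns\rfloor}Y_{N,j}^2},\qquad s\in[1/N,1].$$ *)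

theory Defs
  imports "HOL-Probability.Probability"
begin

section \<open>The Skorohod space \<open>D[a,b]\<close>\<close>

definition cadlag_on :: "real \<Rightarrow> real \<Rightarrow> (real \<Rightarrow> real) \<Rightarrow> bool" where
  "cadlag_on a b x \<longleftrightarrow>
     (\<forall>t. a \<le> t \<and> t < b \<longrightarrow> (x \<longlongrightarrow> x t) (at_right t)) \<and>
     (\<forall>t. a < t \<and> t \<le> b \<longrightarrow> (\<exists>l. (x \<longlongrightarrow> l) (at_left t)))"

text \<open>Elements are \<^const>\<open>undefined\<close> off \<open>[a,b]\<close>, so that two of them are equal iff they agree on
  \<open>[a,b]\<close>.\<close>

definition skorohod_space :: "real \<Rightarrow> real \<Rightarrow> (real \<Rightarrow> real) set" where
  "skorohod_space a b = {x \<in> extensional {a..b}. cadlag_on a b x}"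

definition time_changes :: "real \<Rightarrow> real \<Rightarrow> (real \<Rightarrow> real) set" where
  "time_changes a b =
     {l. strict_mono_on {a..b} l \<and> continuous_on {a..b} l \<and> l ` {a..b} = {a..b}}"

text \<open>The usual metric for the Skorohod (J1) topology. The value outside \<^const>\<open>skorohod_space\<close> is
  irrelevant; it is set to \<open>0\<close> because \<^locale>\<open>Metric_space\<close> wants a total non-negative
  function.\<close>

definition skorohod_dist :: "real \<Rightarrow> real \<Rightarrow> (real \<Rightarrow> real) \<Rightarrow> (real \<Rightarrow> real) \<Rightarrow> real" where
  "skorohod_dist a b x y =
     (if x \<in> skorohod_space a b \<and> y \<in> skorohod_space a b
      then Inf {e. 0 \<le> e \<and> (\<exists>l\<in>time_changes a b. \<forall>t\<in>{a..b}.
                     \<bar>l t - t\<bar> \<le> e \<and> \<bar>x t - y (l t)\<bar> \<le> e)}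
      else 0)"

definition skorohod_topology :: "real \<Rightarrow> real \<Rightarrow> (real \<Rightarrow> real) topology" where
  "skorohod_topology a b = Metric_space.mtopology (skorohod_space a b) (skorohod_dist a b)"

definition skorohod_borel :: "real \<Rightarrow> real \<Rightarrow> (real \<Rightarrow> real) measure" where
  "skorohod_borel a b = sigma (skorohod_space a b) {U. openin (skorohod_topology a b) U}"

lemma cadlag_bounded:
  assumes "cadlag_on a b x"
  shows "bounded (x ` {a..b})"
proof -
  have loc: "\<exists>d>0. \<exists>B. \<forall>s\<in>{a..b}. \<bar>s - t\<bar> < d \<longrightarrow> \<bar>x s\<bar> \<le> B" if t: "t \<in> {a..b}" for t
  proof -
    have side: "\<exists>d>0. \<exists>B. \<forall>s\<in>S. 0 < \<bar>s - t\<bar> \<and> \<bar>s - t\<bar> < d \<longrightarrow> \<bar>x s\<bar> \<le> B"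
      if "(x \<longlongrightarrow> l) (at t within S)" for l S
    proof -
      have "eventually (\<lambda>s. dist (x s) l < 1) (at t within S)"
        using that by (rule tendstoD) simp
      then obtain d where "d > 0" "\<forall>s\<in>S. s \<noteq> t \<and> dist s t < d \<longrightarrow> dist (x s) l < 1"
        by (auto simp: eventually_at)
      then have "\<forall>s\<in>S. 0 < \<bar>s - t\<bar> \<and> \<bar>s - t\<bar> < d \<longrightarrow> \<bar>x s\<bar> \<le> \<bar>l\<bar> + 1"
      proof (intro ballI impI)
        fix s assume "s \<in> S" "0 < \<bar>s - t\<bar> \<and> \<bar>s - t\<bar> < d"
        then have "dist (x s) l < 1"
          using \<open>\<forall>s\<in>S. s \<noteq> t \<and> dist s t < d \<longrightarrow> dist (x s) l < 1\<close> by (simp add: dist_real_def)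
        then show "\<bar>x s\<bar> \<le> \<bar>l\<bar> + 1" unfolding dist_real_def by linarith
      qed
      with \<open>d > 0\<close> show ?thesis by blast
    qed
    have R: "\<exists>d>0. \<exists>B. \<forall>s\<in>{a..b}. t < s \<and> s - t < d \<longrightarrow> \<bar>x s\<bar> \<le> B"
    proof (cases "t < b")
      case True
      then have "(x \<longlongrightarrow> x t) (at_right t)" using assms t by (auto simp: cadlag_on_def)
      from side[OF this] show ?thesis by (fastforce simp: abs_if)
    next
      case False
      then show ?thesis using t by (intro exI[of _ 1]) auto
    qed
    have L: "\<exists>d>0. \<exists>B. \<forall>s\<in>{a..b}. s < t \<and> t - s < d \<longrightarrow> \<bar>x s\<bar> \<le> B"
    proof (cases "a < t")
      case True
      then obtain l where "(x \<longlongrightarrow> l) (at_left t)" using assms t by (auto simp: cadlag_on_def)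
      from side[OF this] show ?thesis by (fastforce simp: abs_if)
    next
      case False
      then show ?thesis using t by (intro exI[of _ 1]) auto
    qed
    obtain d B where 1: "d > 0" "\<And>s. s \<in> {a..b} \<Longrightarrow> t < s \<Longrightarrow> s - t < d \<Longrightarrow> \<bar>x s\<bar> \<le> B" using R by blast
    obtain d' B' where 2: "d' > 0" "\<And>s. s \<in> {a..b} \<Longrightarrow> s < t \<Longrightarrow> t - s < d' \<Longrightarrow> \<bar>x s\<bar> \<le> B'"
      using L by blast
    show ?thesis
    proof (intro exI conjI ballI impI)
      show "min d d' > 0" using 1 2 by simp
      fix s assume s: "s \<in> {a..b}" "\<bar>s - t\<bar> < min d d'"
      consider "s = t" | "t < s" | "s < t" by linarith
      then show "\<bar>x s\<bar> \<le> max \<bar>x t\<bar> (max B B')"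
        using 1(2)[OF s(1)] 2(2)[OF s(1)] s(2) by cases fastforce+
    qed
  qed
  then obtain d B where dB: "\<And>t. t \<in> {a..b} \<Longrightarrow> d t > 0"
      "\<And>t s. t \<in> {a..b} \<Longrightarrow> s \<in> {a..b} \<Longrightarrow> \<bar>s - t\<bar> < d t \<Longrightarrow> \<bar>x s\<bar> \<le> B t"
    by metis
  obtain T where T: "T \<subseteq> {a..b}" "finite T" "{a..b} \<subseteq> (\<Union>t\<in>T. ball t (d t))"
    by (rule compactE_image[of "{a..b}" "{a..b}" "\<lambda>t. ball t (d t)"]) (use dB(1) in auto)
  show ?thesis
    unfolding bounded_iff
  proof (intro exI ballI)
    fix v assume "v \<in> x ` {a..b}"
    then obtain s where s: "s \<in> {a..b}" "v = x s" by blast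
    then obtain t where t: "t \<in> T" "\<bar>s - t\<bar> < d t" using T(3) by (auto simp: dist_real_def)
    then have "\<bar>x s\<bar> \<le> B t" using dB(2) T(1) s by blast
    also have "\<dots> \<le> \<bar>B t\<bar>" by simp
    also have "\<dots> \<le> (\<Sum>t\<in>T. \<bar>B t\<bar>)" using t(1) T(2) by (intro member_le_sum) auto
    finally show "norm v \<le> (\<Sum>t\<in>T. \<bar>B t\<bar>)" using s by simp
  qed
qed

lemma time_change_inverse:
  assumes "l \<in> time_changes a b"
  shows "\<exists>k\<in>time_changes a b. \<forall>t\<in>{a..b}. k t \<in> {a..b} \<and> l (k t) = t"
proof -
  let ?k = "inv_into {a..b} l"
  have l: "strict_mono_on {a..b} l" "continuous_on {a..b} l" "l ` {a..b} = {a..b}"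
    using assms by (auto simp: time_changes_def)
  have inj: "inj_on l {a..b}" using l(1) by (rule strict_mono_on_imp_inj_on)
  have k: "?k t \<in> {a..b}" "l (?k t) = t" if "t \<in> {a..b}" for t
    using that l(3) by (metis inv_into_into, metis f_inv_into_f)
  have "strict_mono_on {a..b} ?k"
  proof (rule strict_mono_onI)
    fix r s assume rs: "r \<in> {a..b}" "s \<in> {a..b}" "r < s"
    show "?k r < ?k s"
    proof (rule ccontr)
      assume "\<not> ?k r < ?k s"
      then have "l (?k s) \<le> l (?k r)"
        using strict_mono_on_leD[OF l(1)] k rs by (meson not_less)
      then show False using k rs by simp
    qed
  qed
  moreover have "continuous_on {a..b} ?k"
    using continuous_on_inv[OF l(2), of ?k] l(3) inj by simp
  moreover have "?k ` {a..b} = {a..b}"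
    using inj_on_imp_bij_betw[OF inj] l(3) by (metis bij_betw_def bij_betw_inv_into)
  ultimately have "?k \<in> time_changes a b" by (simp add: time_changes_def)
  then show ?thesis using k by blast
qed

lemma time_change_comp:
  assumes "l \<in> time_changes a b" "k \<in> time_changes a b"
  shows "k \<circ> l \<in> time_changes a b"
proof -
  have l: "strict_mono_on {a..b} l" "continuous_on {a..b} l" "l ` {a..b} = {a..b}"
    and k: "strict_mono_on {a..b} k" "continuous_on {a..b} k" "k ` {a..b} = {a..b}"
    using assms by (auto simp: time_changes_def)
  have "(k \<circ> l) ` {a..b} = {a..b}" using l(3) k(3) by (simp only: image_comp[symmetric])
  moreover have "continuous_on {a..b} (k \<circ> l)" using l k by (intro continuous_on_compose) simp_all
  moreover have "strict_mono_on {a..b} (k \<circ> l)"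
  proof (rule strict_mono_onI)
    fix r s assume rs: "r \<in> {a..b}" "s \<in> {a..b}" "r < s"
    then have "l r \<in> {a..b}" "l s \<in> {a..b}" using l(3) by blast+
    then show "(k \<circ> l) r < (k \<circ> l) s"
      using strict_mono_onD[OF k(1)] strict_mono_onD[OF l(1) rs] by simp
  qed
  ultimately show ?thesis unfolding time_changes_def by blast
qed

lemma skorohod_metric_space:
  assumes "a \<le> b"
  shows "Metric_space (skorohod_space a b) (skorohod_dist a b)"
proof
  let ?D = "skorohod_space a b"
  define P where "P = (\<lambda>x y e. 0 \<le> e \<and> (\<exists>l\<in>time_changes a b. \<forall>t\<in>{a..b}.
                     \<bar>l t - t\<bar> \<le> e \<and> \<bar>x t - y (l t)\<bar> \<le> e))" for x y :: "real \<Rightarrow> real"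
  have dist: "skorohod_dist a b x y = Inf {e. P x y e}" if "x \<in> ?D" "y \<in> ?D" for x y
    using that by (simp add: skorohod_dist_def P_def)
  have bdd: "bdd_below {e. P x y e}" for x y
    by (rule bdd_belowI[of _ 0]) (simp add: P_def)
  have ne: "{e. P x y e} \<noteq> {}" if "x \<in> ?D" "y \<in> ?D" for x y
  proof -
    obtain A where A: "\<And>t. t \<in> {a..b} \<Longrightarrow> \<bar>x t\<bar> \<le> A"
      using cadlag_bounded[of a b x] \<open>x \<in> ?D\<close> by (force simp: skorohod_space_def bounded_iff)
    obtain B where B: "\<And>t. t \<in> {a..b} \<Longrightarrow> \<bar>y t\<bar> \<le> B"
      using cadlag_bounded[of a b y] \<open>y \<in> ?D\<close> by (force simp: skorohod_space_def bounded_iff)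
    have "0 \<le> A" "0 \<le> B" using A[of a] B[of a] assms by force+
    moreover have "id \<in> time_changes a b" by (auto simp: time_changes_def strict_mono_on_def)
    moreover have "\<bar>x t - y t\<bar> \<le> A + B" if "t \<in> {a..b}" for t
      using A[OF that] B[OF that] by linarith
    ultimately have "P x y (A + B)" unfolding P_def by (force intro!: bexI[of _ id])
    then show ?thesis by blast
  qed
  have sym: "P y x e" if xy: "P x y e" for x y e
  proof -
    obtain l where l: "0 \<le> e" "l \<in> time_changes a b"
        "\<And>t. t \<in> {a..b} \<Longrightarrow> \<bar>l t - t\<bar> \<le> e \<and> \<bar>x t - y (l t)\<bar> \<le> e"
      using xy unfolding P_def by blast
    obtain k where k: "k \<in> time_changes a b" "\<And>t. t \<in> {a..b} \<Longrightarrow> k t \<in> {a..b} \<and> l (k t) = t"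
      using time_change_inverse[OF l(2)] by blast
    have "\<bar>k t - t\<bar> \<le> e \<and> \<bar>y t - x (k t)\<bar> \<le> e" if "t \<in> {a..b}" for t
      using l(3)[of "k t"] k(2)[OF that] by (simp add: abs_minus_commute)
    then show ?thesis unfolding P_def using l(1) k(1) by blast
  qed
  have refl: "P x x 0" for x
    unfolding P_def by (auto simp: time_changes_def strict_mono_on_def intro!: bexI[of _ id])
  have eq: "x t = y t" if x: "x \<in> ?D" and y: "y \<in> ?D" and small: "\<And>e. e > 0 \<Longrightarrow> P x y e"
    and t: "t \<in> {a..b}" for x y t
  proof -
    have cx: "cadlag_on a b x" and cy: "cadlag_on a b y" using x y by (auto simp: skorohod_space_def)
    have near: "\<exists>s\<in>{a..b}. \<bar>s - r\<bar> \<le> e \<and> \<bar>x r - y s\<bar> \<le> e \<and> (r = b \<longrightarrow> s = b)"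
      if r: "r \<in> {a..b}" and "e > 0" for r e
    proof -
      obtain l where l: "l \<in> time_changes a b"
          "\<And>t. t \<in> {a..b} \<Longrightarrow> \<bar>l t - t\<bar> \<le> e \<and> \<bar>x t - y (l t)\<bar> \<le> e"
        using small[OF \<open>e > 0\<close>] by (auto simp: P_def)
      have img: "l ` {a..b} = {a..b}" and mono: "strict_mono_on {a..b} l"
        using l(1) by (auto simp: time_changes_def)
      have "l b = b"
      proof (rule antisym)
        show "l b \<le> b" using img assms by force
        have "b \<in> l ` {a..b}" using img assms by simp
        then obtain s where "s \<in> {a..b}" "b = l s" by blast
        then show "b \<le> l b" using strict_mono_on_leD[OF mono, of s b] assms by auto
      qed
      then show ?thesis using l(2)[OF r] r img by (intro bexI[of _ "l r"]) auto
    qed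
    show ?thesis
    proof (cases "t = b")
      case True
      show ?thesis
      proof (rule ccontr)
        assume "x t \<noteq> y t"
        then show False using near[OF t, of "\<bar>x t - y t\<bar> / 2"] True by auto
      qed
    next
      case False
      then have tb: "t < b" and ta: "a \<le> t" using t by auto
      have xr: "(x \<longlongrightarrow> x t) (at_right t)" and yr: "(y \<longlongrightarrow> y t) (at_right t)"
        using cx cy ta tb by (auto simp: cadlag_on_def)
      show ?thesis
      proof (rule ccontr)
        assume "x t \<noteq> y t"
        define c where "c = \<bar>x t - y t\<bar> / 4"
        have c: "c > 0" using \<open>x t \<noteq> y t\<close> by (simp add: c_def)
        obtain d1 where d1: "d1 > 0" "\<And>s. t < s \<Longrightarrow> s - t < d1 \<Longrightarrow> \<bar>x s - x t\<bar> < c"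
          using tendstoD[OF xr c] by (force simp: eventually_at dist_real_def)
        obtain d2 where d2: "d2 > 0" "\<And>s. t < s \<Longrightarrow> s - t < d2 \<Longrightarrow> \<bar>y s - y t\<bar> < c"
          using tendstoD[OF yr c] by (force simp: eventually_at dist_real_def)
        define d where "d = min (b - t) (min d1 d2)"
        have d: "d > 0" "d \<le> b - t" "d \<le> d1" "d \<le> d2" using tb d1 d2 by (auto simp: d_def)
        define r where "r = t + d / 2"
        define e where "e = min c (d / 4)"
        have e: "e > 0" "e \<le> c" "e \<le> d / 4" using c d by (auto simp: e_def)
        have "r \<in> {a..b}" using ta d by (auto simp: r_def)
        from near[OF this e(1)] obtain s where s: "\<bar>s - r\<bar> \<le> e" "\<bar>x r - y s\<bar> \<le> e" by blast
        have "t < s" "s - t < d2" using s(1) e d unfolding r_def by linarith+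
        moreover have "t < r" "r - t < d1" using d unfolding r_def by linarith+
        ultimately have "\<bar>y s - y t\<bar> < c" "\<bar>x r - x t\<bar> < c" using d1(2) d2(2) by auto
        then have "\<bar>x t - y t\<bar> < 3 * c" using s(2) e by linarith
        then show False using c by (simp add: c_def)
      qed
    qed
  qed
  show "0 \<le> skorohod_dist a b x y" for x y
  proof (cases "x \<in> ?D \<and> y \<in> ?D")
    case True
    then show ?thesis using ne[of x y] dist[of x y] by (auto intro!: cInf_greatest simp: P_def)
  qed (auto simp: skorohod_dist_def)
  show "skorohod_dist a b x y = skorohod_dist a b y x" for x y
  proof (cases "x \<in> ?D \<and> y \<in> ?D")
    case True
    moreover have "{e. P x y e} = {e. P y x e}" using sym by blast
    ultimately show ?thesis using dist by simp
  qed (auto simp: skorohod_dist_def)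
  have mono: "P x y e" if "P x y e'" "e' \<le> e" for x y e e'
    using that unfolding P_def by (meson order_trans)
  have lessP: "P x y e" if "x \<in> ?D" "y \<in> ?D" "skorohod_dist a b x y < e" for x y e
    using that dist[of x y] cInf_lessD[OF ne[of x y], of e] mono[of x y _ e] by force
  show "skorohod_dist a b x y = 0 \<longleftrightarrow> x = y" if x: "x \<in> ?D" and y: "y \<in> ?D" for x y
  proof
    assume "skorohod_dist a b x y = 0"
    then have "x t = y t" if "t \<in> {a..b}" for t using eq[OF x y _ that] lessP[OF x y] by auto
    then show "x = y"
      using x y by (intro extensionalityI[of x "{a..b}" y]) (auto simp: skorohod_space_def)
  next
    assume "x = y"
    have "Inf {e. P x x e} = 0"
      using refl by (intro cInf_eq_minimum) (auto simp: P_def)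
    then show "skorohod_dist a b x y = 0" using dist[OF x x] \<open>x = y\<close> by simp
  qed
  show "skorohod_dist a b x z \<le> skorohod_dist a b x y + skorohod_dist a b y z"
    if x: "x \<in> ?D" and y: "y \<in> ?D" and z: "z \<in> ?D" for x y z
  proof (rule field_le_epsilon)
    fix e :: real assume e: "e > 0"
    define p where "p = skorohod_dist a b x y + e / 2"
    define q where "q = skorohod_dist a b y z + e / 2"
    have "P x y p" "P y z q" using lessP x y z e by (auto simp: p_def q_def)
    then obtain l k where l: "0 \<le> p" "l \<in> time_changes a b"
        "\<And>t. t \<in> {a..b} \<Longrightarrow> \<bar>l t - t\<bar> \<le> p \<and> \<bar>x t - y (l t)\<bar> \<le> p"
      and k: "0 \<le> q" "k \<in> time_changes a b"
        "\<And>t. t \<in> {a..b} \<Longrightarrow> \<bar>k t - t\<bar> \<le> q \<and> \<bar>y t - z (k t)\<bar> \<le> q"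
      by (auto simp: P_def)
    have "\<bar>k (l t) - t\<bar> \<le> p + q \<and> \<bar>x t - z (k (l t))\<bar> \<le> p + q" if "t \<in> {a..b}" for t
    proof -
      have "l t \<in> {a..b}" using l(2) that by (auto simp: time_changes_def)
      from k(3)[OF this] l(3)[OF that] show ?thesis by linarith
    qed
    then have "P x z (p + q)"
      using l(1) k(1) time_change_comp[OF l(2) k(2)]
      unfolding P_def by (intro conjI bexI[of _ "k \<circ> l"]) auto
    then have "skorohod_dist a b x z \<le> p + q"
      using dist[OF x z] cInf_lower[OF _ bdd[of x z], of "p + q"] by simp
    then show "skorohod_dist a b x z \<le> skorohod_dist a b x y + skorohod_dist a b y z + e"
      by (simp add: p_def q_def)
  qed
qed

text \<open>A process is a map from outcomes to paths; only the restriction of its paths to \<open>[a,b]\<close> matters.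
  Being a random element of \<open>D[a,b]\<close> (measurability with respect to the Skorohod Borel sets) is part
  of the notion of weak convergence.\<close>

definition random_element :: "real \<Rightarrow> real \<Rightarrow> 'a measure \<Rightarrow> ('a \<Rightarrow> real \<Rightarrow> real) \<Rightarrow> bool" where
  "random_element a b P X \<longleftrightarrow> (\<lambda>\<omega>. restrict (X \<omega>) {a..b}) \<in> P \<rightarrow>\<^sub>M skorohod_borel a b"

definition weakly_converges ::
  "real \<Rightarrow> real \<Rightarrow> 'a measure \<Rightarrow> (nat \<Rightarrow> 'a \<Rightarrow> real \<Rightarrow> real) \<Rightarrow> 'b measure \<Rightarrow> ('b \<Rightarrow> real \<Rightarrow> real) \<Rightarrow> bool"
where
  "weakly_converges a b P X Q Z \<longleftrightarrow>
     (\<forall>N. random_element a b P (X N)) \<and> random_element a b Q Z \<and>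
     (\<forall>f. continuous_map (skorohod_topology a b) euclideanreal f \<and>
          bounded (f ` skorohod_space a b) \<longrightarrow>
          (\<lambda>N. \<integral>\<omega>. f (restrict (X N \<omega>) {a..b}) \<partial>P)
            \<longlonglongrightarrow> (\<integral>\<omega>. f (restrict (Z \<omega>) {a..b}) \<partial>Q))"

section \<open>Brownian motion and stationary series\<close>

definition brownian_motion :: "'b measure \<Rightarrow> ('b \<Rightarrow> real \<Rightarrow> real) \<Rightarrow> bool" where
  "brownian_motion Q B \<longleftrightarrow>
     prob_space Q \<and>
     (\<forall>t\<in>{0..1}. (\<lambda>\<omega>. B \<omega> t) \<in> borel_measurable Q) \<and>
     (AE \<omega> in Q. B \<omega> 0 = 0) \<and>
     (\<forall>\<omega>\<in>space Q. continuous_on {0..1} (B \<omega>)) \<and>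
     (\<forall>s t. 0 \<le> s \<and> s < t \<and> t \<le> 1 \<longrightarrow>
        distributed Q lborel (\<lambda>\<omega>. B \<omega> t - B \<omega> s) (normal_density 0 (sqrt (t - s)))) \<and>
     (\<forall>n (t :: nat \<Rightarrow> real). 0 \<le> t 0 \<and> (\<forall>i<n. t i \<le> t (Suc i)) \<and> t n \<le> 1 \<longrightarrow>
        prob_space.indep_vars Q (\<lambda>_. borel) (\<lambda>i \<omega>. B \<omega> (t (Suc i)) - B \<omega> (t i)) {..<n})"

definition covariance :: "'a measure \<Rightarrow> ('a \<Rightarrow> real) \<Rightarrow> ('a \<Rightarrow> real) \<Rightarrow> real" where
  "covariance P X Y = (\<integral>\<omega>. (X \<omega> - (\<integral>\<omega>'. X \<omega>' \<partial>P)) * (Y \<omega> - (\<integral>\<omega>'. Y \<omega>' \<partial>P)) \<partial>P)"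

text \<open>Series are indexed by \<open>n \<ge> 1\<close>; the value at \<open>0\<close> is ignored.\<close>

definition weakly_stationary :: "'a measure \<Rightarrow> (nat \<Rightarrow> 'a \<Rightarrow> real) \<Rightarrow> bool" where
  "weakly_stationary P v \<longleftrightarrow>
     (\<forall>n\<ge>1. v n \<in> borel_measurable P \<and> integrable P (\<lambda>\<omega>. (v n \<omega>)\<^sup>2)) \<and>
     (\<forall>n\<ge>1. (\<integral>\<omega>. v n \<omega> \<partial>P) = (\<integral>\<omega>. v 1 \<omega> \<partial>P)) \<and>
     (\<forall>n\<ge>1. \<forall>k. covariance P (v n) (v (n + k)) = covariance P (v 1) (v (1 + k)))"

definition partial_sum_process :: "(nat \<Rightarrow> 'a \<Rightarrow> real) \<Rightarrow> nat \<Rightarrow> 'a \<Rightarrow> real \<Rightarrow> real" where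
  "partial_sum_process u N \<omega> s = (\<Sum>i=1..nat \<lfloor>real N * s\<rfloor>. u i \<omega>) / sqrt (real N)"

definition scaled_path :: "real \<Rightarrow> ('b \<Rightarrow> real \<Rightarrow> real) \<Rightarrow> 'b \<Rightarrow> real \<Rightarrow> real" where
  "scaled_path \<sigma> B \<omega> s = \<sigma> * B \<omega> s"

text \<open>\<open>I(0)\<close>, relative to a given Brownian motion; all of them have the same law.\<close>

definition I0_series ::
  "'a measure \<Rightarrow> (nat \<Rightarrow> 'a \<Rightarrow> real) \<Rightarrow> 'b measure \<Rightarrow> ('b \<Rightarrow> real \<Rightarrow> real) \<Rightarrow> bool" where
  "I0_series P u Q B \<longleftrightarrow>
     (\<exists>\<sigma>>0. weakly_converges 0 1 P (partial_sum_process u) Q (scaled_path \<sigma> B))"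

section \<open>The kernel, the detector and its limit\<close>

definition admissible_kernel :: "(real \<Rightarrow> real) \<Rightarrow> bool" where
  "admissible_kernel K \<longleftrightarrow>
     (\<forall>x. 0 \<le> K x) \<and> (\<exists>L. L-lipschitz_on UNIV K) \<and>
     has_bochner_integral lborel K 1 \<and> (\<forall>x. K (- x) = K x) \<and>
     has_bochner_integral lborel (\<lambda>x. x * K x) 0 \<and>
     integrable lborel (\<lambda>x. x\<^sup>2 * K x)"

definition scaled_kernel :: "(real \<Rightarrow> real) \<Rightarrow> real \<Rightarrow> real \<Rightarrow> real" where
  "scaled_kernel K h x = K (x / h) / h"

text \<open>If all observations up to \<open>\<lfloor>Ns\<rfloor>\<close> vanish, the ratio is \<open>0 / 0 = 0\<close>.\<close>

definition U_process :: "(real \<Rightarrow> real) \<Rightarrow> real \<Rightarrow> nat \<Rightarrow> (nat \<Rightarrow> real) \<Rightarrow> real \<Rightarrow> real" where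
  "U_process K h N y s =
     (if s < 1 / real N then 0
      else let n = nat \<lfloor>real N * s\<rfloor> in
        (1 / real n ^ 3 * (\<Sum>i=1..n. (\<Sum>j=1..i. y j)\<^sup>2 * scaled_kernel K h (real i - real n))) /
        (1 / real n ^ 2 * (\<Sum>j=1..n. (y j)\<^sup>2)))"

definition U2_limit ::
  "(real \<Rightarrow> real) \<Rightarrow> real \<Rightarrow> real \<Rightarrow> real \<Rightarrow> (real \<Rightarrow> real) \<Rightarrow> ('b \<Rightarrow> real \<Rightarrow> real) \<Rightarrow> 'b \<Rightarrow> real \<Rightarrow> real"
where
  "U2_limit K \<zeta> Eu2 \<sigma> \<mu> B \<omega> s =
     1 / (s * Eu2) * \<zeta> * (LBINT r:{0..s}. (\<mu> r + \<sigma> * B \<omega> r)\<^sup>2 * K (\<zeta> * (r - s)))"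

end

theory Submission
  imports Defs
begin

text \<open>
  Let \<open>S_N\<close> and \<open>\<mu>_N\<close> be the partial sum processes of the errors and of the drift, \<open>v\<close> the second moment
  of the errors, \<open>c = N / h_N\<close> and \<open>n = \<lfloor>Ns\<rfloor>\<close>. After cancelling powers of \<open>n\<close> and \<open>N\<close>, the detector \<open>n U_N(s)\<close>
  is the quotient of \<open>c / N * \<Sum>i=1..n. (\<mu>_N(i/N) + S_N(i/N))\<^sup>2 K(c (i - n) / N)\<close> and of
  \<open>1 / N * \<Sum>j=1..n. Y_{N,j}\<^sup>2\<close>.

  The numerator is a Riemann sum for \<open>\<zeta>\<close> times the integral of \<open>(\<mu> + S_N)\<^sup>2 K(\<zeta> (r - s))\<close> over \<open>r \<in> [0, s]\<close>,
  with an error that is uniform in \<open>s\<close> and depends on the path only through its supremum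
  (\<open>smoothed_integral_riemann_sum\<close>); these suprema are tight (\<open>weakly_converges_tight\<close>). The denominator is
  close to \<open>s v\<close> uniformly in \<open>s\<close>: for the errors alone by a law of large numbers for weakly stationary
  non-negative series (\<open>uniform_law_of_large_numbers\<close>), and the drift, which adds up to order \<open>sqrt N\<close> only,
  changes it by a vanishing amount (\<open>drift_square_negligible\<close>). Moreover \<open>v > 0\<close>, since otherwise the partial sums could not
  converge to a non-zero multiple of Brownian motion (\<open>limit_variance_positive\<close>).

  Hence the detector is, with high probability and uniformly over \<open>s \<in> [\<kappa>, 1]\<close>, close to \<open>H(S_N)\<close>, where
  \<open>H(x)(s)\<close> is \<open>\<zeta> / (s v)\<close> times the integral of \<open>(\<mu> + x)\<^sup>2 K(\<zeta> (r - s))\<close> over \<open>[0, s]\<close>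
  (\<open>detector_estimate\<close>). The map \<open>H\<close> is continuous from \<open>D[0,1]\<close> to \<open>D[\<kappa>,1]\<close> at every path, because
  Skorohod convergence implies pointwise convergence at all but countably many times and an integral ignores
  countable sets (\<open>limit_map_continuous\<close>). The continuous mapping principle gives \<open>H(S_N) \<Rightarrow> H(\<sigma> B)\<close>, which is
  the asserted limit, and Slutsky's principle (\<open>weakly_converges_Slutsky\<close>) replaces \<open>H(S_N)\<close> by the detector.
  Finally, \<open>H\<close> takes values in the continuous paths because \<open>K\<close> is Lipschitz continuous, so the limit has
  continuous paths.
\<close>

section \<open>The Skorohod metric\<close>

text \<open>The distance is an infimum that need not be attained, so a time change is only available at every
  strictly larger level.\<close>

lemma skorohod_dist_less_time_change:
  assumes "x \<in> skorohod_space a b" "y \<in> skorohod_space a b" "a \<le> b" "skorohod_dist a b x y < e"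
  shows "\<exists>l\<in>time_changes a b. \<forall>t\<in>{a..b}. \<bar>l t - t\<bar> \<le> e \<and> \<bar>x t - y (l t)\<bar> \<le> e"
proof -
  let ?S = "{e. 0 \<le> e \<and> (\<exists>l\<in>time_changes a b. \<forall>t\<in>{a..b}. \<bar>l t - t\<bar> \<le> e \<and> \<bar>x t - y (l t)\<bar> \<le> e)}"
  obtain A where A: "\<And>t. t \<in> {a..b} \<Longrightarrow> \<bar>x t\<bar> \<le> A"
    using cadlag_bounded[of a b x] assms(1) by (force simp: skorohod_space_def bounded_iff)
  obtain C where C: "\<And>t. t \<in> {a..b} \<Longrightarrow> \<bar>y t\<bar> \<le> C"
    using cadlag_bounded[of a b y] assms(2) by (force simp: skorohod_space_def bounded_iff)
  have "0 \<le> A + C" using A[of a] C[of a] assms(3) by fastforce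
  moreover have "id \<in> time_changes a b" by (auto simp: time_changes_def strict_mono_on_def)
  moreover have "\<bar>x t - y t\<bar> \<le> A + C" if "t \<in> {a..b}" for t
    using A[OF that] C[OF that] by linarith
  ultimately have "A + C \<in> ?S" by (auto intro!: bexI[of _ id])
  then have "?S \<noteq> {}" by blast
  moreover have "Inf ?S < e" using assms by (simp add: skorohod_dist_def)
  ultimately obtain e' where "e' \<in> ?S" "e' < e" using cInf_lessD[of ?S e] by auto
  then obtain l where "l \<in> time_changes a b"
    "\<And>t. t \<in> {a..b} \<Longrightarrow> \<bar>l t - t\<bar> \<le> e' \<and> \<bar>x t - y (l t)\<bar> \<le> e'" by blast
  with \<open>e' < e\<close> show ?thesis by (intro bexI[of _ l]) force+
qed

lemma skorohod_dist_le_sup_dist: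
  assumes "x \<in> skorohod_space a b" "y \<in> skorohod_space a b" "0 \<le> e"
    and "\<And>t. t \<in> {a..b} \<Longrightarrow> \<bar>x t - y t\<bar> \<le> e"
  shows "skorohod_dist a b x y \<le> e"
proof -
  let ?S = "{e. 0 \<le> e \<and> (\<exists>l\<in>time_changes a b. \<forall>t\<in>{a..b}. \<bar>l t - t\<bar> \<le> e \<and> \<bar>x t - y (l t)\<bar> \<le> e)}"
  have "id \<in> time_changes a b" by (auto simp: time_changes_def strict_mono_on_def)
  then have "e \<in> ?S" using assms by (auto intro!: bexI[of _ id])
  moreover have "bdd_below ?S" by (rule bdd_belowI[of _ 0]) auto
  ultimately show ?thesis using assms by (simp add: skorohod_dist_def cInf_lower)
qed

lemma time_change_fixes_right_end:
  assumes "l \<in> time_changes a b" "a \<le> b"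
  shows "l b = b"
proof (rule antisym)
  have img: "l ` {a..b} = {a..b}" and mono: "strict_mono_on {a..b} l"
    using assms by (auto simp: time_changes_def)
  show "l b \<le> b" using img assms by force
  have "b \<in> l ` {a..b}" using img assms by simp
  then obtain s where "s \<in> {a..b}" "b = l s" by blast
  then show "b \<le> l b" using strict_mono_on_leD[OF mono, of s b] assms by auto
qed

lemma topspace_skorohod: "a \<le> b \<Longrightarrow> topspace (skorohod_topology a b) = skorohod_space a b"
  unfolding skorohod_topology_def
  using Metric_space.topspace_mtopology[OF skorohod_metric_space] by blast

lemma continuous_map_skorohod_iff:
  assumes "a \<le> b" "c \<le> d"
  shows "continuous_map (skorohod_topology a b) (skorohod_topology c d) F \<longleftrightarrow>
    F ` skorohod_space a b \<subseteq> skorohod_space c d \<and>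
    (\<forall>x\<in>skorohod_space a b. \<forall>e>0. \<exists>r>0. \<forall>y. y \<in> skorohod_space a b \<and> skorohod_dist a b x y < r
        \<longrightarrow> skorohod_dist c d (F x) (F y) < e)"
  unfolding skorohod_topology_def
  by (rule Metric_space.metric_continuous_map[OF skorohod_metric_space[OF assms(1)]
        skorohod_metric_space[OF assms(2)]])

lemma continuous_map_skorohod_real_iff:
  fixes f :: "(real \<Rightarrow> real) \<Rightarrow> real"
  assumes "a \<le> b"
  shows "continuous_map (skorohod_topology a b) euclideanreal f \<longleftrightarrow>
    (\<forall>x\<in>skorohod_space a b. \<forall>e>0. \<exists>r>0. \<forall>y. y \<in> skorohod_space a b \<and> skorohod_dist a b x y < r
        \<longrightarrow> \<bar>f x - f y\<bar> < e)"
  using Metric_space.metric_continuous_map[OF skorohod_metric_space[OF assms] Met_TC.Metric_space_axioms,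
      of f]
  by (simp add: skorohod_topology_def dist_real_def)

lemma continuous_map_skorohod_Lipschitz:
  fixes f :: "(real \<Rightarrow> real) \<Rightarrow> real"
  assumes "a \<le> b" "\<And>x y. x \<in> skorohod_space a b \<Longrightarrow> y \<in> skorohod_space a b \<Longrightarrow>
      \<bar>f x - f y\<bar> \<le> k * skorohod_dist a b x y"
  shows "continuous_map (skorohod_topology a b) euclideanreal f"
  unfolding continuous_map_skorohod_real_iff[OF assms(1)]
proof (intro ballI allI impI)
  fix x and e :: real assume x: "x \<in> skorohod_space a b" and e: "e > 0"
  show "\<exists>r>0. \<forall>y. y \<in> skorohod_space a b \<and> skorohod_dist a b x y < r \<longrightarrow> \<bar>f x - f y\<bar> < e"
  proof (intro exI[of _ "e / (\<bar>k\<bar> + 1)"] conjI allI impI)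
    show "0 < e / (\<bar>k\<bar> + 1)" using e by simp
    fix y assume y: "y \<in> skorohod_space a b \<and> skorohod_dist a b x y < e / (\<bar>k\<bar> + 1)"
    have nn: "0 \<le> skorohod_dist a b x y"
      using Metric_space.nonneg[OF skorohod_metric_space[OF assms(1)]] .
    have "\<bar>f x - f y\<bar> \<le> k * skorohod_dist a b x y" using assms(2) x y by blast
    also have "\<dots> \<le> (\<bar>k\<bar> + 1) * skorohod_dist a b x y"
      by (intro mult_right_mono nn) simp
    also have "\<dots> < e" using y by (simp add: pos_less_divide_eq mult.commute)
    finally show "\<bar>f x - f y\<bar> < e" .
  qed
qed

text \<open>A time change fixes the end point, so that evaluation there is continuous on the whole space;
  evaluation at an interior time is not.\<close>

lemma skorohod_dist_right_end:
  assumes "x \<in> skorohod_space a b" "y \<in> skorohod_space a b" "a \<le> b"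
  shows "\<bar>x b - y b\<bar> \<le> skorohod_dist a b x y"
proof (rule field_le_epsilon)
  fix e :: real assume "0 < e"
  then obtain l where "l \<in> time_changes a b"
    "\<forall>t\<in>{a..b}. \<bar>l t - t\<bar> \<le> skorohod_dist a b x y + e \<and> \<bar>x t - y (l t)\<bar> \<le> skorohod_dist a b x y + e"
    using skorohod_dist_less_time_change[OF assms, of "skorohod_dist a b x y + e"] by auto
  then show "\<bar>x b - y b\<bar> \<le> skorohod_dist a b x y + e"
    using time_change_fixes_right_end[of l a b] assms(3) by force
qed

lemma bounded_abs_image:
  fixes x :: "real \<Rightarrow> real"
  assumes "bounded (x ` A)"
  shows "bounded ((\<lambda>t. \<bar>x t\<bar>) ` A)"
  using assms by (auto simp: bounded_iff)

text \<open>A time change permutes the times over which the supremum is taken, so the supremum norm does not see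
  it.\<close>

lemma skorohod_dist_sup_norm:
  assumes x: "x \<in> skorohod_space a b" and y: "y \<in> skorohod_space a b" and ab: "a \<le> b"
  shows "\<bar>(SUP t\<in>{a..b}. \<bar>x t\<bar>) - (SUP t\<in>{a..b}. \<bar>y t\<bar>)\<bar> \<le> skorohod_dist a b x y"
proof -
  have *: "(SUP t\<in>{a..b}. \<bar>x t\<bar>) \<le> (SUP t\<in>{a..b}. \<bar>y t\<bar>) + skorohod_dist a b x y"
    if x: "x \<in> skorohod_space a b" and y: "y \<in> skorohod_space a b" for x y
  proof (rule field_le_epsilon)
    fix e :: real assume "0 < e"
    then obtain l where l: "l \<in> time_changes a b"
      "\<forall>t\<in>{a..b}. \<bar>l t - t\<bar> \<le> skorohod_dist a b x y + e \<and> \<bar>x t - y (l t)\<bar> \<le> skorohod_dist a b x y + e"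
      using skorohod_dist_less_time_change[OF x y ab, of "skorohod_dist a b x y + e"] by auto
    have bdd: "bdd_above ((\<lambda>t. \<bar>y t\<bar>) ` {a..b})"
      using cadlag_bounded[of a b y] y unfolding skorohod_space_def
      by (intro bounded_imp_bdd_above bounded_abs_image) auto
    show "(SUP t\<in>{a..b}. \<bar>x t\<bar>) \<le> (SUP t\<in>{a..b}. \<bar>y t\<bar>) + skorohod_dist a b x y + e"
    proof (rule cSUP_least)
      show "{a..b} \<noteq> {}" using ab by simp
      fix t assume t: "t \<in> {a..b}"
      then have "l t \<in> {a..b}" using l(1) by (auto simp: time_changes_def)
      then have "\<bar>y (l t)\<bar> \<le> (SUP t\<in>{a..b}. \<bar>y t\<bar>)" using bdd by (rule cSUP_upper)
      moreover have "\<bar>x t - y (l t)\<bar> \<le> skorohod_dist a b x y + e" using l(2) t by blast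
      ultimately show "\<bar>x t\<bar> \<le> (SUP t\<in>{a..b}. \<bar>y t\<bar>) + skorohod_dist a b x y + e"
        by linarith
    qed
  qed
  show ?thesis
    using *[OF x y] *[OF y x] Metric_space.commute[OF skorohod_metric_space[OF ab], of x y] by linarith
qed

section \<open>Convergence in probability\<close>

text \<open>A uniform bound over paths need not define a measurable event, so the exceptional outcomes are
  only required to be covered by an event \<open>E\<close> of small probability.\<close>

definition eventually_likely :: "'a measure \<Rightarrow> real \<Rightarrow> (nat \<Rightarrow> 'a \<Rightarrow> bool) \<Rightarrow> bool" where
  "eventually_likely P d \<Phi> \<longleftrightarrow>
     (\<forall>\<^sub>F N in sequentially. \<exists>E\<in>sets P. measure P E \<le> d \<and> (\<forall>\<omega>\<in>space P - E. \<Phi> N \<omega>))"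

lemma eventually_likely_conj:
  assumes "eventually_likely P d \<Phi>" "eventually_likely P d' \<Psi>" "prob_space P"
  shows "eventually_likely P (d + d') (\<lambda>N \<omega>. \<Phi> N \<omega> \<and> \<Psi> N \<omega>)"
  using assms(1,2) unfolding eventually_likely_def
proof eventually_elim
  case (elim N)
  interpret prob_space P by fact
  obtain E E' where E: "E \<in> sets P" "measure P E \<le> d" "\<forall>\<omega>\<in>space P - E. \<Phi> N \<omega>"
    and E': "E' \<in> sets P" "measure P E' \<le> d'" "\<forall>\<omega>\<in>space P - E'. \<Psi> N \<omega>"
    using elim by blast
  have "measure P (E \<union> E') \<le> measure P E + measure P E'"
    using E(1) E'(1) by (rule measure_Un_le)
  then show ?case using E E' by (intro bexI[of _ "E \<union> E'"]) auto
qed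

lemma eventually_likely_mono:
  assumes "eventually_likely P d \<Phi>"
    and "\<forall>\<^sub>F N in sequentially. \<forall>\<omega>\<in>space P. \<Phi> N \<omega> \<longrightarrow> \<Psi> N \<omega>"
  shows "eventually_likely P d \<Psi>"
  using assms unfolding eventually_likely_def
  by eventually_elim blast

text \<open>Markov's inequality.\<close>

lemma eventually_likely_L1:
  fixes W :: "nat \<Rightarrow> 'a \<Rightarrow> real"
  assumes P: "prob_space P" and W: "\<And>N. integrable P (W N)" "\<And>N \<omega>. \<omega> \<in> space P \<Longrightarrow> 0 \<le> W N \<omega>"
    and lim: "(\<lambda>N. \<integral>\<omega>. W N \<omega> \<partial>P) \<longlonglongrightarrow> 0" and e: "0 < e" and d: "0 < d"
  shows "eventually_likely P d (\<lambda>N \<omega>. W N \<omega> \<le> e)"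
proof -
  have "\<forall>\<^sub>F N in sequentially. (\<integral>\<omega>. W N \<omega> \<partial>P) < d * e"
    using lim e d by (intro order_tendstoD) auto
  then show ?thesis
    unfolding eventually_likely_def
  proof eventually_elim
    case (elim N)
    have "measure P {\<omega>\<in>space P. W N \<omega> \<ge> e} \<le> (\<integral>\<omega>. W N \<omega> \<partial>P) / e"
      using W e by (intro integral_Markov_inequality_measure[where A="{}"]) auto
    also have "\<dots> \<le> d" using elim e by (simp add: pos_divide_le_eq)
    finally show ?case using W(1)
      by (intro bexI[of _ "{\<omega>\<in>space P. W N \<omega> \<ge> e}"]) auto
  qed
qed

section \<open>Weak convergence in the Skorohod space\<close>

lemma space_skorohod_borel: "a \<le> b \<Longrightarrow> space (skorohod_borel a b) = skorohod_space a b"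
  unfolding skorohod_borel_def using openin_subset[of "skorohod_topology a b"] topspace_skorohod
  by (intro space_measure_of) blast

lemma sets_skorohod_borel_open:
  "a \<le> b \<Longrightarrow> openin (skorohod_topology a b) U \<Longrightarrow> U \<in> sets (skorohod_borel a b)"
  unfolding skorohod_borel_def using openin_subset[of "skorohod_topology a b"] topspace_skorohod
  by (subst sets_measure_of) auto

lemma measurable_skorohod_borelI:
  assumes "a \<le> b" "\<And>\<omega>. \<omega> \<in> space P \<Longrightarrow> F \<omega> \<in> skorohod_space a b"
    and "\<And>U. openin (skorohod_topology a b) U \<Longrightarrow> F -` U \<inter> space P \<in> sets P"
  shows "F \<in> P \<rightarrow>\<^sub>M skorohod_borel a b"
  unfolding skorohod_borel_def
  using assms openin_subset[of "skorohod_topology a b"] topspace_skorohod[of a b]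
  by (intro measurable_measure_of) auto

lemma continuous_map_skorohod_measurable:
  assumes "a \<le> b" "c \<le> d" "continuous_map (skorohod_topology a b) (skorohod_topology c d) F"
  shows "F \<in> skorohod_borel a b \<rightarrow>\<^sub>M skorohod_borel c d"
proof (rule measurable_skorohod_borelI[OF assms(2)])
  show "F \<omega> \<in> skorohod_space c d" if "\<omega> \<in> space (skorohod_borel a b)" for \<omega>
    using continuous_map_funspace[OF assms(3)] that assms(1,2)
    by (auto simp: topspace_skorohod space_skorohod_borel)
  show "F -` U \<inter> space (skorohod_borel a b) \<in> sets (skorohod_borel a b)"
    if "openin (skorohod_topology c d) U" for U
    using openin_continuous_map_preimage[OF assms(3) that] assms(1)
    by (intro sets_skorohod_borel_open)
       (auto simp: topspace_skorohod space_skorohod_borel vimage_def Int_def conj_commute)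
qed

lemma continuous_map_skorohod_borel_measurable:
  fixes f :: "(real \<Rightarrow> real) \<Rightarrow> real"
  assumes "a \<le> b" "continuous_map (skorohod_topology a b) euclideanreal f"
  shows "f \<in> borel_measurable (skorohod_borel a b)"
proof (rule borel_measurableI)
  fix U :: "real set" assume "open U"
  then show "f -` U \<inter> space (skorohod_borel a b) \<in> sets (skorohod_borel a b)"
    using openin_continuous_map_preimage[OF assms(2), of U] assms(1)
    by (intro sets_skorohod_borel_open)
       (auto simp: topspace_skorohod space_skorohod_borel vimage_def Int_def conj_commute)
qed

lemma random_element_space:
  assumes "a \<le> b" "random_element a b P X" "\<omega> \<in> space P"
  shows "restrict (X \<omega>) {a..b} \<in> skorohod_space a b"
  using measurable_space assms unfolding random_element_def by (metis space_skorohod_borel)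

lemma weakly_converges_continuous_mapping:
  assumes "a \<le> b" "c \<le> d" "weakly_converges a b P X Q Z"
    and F: "continuous_map (skorohod_topology a b) (skorohod_topology c d) F"
  shows "weakly_converges c d P (\<lambda>N \<omega>. F (restrict (X N \<omega>) {a..b})) Q (\<lambda>\<omega>. F (restrict (Z \<omega>) {a..b}))"
proof -
  have F_space: "F x \<in> skorohod_space c d" if "x \<in> skorohod_space a b" for x
    using continuous_map_funspace[OF F] that assms(1,2) by (auto simp: topspace_skorohod)
  then have restr: "restrict (F x) {c..d} = F x" if "x \<in> skorohod_space a b" for x
    using that by (metis (no_types, lifting) extensional_restrict mem_Collect_eq skorohod_space_def)
  have re: "random_element c d R (\<lambda>\<omega>. F (restrict (W \<omega>) {a..b}))" if "random_element a b R W"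
    for R :: "'c measure" and W
  proof -
    have "(\<lambda>\<omega>. F (restrict (W \<omega>) {a..b})) \<in> R \<rightarrow>\<^sub>M skorohod_borel c d"
      using that continuous_map_skorohod_measurable[OF assms(1,2) F]
      unfolding random_element_def by (rule measurable_compose)
    also have "?this \<longleftrightarrow> random_element c d R (\<lambda>\<omega>. F (restrict (W \<omega>) {a..b}))"
      unfolding random_element_def
      by (intro measurable_cong) (simp add: restr random_element_space[OF assms(1) that])
    finally show ?thesis .
  qed
  have reX: "random_element a b P (X N)" for N
    using assms(3) unfolding weakly_converges_def by blast
  have reZ: "random_element a b Q Z"
    using assms(3) unfolding weakly_converges_def by blast
  have "(\<lambda>N. \<integral>\<omega>. f (restrict (F (restrict (X N \<omega>) {a..b})) {c..d}) \<partial>P)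
       \<longlonglongrightarrow> (\<integral>\<omega>. f (restrict (F (restrict (Z \<omega>) {a..b})) {c..d}) \<partial>Q)"
    if f: "continuous_map (skorohod_topology c d) euclideanreal f"
      and bd: "bounded (f ` skorohod_space c d)" for f
  proof -
    have "continuous_map (skorohod_topology a b) euclideanreal (f \<circ> F)"
      using F f by (rule continuous_map_compose)
    moreover have "bounded ((f \<circ> F) ` skorohod_space a b)"
      using bd by (rule bounded_subset) (use F_space in auto)
    ultimately have "(\<lambda>N. \<integral>\<omega>. (f \<circ> F) (restrict (X N \<omega>) {a..b}) \<partial>P)
       \<longlonglongrightarrow> (\<integral>\<omega>. (f \<circ> F) (restrict (Z \<omega>) {a..b}) \<partial>Q)"
      using assms(3) unfolding weakly_converges_def by blast
    moreover have "(\<integral>\<omega>. (f \<circ> F) (restrict (X N \<omega>) {a..b}) \<partial>P) =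
        (\<integral>\<omega>. f (restrict (F (restrict (X N \<omega>) {a..b})) {c..d}) \<partial>P)" for N
      using restr[OF random_element_space[OF assms(1) reX]]
      by (intro Bochner_Integration.integral_cong) auto
    moreover have "(\<integral>\<omega>. (f \<circ> F) (restrict (Z \<omega>) {a..b}) \<partial>Q) =
        (\<integral>\<omega>. f (restrict (F (restrict (Z \<omega>) {a..b})) {c..d}) \<partial>Q)"
      using restr[OF random_element_space[OF assms(1) reZ]]
      by (intro Bochner_Integration.integral_cong) auto
    ultimately show ?thesis by simp
  qed
  then show ?thesis
    unfolding weakly_converges_def using re[OF reX] re[OF reZ] by blast
qed



lemma bounded_continuous_map_expectation:
  assumes "a \<le> b" "prob_space P" "random_element a b P X"
    and "continuous_map (skorohod_topology a b) euclideanreal f"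
    and "\<And>x. x \<in> skorohod_space a b \<Longrightarrow> \<bar>f x\<bar> \<le> C"
  shows "integrable P (\<lambda>\<omega>. f (restrict (X \<omega>) {a..b}))"
proof (rule finite_measure.integrable_const_bound[where B=C])
  show "finite_measure P" using assms(2) by (simp add: prob_space_def)
  show "AE \<omega> in P. norm (f (restrict (X \<omega>) {a..b})) \<le> C"
    using assms(5) random_element_space[OF assms(1,3)] by (intro AE_I2) simp
  show "(\<lambda>\<omega>. f (restrict (X \<omega>) {a..b})) \<in> borel_measurable P"
    using assms(3) continuous_map_skorohod_borel_measurable[OF assms(1,4)]
    unfolding random_element_def by (rule measurable_compose)
qed

text \<open>The infimal convolution of \<open>f\<close> with \<open>k\<close> times the metric: the largest \<open>k\<close>-Lipschitz function
  below \<open>f\<close>.\<close>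

definition Lipschitz_minorant :: "real \<Rightarrow> real \<Rightarrow> ((real \<Rightarrow> real) \<Rightarrow> real) \<Rightarrow> real \<Rightarrow> (real \<Rightarrow> real) \<Rightarrow> real" where
  "Lipschitz_minorant a b f k x = (INF y\<in>skorohod_space a b. f y + k * skorohod_dist a b x y)"

lemma Lipschitz_minorant:
  assumes ab: "a \<le> b" and bd: "\<And>x. x \<in> skorohod_space a b \<Longrightarrow> \<bar>f x\<bar> \<le> C" and k: "0 \<le> k"
    and x: "x \<in> skorohod_space a b"
  shows Lipschitz_minorant_lower: "- C \<le> Lipschitz_minorant a b f k x"
    and Lipschitz_minorant_upper: "Lipschitz_minorant a b f k x \<le> f x"
    and Lipschitz_minorant_Lipschitz: "y \<in> skorohod_space a b \<Longrightarrow>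
      \<bar>Lipschitz_minorant a b f k x - Lipschitz_minorant a b f k y\<bar> \<le> k * skorohod_dist a b x y"
proof -
  let ?D = "skorohod_space a b" and ?d = "skorohod_dist a b" and ?m = "Lipschitz_minorant a b f k"
  interpret Metric_space ?D ?d by (rule skorohod_metric_space[OF ab])
  have low: "- C \<le> f z + k * ?d y z" if "z \<in> ?D" for y z
    using bd[OF that] mult_nonneg_nonneg[OF k nonneg[of y z]] by linarith
  then have bdd: "bdd_below ((\<lambda>z. f z + k * ?d y z) ` ?D)" for y
    by (intro bdd_belowI2)
  have upper: "?m y \<le> f z + k * ?d y z" if "z \<in> ?D" for y z
    unfolding Lipschitz_minorant_def by (rule cINF_lower[OF bdd that])
  show "- C \<le> ?m x"
    unfolding Lipschitz_minorant_def using x low by (intro cINF_greatest) auto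
  show "?m x \<le> f x" using upper[OF x, of x] x by simp
  have one: "?m y \<le> ?m z + k * ?d y z" if y: "y \<in> ?D" and z: "z \<in> ?D" for y z
  proof -
    have "?m y - k * ?d y z \<le> ?m z"
      unfolding Lipschitz_minorant_def[of a b f k z]
    proof (rule cINF_greatest)
      show "?D \<noteq> {}" using x by blast
      fix w assume w: "w \<in> ?D"
      have "k * ?d y w \<le> k * (?d y z + ?d z w)" by (intro mult_left_mono triangle y z w k)
      then show "?m y - k * ?d y z \<le> f w + k * ?d z w"
        using upper[OF w, of y] by (simp add: distrib_left)
    qed
    then show ?thesis by linarith
  qed
  show "\<bar>?m x - ?m y\<bar> \<le> k * ?d x y" if y: "y \<in> ?D"
    using one[OF x y] one[OF y x] commute[of x y] by simp
qed

text \<open>Within a small ball around \<open>x\<close>, continuity keeps \<open>f\<close> close to \<open>f x\<close>; outside of it the penalty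
  \<open>k * d\<close> eventually exceeds the total oscillation \<open>2 * C\<close>. So the infimum cannot stay below \<open>f x\<close>.\<close>

lemma Lipschitz_minorant_tendsto:
  assumes ab: "a \<le> b" and f: "continuous_map (skorohod_topology a b) euclideanreal f"
    and bd: "\<And>x. x \<in> skorohod_space a b \<Longrightarrow> \<bar>f x\<bar> \<le> C"
    and x: "x \<in> skorohod_space a b"
  shows "(\<lambda>k. Lipschitz_minorant a b f (real k) x) \<longlonglongrightarrow> f x"
proof (rule LIMSEQ_I)
  let ?D = "skorohod_space a b" and ?d = "skorohod_dist a b"
  interpret Metric_space ?D ?d by (rule skorohod_metric_space[OF ab])
  fix e :: real assume e: "e > 0"
  obtain r where r: "r > 0" "\<And>y. y \<in> ?D \<Longrightarrow> ?d x y < r \<Longrightarrow> \<bar>f x - f y\<bar> < e / 2"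
    using f x e unfolding continuous_map_skorohod_real_iff[OF ab] by (meson half_gt_zero)
  obtain k0 :: nat where k0: "2 * C / r \<le> real k0" using real_arch_simple by blast
  show "\<exists>no. \<forall>k\<ge>no. norm (Lipschitz_minorant a b f (real k) x - f x) < e"
  proof (intro exI allI impI)
    fix k assume k: "k \<ge> k0"
    have kr: "2 * C \<le> real k * r"
      using k0 r(1) k by (simp add: pos_divide_le_eq) (smt (verit) mult_right_mono of_nat_mono)
    have "f x - e / 2 \<le> f y + real k * ?d x y" if y: "y \<in> ?D" for y
    proof (cases "?d x y < r")
      case True
      then show ?thesis using r(2)[OF y] mult_nonneg_nonneg[of "real k" "?d x y"] nonneg[of x y]
        by (smt (verit) of_nat_0_le_iff)
    next
      case False
      then have "real k * r \<le> real k * ?d x y" by (intro mult_left_mono) auto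
      then show ?thesis using kr bd[OF x] bd[OF y] e by linarith
    qed
    then have "f x - e / 2 \<le> Lipschitz_minorant a b f (real k) x"
      unfolding Lipschitz_minorant_def using x by (intro cINF_greatest) auto
    moreover have "Lipschitz_minorant a b f (real k) x \<le> f x"
      using Lipschitz_minorant_upper[of a b f C, OF ab bd _ x] by simp
    ultimately show "norm (Lipschitz_minorant a b f (real k) x - f x) < e" using e by simp
  qed
qed

text \<open>A bounded continuous \<open>f\<close> need not be uniformly continuous, so paths that are close do not
  give close values of \<open>f\<close>. Its Lipschitz minorants \<open>g\<close> are uniformly continuous, and
  \<open>E f(X) \<ge> E g(X) \<approx> E g(X') \<approx> E g(Z) \<approx> E f(Z)\<close>, where the last step uses that the minorants increase
  to \<open>f\<close>. This bounds the lower limit of \<open>E f(X)\<close>; applying it to \<open>-f\<close> as well gives convergence.\<close>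

lemma weakly_converges_Slutsky:
  assumes ab: "a \<le> b" and P: "prob_space P" and Q: "prob_space Q"
    and wc: "weakly_converges a b P X' Q Z"
    and re: "\<And>N. random_element a b P (X N)"
    and near: "\<And>e d. 0 < e \<Longrightarrow> 0 < d \<Longrightarrow> eventually_likely P d (\<lambda>N \<omega>. \<forall>t\<in>{a..b}. \<bar>X N \<omega> t - X' N \<omega> t\<bar> \<le> e)"
  shows "weakly_converges a b P X Q Z"
proof -
  interpret P: prob_space P by fact
  interpret Q: prob_space Q by fact
  let ?D = "skorohod_space a b" and ?d = "skorohod_dist a b"
  interpret Metric_space ?D ?d by (rule skorohod_metric_space[OF ab])
  have reX': "random_element a b P (X' N)" for N
    using wc unfolding weakly_converges_def by blast
  have reZ: "random_element a b Q Z"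
    using wc unfolding weakly_converges_def by blast
  define r :: "(real \<Rightarrow> real) \<Rightarrow> real \<Rightarrow> real" where "r x = restrict x {a..b}" for x
  have lower: "\<forall>\<^sub>F N in sequentially. (\<integral>\<omega>. f (r (Z \<omega>)) \<partial>Q) - e < (\<integral>\<omega>. f (r (X N \<omega>)) \<partial>P)"
    if f: "continuous_map (skorohod_topology a b) euclideanreal f"
      and bd: "\<And>x. x \<in> ?D \<Longrightarrow> \<bar>f x\<bar> \<le> C" and e: "0 < e" for f C and e :: real
  proof -
    \<comment> \<open>The error \<open>e\<close> is split into a quarter each for the minorant, the convergence of \<open>X'\<close>, the distance of the paths, and the exceptional event.\<close>
    let ?g = "\<lambda>k. Lipschitz_minorant a b f (real k)"
    have C0: "0 \<le> C"
    proof -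
      obtain \<omega> where "\<omega> \<in> space P" using P.not_empty by blast
      from bd[OF random_element_space[OF ab re this]] show ?thesis by (meson abs_ge_zero order_trans)
    qed
    have gbd: "\<bar>?g k x\<bar> \<le> C" if "x \<in> ?D" for k x
      using Lipschitz_minorant_lower[of a b f C, OF ab bd _ that, of "real k"]
        Lipschitz_minorant_upper[of a b f C, OF ab bd _ that, of "real k"] bd[OF that] by force
    have gcont: "continuous_map (skorohod_topology a b) euclideanreal (?g k)" for k
      using Lipschitz_minorant_Lipschitz[of a b f C, OF ab bd, of "real k"]
      by (intro continuous_map_skorohod_Lipschitz[OF ab, of _ "real k"]) auto
    have gbounded: "bounded (?g k ` ?D)" for k
      using gbd[of _ k] by (auto simp: bounded_iff)
    have fint: "integrable R (\<lambda>\<omega>. f (r (W \<omega>)))" if "prob_space R" "random_element a b R W"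
      for R :: "'c measure" and W
      unfolding r_def using bounded_continuous_map_expectation[OF ab that f bd] by simp
    have gint: "integrable R (\<lambda>\<omega>. ?g k (r (W \<omega>)))" if "prob_space R" "random_element a b R W"
      for R :: "'c measure" and W k
      unfolding r_def using bounded_continuous_map_expectation[OF ab that gcont gbd] by simp
    have gintQ: "integrable Q (\<lambda>\<omega>. ?g k (r (Z \<omega>)))" for k
      unfolding r_def using bounded_continuous_map_expectation[OF ab Q reZ gcont gbd] by simp
    have fintQ: "integrable Q (\<lambda>\<omega>. f (r (Z \<omega>)))"
      unfolding r_def using bounded_continuous_map_expectation[OF ab Q reZ f bd] by simp
    have "(\<lambda>k. \<integral>\<omega>. ?g k (r (Z \<omega>)) \<partial>Q) \<longlonglongrightarrow> (\<integral>\<omega>. f (r (Z \<omega>)) \<partial>Q)"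
    proof (rule integral_dominated_convergence[where w="\<lambda>_. C"])
      show "AE \<omega> in Q. (\<lambda>k. ?g k (r (Z \<omega>))) \<longlonglongrightarrow> f (r (Z \<omega>))"
        using Lipschitz_minorant_tendsto[OF ab f bd] random_element_space[OF ab reZ]
        by (intro AE_I2) (simp add: r_def)
      show "AE \<omega> in Q. norm (?g k (r (Z \<omega>))) \<le> C" for k
        using gbd random_element_space[OF ab reZ] by (intro AE_I2) (simp add: r_def)
    qed (use gintQ fintQ in auto)
    then have "\<forall>\<^sub>F k in sequentially. (\<integral>\<omega>. f (r (Z \<omega>)) \<partial>Q) - e / 4 < (\<integral>\<omega>. ?g k (r (Z \<omega>)) \<partial>Q)"
      using e by (intro order_tendstoD) auto
    then obtain k where k: "(\<integral>\<omega>. f (r (Z \<omega>)) \<partial>Q) - e / 4 < (\<integral>\<omega>. ?g k (r (Z \<omega>)) \<partial>Q)"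
      by (meson eventually_happens trivial_limit_sequentially)
    have "(\<lambda>N. \<integral>\<omega>. ?g k (r (X' N \<omega>)) \<partial>P) \<longlonglongrightarrow> (\<integral>\<omega>. ?g k (r (Z \<omega>)) \<partial>Q)"
      using wc gcont[of k] gbounded[of k] unfolding weakly_converges_def r_def by blast
    then have ev1: "\<forall>\<^sub>F N in sequentially.
        (\<integral>\<omega>. ?g k (r (Z \<omega>)) \<partial>Q) - e / 4 < (\<integral>\<omega>. ?g k (r (X' N \<omega>)) \<partial>P)"
      using e by (intro order_tendstoD) auto
    have ev2: "\<forall>\<^sub>F N in sequentially. \<exists>E\<in>sets P. measure P E \<le> e / (8 * (C + 1)) \<and>
        (\<forall>\<omega>\<in>space P - E. \<forall>t\<in>{a..b}. \<bar>X N \<omega> t - X' N \<omega> t\<bar> \<le> e / (4 * (real k + 1)))"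
      unfolding eventually_likely_def[symmetric] using e C0 by (intro near) auto
    show ?thesis using ev1 ev2
    proof eventually_elim
      case (elim N)
      then obtain E where E: "E \<in> sets P" "measure P E \<le> e / (8 * (C + 1))"
        "\<And>\<omega> t. \<omega> \<in> space P - E \<Longrightarrow> t \<in> {a..b} \<Longrightarrow> \<bar>X N \<omega> t - X' N \<omega> t\<bar> \<le> e / (4 * (real k + 1))"
        by blast
      have pt: "?g k (r (X' N \<omega>)) \<le> f (r (X N \<omega>)) + (e / 4 + 2 * C * indicator E \<omega>)"
        if \<omega>: "\<omega> \<in> space P" for \<omega>
      proof -
        have D: "r (X N \<omega>) \<in> ?D" "r (X' N \<omega>) \<in> ?D"
          unfolding r_def using random_element_space[OF ab _ \<omega>] re reX' by blast+
        show ?thesis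
        proof (cases "\<omega> \<in> E")
          case True
          then show ?thesis using gbd[OF D(2), of k] bd[OF D(1)] e by (simp add: abs_le_iff)
        next
          case False
          have "?d (r (X' N \<omega>)) (r (X N \<omega>)) \<le> e / (4 * (real k + 1))"
            using E(3)[of \<omega>] False \<omega> e D
            by (intro skorohod_dist_le_sup_dist) (auto simp: r_def abs_minus_commute)
          then have "real k * ?d (r (X' N \<omega>)) (r (X N \<omega>)) \<le> real k * (e / (4 * (real k + 1)))"
            by (intro mult_left_mono) auto
          also have "\<dots> \<le> e / 4" using e by (simp add: divide_simps)
          finally have "?g k (r (X' N \<omega>)) \<le> ?g k (r (X N \<omega>)) + e / 4"
            using Lipschitz_minorant_Lipschitz[of a b f C, OF ab bd _ D(2) D(1), of "real k"] by simp
          also have "?g k (r (X N \<omega>)) \<le> f (r (X N \<omega>))"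
            by (rule Lipschitz_minorant_upper[of a b f C, OF ab bd _ D(1)]) simp_all
          finally show ?thesis using False by simp
        qed
      qed
      have "(\<integral>\<omega>. ?g k (r (X' N \<omega>)) \<partial>P) \<le> (\<integral>\<omega>. f (r (X N \<omega>)) + (e / 4 + 2 * C * indicator E \<omega>) \<partial>P)"
        using pt gint[OF P reX'] fint[OF P re] E(1)
        by (intro integral_mono) (auto simp: less_top[symmetric])
      also have "\<dots> = (\<integral>\<omega>. f (r (X N \<omega>)) \<partial>P) + (e / 4 + 2 * C * measure P E)"
        using fint[OF P re] E(1)
        by (subst Bochner_Integration.integral_add) (auto simp: less_top[symmetric] P.prob_space)
      also have "2 * C * measure P E \<le> 2 * (C + 1) * (e / (8 * (C + 1)))"
        using E(2) C0 by (intro mult_mono) auto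
      also have "\<dots> = e / 4" using C0 by (simp add: divide_simps)
      finally show ?case using k elim(1) by linarith
    qed
  qed
  show ?thesis
    unfolding weakly_converges_def
  proof (intro conjI allI impI re reZ)
    fix f assume f: "continuous_map (skorohod_topology a b) euclideanreal f \<and> bounded (f ` ?D)"
    then obtain C where C: "\<And>x. x \<in> ?D \<Longrightarrow> \<bar>f x\<bar> \<le> C" by (auto simp: bounded_iff)
    have f': "continuous_map (skorohod_topology a b) euclideanreal (\<lambda>x. - f x)"
      using f by (intro continuous_map_minus) auto
    show "(\<lambda>N. \<integral>\<omega>. f (restrict (X N \<omega>) {a..b}) \<partial>P) \<longlonglongrightarrow> (\<integral>\<omega>. f (restrict (Z \<omega>) {a..b}) \<partial>Q)"
      unfolding r_def[symmetric]
    proof (rule tendstoI)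
      fix e :: real assume e: "0 < e"
      have "\<forall>\<^sub>F N in sequentially. (\<integral>\<omega>. f (r (Z \<omega>)) \<partial>Q) - e < (\<integral>\<omega>. f (r (X N \<omega>)) \<partial>P)"
        using f C e by (intro lower) auto
      moreover have "\<forall>\<^sub>F N in sequentially. (\<integral>\<omega>. - f (r (Z \<omega>)) \<partial>Q) - e < (\<integral>\<omega>. - f (r (X N \<omega>)) \<partial>P)"
        using C by (intro lower[OF f' _ e]) auto
      ultimately show "\<forall>\<^sub>F N in sequentially.
          dist (\<integral>\<omega>. f (r (X N \<omega>)) \<partial>P) (\<integral>\<omega>. f (r (Z \<omega>)) \<partial>Q) < e"
        by eventually_elim (simp add: dist_real_def abs_less_iff)
    qed
  qed
qed

text \<open>The supremum norm is a continuous functional, so a continuous cut-off of it has expectations that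
  converge to the corresponding expectation under the limit, which is small for a high cut-off level.\<close>

lemma weakly_converges_tight:
  assumes ab: "a \<le> b" and P: "prob_space P" and Q: "prob_space Q"
    and wc: "weakly_converges a b P X Q Z" and d: "0 < d"
  shows "\<exists>R. eventually_likely P d (\<lambda>N \<omega>. \<forall>t\<in>{a..b}. \<bar>X N \<omega> t\<bar> \<le> R)"
proof -
  define sn where "sn x = (SUP t\<in>{a..b}. \<bar>x t\<bar>)" for x :: "real \<Rightarrow> real"
  define f where "f R x = min 1 (max 0 (sn x - R))" for R :: real and x
  have reX: "random_element a b P (X N)" for N
    using wc unfolding weakly_converges_def by blast
  have reZ: "random_element a b Q Z"
    using wc unfolding weakly_converges_def by blast
  have fcont: "continuous_map (skorohod_topology a b) euclideanreal (f R)" for R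
  proof (rule continuous_map_skorohod_Lipschitz[OF ab])
    fix x y assume "x \<in> skorohod_space a b" "y \<in> skorohod_space a b"
    from skorohod_dist_sup_norm[OF this ab] show "\<bar>f R x - f R y\<bar> \<le> 1 * skorohod_dist a b x y"
      unfolding f_def sn_def[symmetric] by linarith
  qed
  have fbd: "\<bar>f R x\<bar> \<le> 1" "0 \<le> f R x" for R x unfolding f_def by auto
  have "(\<lambda>n. \<integral>\<omega>. f (real n) (restrict (Z \<omega>) {a..b}) \<partial>Q) \<longlonglongrightarrow> (\<integral>\<omega>. 0 \<partial>Q)"
  proof (rule integral_dominated_convergence[where w="\<lambda>_. 1"])
    show "AE \<omega> in Q. (\<lambda>n. f (real n) (restrict (Z \<omega>) {a..b})) \<longlonglongrightarrow> 0"
    proof (rule AE_I2, rule tendsto_eventually)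
      fix \<omega>
      show "\<forall>\<^sub>F n in sequentially. f (real n) (restrict (Z \<omega>) {a..b}) = 0"
        using eventually_ge_at_top[of "nat \<lceil>sn (restrict (Z \<omega>) {a..b})\<rceil>"]
      proof eventually_elim
        case (elim n)
        then have "sn (restrict (Z \<omega>) {a..b}) \<le> real n" by linarith
        then show ?case by (simp add: f_def)
      qed
    qed
    interpret Q: prob_space Q by fact
    show "integrable Q (\<lambda>_. 1 :: real)" by simp
    show "(\<lambda>\<omega>. f (real n) (restrict (Z \<omega>) {a..b})) \<in> borel_measurable Q" for n
      using bounded_continuous_map_expectation[OF ab Q reZ fcont fbd(1)] by (rule borel_measurable_integrable)
  qed (use fbd in auto)
  then have "\<forall>\<^sub>F n in sequentially. (\<integral>\<omega>. f (real n) (restrict (Z \<omega>) {a..b}) \<partial>Q) < d"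
    using d by (intro order_tendstoD) auto
  then obtain R where R: "(\<integral>\<omega>. f R (restrict (Z \<omega>) {a..b}) \<partial>Q) < d"
    by (meson eventually_happens trivial_limit_sequentially)
  have "bounded (f R ` skorohod_space a b)" using fbd(1) by (auto simp: bounded_iff)
  then have "(\<lambda>N. \<integral>\<omega>. f R (restrict (X N \<omega>) {a..b}) \<partial>P) \<longlonglongrightarrow> (\<integral>\<omega>. f R (restrict (Z \<omega>) {a..b}) \<partial>Q)"
    using wc fcont[of R] unfolding weakly_converges_def by blast
  then have "\<forall>\<^sub>F N in sequentially. (\<integral>\<omega>. f R (restrict (X N \<omega>) {a..b}) \<partial>P) < d"
    using R by (rule order_tendstoD)
  then have "eventually_likely P d (\<lambda>N \<omega>. \<forall>t\<in>{a..b}. \<bar>X N \<omega> t\<bar> \<le> R + 1)"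
    unfolding eventually_likely_def
  proof eventually_elim
    case (elim N)
    \<comment> \<open>The cut-off equals \<open>1\<close> exactly when the supremum norm is at least \<open>R + 1\<close>.\<close>
    let ?E = "{\<omega>\<in>space P. f R (restrict (X N \<omega>) {a..b}) \<ge> 1}"
    have int: "integrable P (\<lambda>\<omega>. f R (restrict (X N \<omega>) {a..b}))"
      using bounded_continuous_map_expectation[OF ab P reX fcont fbd(1)] .
    have "measure P ?E \<le> (\<integral>\<omega>. f R (restrict (X N \<omega>) {a..b}) \<partial>P) / 1"
      using int fbd by (intro integral_Markov_inequality_measure[where A="{}"]) auto
    moreover have "?E \<in> sets P" using int by measurable
    moreover have "\<bar>X N \<omega> t\<bar> \<le> R + 1" if \<omega>: "\<omega> \<in> space P - ?E" and t: "t \<in> {a..b}" for \<omega> t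
    proof -
      have "restrict (X N \<omega>) {a..b} \<in> skorohod_space a b"
        using random_element_space[OF ab reX] \<omega> by blast
      then have "cadlag_on a b (restrict (X N \<omega>) {a..b})" by (simp add: skorohod_space_def)
      then have "bdd_above ((\<lambda>t. \<bar>restrict (X N \<omega>) {a..b} t\<bar>) ` {a..b})"
        by (intro bounded_imp_bdd_above bounded_abs_image cadlag_bounded)
      then have "\<bar>restrict (X N \<omega>) {a..b} t\<bar> \<le> sn (restrict (X N \<omega>) {a..b})"
        unfolding sn_def using t by (intro cSUP_upper)
      moreover have "f R (restrict (X N \<omega>) {a..b}) < 1" using \<omega> by auto
      ultimately show ?thesis using t unfolding f_def by (simp split: if_splits add: min_def max_def)
    qed
    ultimately show ?case using elim by (intro bexI[of _ ?E]) auto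
  qed
  then show ?thesis by blast
qed

section \<open>Cadlag paths\<close>

lemma cadlag_on_cong:
  assumes "cadlag_on a b x" "\<And>t. t \<in> {a..b} \<Longrightarrow> x t = y t"
  shows "cadlag_on a b y"
  unfolding cadlag_on_def
proof (intro conjI allI impI)
  fix t assume t: "a \<le> t \<and> t < b"
  then have "(x \<longlongrightarrow> x t) (at_right t)" using assms(1) by (auto simp: cadlag_on_def)
  moreover have "\<forall>\<^sub>F s in at_right t. x s = y s"
    using t assms(2) by (intro eventually_at_rightI[of t b]) auto
  ultimately show "(y \<longlongrightarrow> y t) (at_right t)"
    using t assms(2)[of t] by (simp add: tendsto_cong)
next
  fix t assume t: "a < t \<and> t \<le> b"
  then obtain l where "(x \<longlongrightarrow> l) (at_left t)" using assms(1) by (auto simp: cadlag_on_def)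
  moreover have "\<forall>\<^sub>F s in at_left t. x s = y s"
    using t assms(2) by (intro eventually_at_leftI[of a t]) auto
  ultimately show "\<exists>l. (y \<longlongrightarrow> l) (at_left t)" by (auto simp: tendsto_cong)
qed

lemma cadlag_on_restrict: "cadlag_on a b (restrict x {a..b}) \<longleftrightarrow> cadlag_on a b x"
  using cadlag_on_cong[of a b x "restrict x {a..b}"] cadlag_on_cong[of a b "restrict x {a..b}" x]
  by auto

lemma restrict_in_skorohod_space: "restrict x {a..b} \<in> skorohod_space a b \<longleftrightarrow> cadlag_on a b x"
  by (simp add: skorohod_space_def cadlag_on_restrict)

lemma continuous_on_imp_cadlag_on:
  assumes "continuous_on {a..b} x"
  shows "cadlag_on a b x"
  unfolding cadlag_on_def
proof (intro conjI allI impI)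
  have c: "(x \<longlongrightarrow> x t) (at t within {a..b})" if "t \<in> {a..b}" for t
    using assms that by (auto simp: continuous_on_def)
  fix t
  show "(x \<longlongrightarrow> x t) (at_right t)" if "a \<le> t \<and> t < b"
    using tendsto_within_subset[OF c[of t], of "{t..b}"] that at_within_Icc_at_right[of t b]
    by auto
  show "\<exists>l. (x \<longlongrightarrow> l) (at_left t)" if "a < t \<and> t \<le> b"
    using tendsto_within_subset[OF c[of t], of "{a..t}"] that at_within_Icc_at_left[of a t]
    by auto
qed

text \<open>One-sided limits force the oscillation to be small on both sides of every point \<open>p\<close>, so the points
  of large oscillation cannot accumulate anywhere in the compact interval.\<close>

lemma cadlag_on_finite_oscillations:
  assumes x: "cadlag_on a b x" and e: "e > 0"
  shows "finite {t\<in>{a<..<b}. \<not> (\<exists>d>0. \<forall>s. \<bar>s - t\<bar> < d \<longrightarrow> \<bar>x s - x t\<bar> < e)}" (is "finite ?D")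
proof (rule ccontr)
  assume inf: "infinite ?D"
  have "?D \<subseteq> {a..b}" by auto
  then obtain p where p: "p \<in> {a..b}" "p islimpt ?D"
    using compact_eq_Bolzano_Weierstrass[of "{a..b}"] inf by auto
  \<comment> \<open>Values within \<open>e / 2\<close> of a common level \<open>l\<close> are within \<open>e\<close> of each other.\<close>
  have calm: "t \<notin> ?D" if l: "\<And>s. s \<in> {c<..<d} \<Longrightarrow> \<bar>x s - l\<bar> < e / 2" and t: "t \<in> {c<..<d}" for c d l t
  proof -
    have "min (t - c) (d - t) > 0" using t by simp
    moreover have "\<bar>x s - x t\<bar> < e" if "\<bar>s - t\<bar> < min (t - c) (d - t)" for s
    proof -
      have "s \<in> {c<..<d}" using that by (auto simp: abs_less_iff)
      then show ?thesis using l[of s] l[OF t] by linarith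
    qed
    ultimately show ?thesis by blast
  qed
  have right: "\<exists>d>p. \<forall>t\<in>{p<..<d}. t \<notin> ?D"
  proof (cases "p < b")
    case True
    then have "(x \<longlongrightarrow> x p) (at_right p)" using x p by (auto simp: cadlag_on_def)
    from tendstoD[OF this, of "e / 2"] e
    obtain d where "d > p" "\<And>s. s \<in> {p<..<d} \<Longrightarrow> \<bar>x s - x p\<bar> < e / 2"
      by (auto simp: eventually_at_right_field dist_real_def)
    then show ?thesis using calm[of p d "x p"] by blast
  next
    case False
    then show ?thesis using p by (intro exI[of _ "p + 1"]) auto
  qed
  have left: "\<exists>c<p. \<forall>t\<in>{c<..<p}. t \<notin> ?D"
  proof (cases "a < p")
    case True
    then obtain l where "(x \<longlongrightarrow> l) (at_left p)" using x p by (auto simp: cadlag_on_def)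
    from tendstoD[OF this, of "e / 2"] e
    obtain c where "c < p" "\<And>s. s \<in> {c<..<p} \<Longrightarrow> \<bar>x s - l\<bar> < e / 2"
      by (auto simp: eventually_at_left_field dist_real_def)
    then show ?thesis using calm[of c p l] by blast
  next
    case False
    then show ?thesis using p by (intro exI[of _ "p - 1"]) auto
  qed
  obtain c d where cd: "c < p" "p < d" "\<And>t. t \<in> {c<..<p} \<Longrightarrow> t \<notin> ?D" "\<And>t. t \<in> {p<..<d} \<Longrightarrow> t \<notin> ?D"
    using left right by blast
  have "p \<in> {c<..<d}" using cd by simp
  then obtain t where "t \<in> ?D" "t \<in> {c<..<d}" "t \<noteq> p"
    using p(2) unfolding islimpt_def by (meson open_greaterThanLessThan)
  then show False using cd(3)[of t] cd(4)[of t] by (meson greaterThanLessThan_iff linorder_neqE)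
qed

lemma cadlag_on_countable_discontinuities:
  assumes "cadlag_on a b x"
  shows "countable {t\<in>{a<..<b}. \<not> isCont x t}"
proof -
  have "{t\<in>{a<..<b}. \<not> isCont x t} \<subseteq>
    (\<Union>n. {t\<in>{a<..<b}. \<not> (\<exists>d>0. \<forall>s. \<bar>s - t\<bar> < d \<longrightarrow> \<bar>x s - x t\<bar> < 1 / real (Suc n))})" (is "_ \<subseteq> (\<Union>n. ?D n)")
  proof safe
    fix t assume t: "t \<in> {a<..<b}" "\<not> isCont x t"
    show "t \<in> (\<Union>n. ?D n)"
    proof (rule ccontr)
      assume "t \<notin> (\<Union>n. ?D n)"
      then have *: "\<exists>d>0. \<forall>s. \<bar>s - t\<bar> < d \<longrightarrow> \<bar>x s - x t\<bar> < 1 / real (Suc n)" for n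
        using t(1) by blast
      have "isCont x t"
        unfolding continuous_at_eps_delta
      proof (intro allI impI)
        fix e :: real assume "e > 0"
        then obtain n where n: "1 / real (Suc n) < e"
          using reals_Archimedean by (auto simp: inverse_eq_divide)
        show "\<exists>d>0. \<forall>s. dist s t < d \<longrightarrow> dist (x s) (x t) < e"
          using *[of n] n unfolding dist_real_def by (meson less_trans)
      qed
      then show False using t(2) by blast
    qed
  qed
  moreover have "countable (\<Union>n. ?D n)"
    using cadlag_on_finite_oscillations[OF assms] by (intro countable_UN) (auto intro!: countable_finite)
  ultimately show ?thesis by (rule countable_subset)
qed

lemma cadlag_on_borel_measurable:
  assumes "cadlag_on a b x"
  shows "(\<lambda>t. indicator {a..b} t * x t) \<in> borel_measurable borel"
proof (rule borel_measurable_continuous_countable_exceptions)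
  let ?X = "{a, b} \<union> {t\<in>{a<..<b}. \<not> isCont x t}"
  show "countable ?X" using cadlag_on_countable_discontinuities[OF assms] by simp
  show "continuous_on (- ?X) (\<lambda>t. indicator {a..b} t * x t)"
  proof (rule continuous_at_imp_continuous_on, rule ballI)
    fix t assume t: "t \<in> - ?X"
    consider "t < a" | "b < t" | "a < t" "t < b" using t by force
    then show "isCont (\<lambda>t. indicator {a..b} t * x t) t"
    proof cases
      case 1
      then have "\<forall>\<^sub>F s in nhds t. indicator {a..b} s * x s = 0"
        using eventually_nhds_in_open[of "{..<a}" t] by (auto elim!: eventually_mono)
      from isCont_cong[OF this] show ?thesis by simp
    next
      case 2
      then have "\<forall>\<^sub>F s in nhds t. indicator {a..b} s * x s = 0"
        using eventually_nhds_in_open[of "{b<..}" t] by (auto elim!: eventually_mono)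
      from isCont_cong[OF this] show ?thesis by simp
    next
      case 3
      then have "\<forall>\<^sub>F s in nhds t. indicator {a..b} s * x s = x s"
        using eventually_nhds_in_open[of "{a<..<b}" t] by (auto elim!: eventually_mono)
      from isCont_cong[OF this] show ?thesis using t 3 by simp
    qed
  qed
qed

text \<open>The time changes tend to the identity uniformly, which does no harm at a time where the limit is
  continuous.\<close>

lemma skorohod_convergence_pointwise:
  assumes ab: "a \<le> b" and x: "x \<in> skorohod_space a b" and xs: "\<And>n. xs n \<in> skorohod_space a b"
    and lim: "(\<lambda>n. skorohod_dist a b (xs n) x) \<longlonglongrightarrow> 0" and t: "t \<in> {a<..<b}" "isCont x t"
  shows "(\<lambda>n. xs n t) \<longlonglongrightarrow> x t"
proof (rule tendstoI)
  fix e :: real assume e: "e > 0"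
  then obtain d where d: "d > 0" "\<And>s. \<bar>s - t\<bar> < d \<Longrightarrow> \<bar>x s - x t\<bar> < e / 2"
    using t(2) unfolding continuous_at_eps_delta dist_real_def by (meson half_gt_zero)
  have "\<forall>\<^sub>F n in sequentially. skorohod_dist a b (xs n) x < min (d / 2) (e / 2)"
    using lim d e by (intro order_tendstoD) auto
  then show "\<forall>\<^sub>F n in sequentially. dist (xs n t) (x t) < e"
  proof eventually_elim
    case (elim n)
    from skorohod_dist_less_time_change[OF xs x ab this] t(1)
    obtain l where l: "\<bar>l t - t\<bar> \<le> min (d / 2) (e / 2)" "\<bar>xs n t - x (l t)\<bar> \<le> min (d / 2) (e / 2)"
      by fastforce
    then have "\<bar>x (l t) - x t\<bar> < e / 2" using d by (intro d) linarith
    then show ?case using l(2) unfolding dist_real_def by linarith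
  qed
qed

section \<open>Step processes\<close>

lemma cadlag_on_step: "cadlag_on a b (\<lambda>s. c (nat \<lfloor>real N * s\<rfloor>))"
proof (cases "N = 0")
  case True
  then show ?thesis by (auto simp: cadlag_on_def)
next
  case False
  then have N: "0 < real N" by simp
  have right: "\<forall>\<^sub>F s in at_right t. \<lfloor>real N * s\<rfloor> = \<lfloor>real N * t\<rfloor>" for t
  proof (rule eventually_at_rightI)
    show "t < (of_int \<lfloor>real N * t\<rfloor> + 1) / real N"
      using N by (simp add: pos_less_divide_eq mult.commute)
    fix s assume "s \<in> {t<..<(of_int \<lfloor>real N * t\<rfloor> + 1) / real N}"
    then have "real N * t < real N * s" "real N * s < of_int \<lfloor>real N * t\<rfloor> + 1"
      using N by (auto simp: pos_less_divide_eq mult.commute)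
    then show "\<lfloor>real N * s\<rfloor> = \<lfloor>real N * t\<rfloor>" by linarith
  qed
  have left: "\<forall>\<^sub>F s in at_left t. \<lfloor>real N * s\<rfloor> = \<lceil>real N * t\<rceil> - 1" for t
  proof (rule eventually_at_leftI)
    show "(of_int \<lceil>real N * t\<rceil> - 1) / real N < t"
      using N by (simp add: pos_divide_less_eq mult.commute) linarith
    fix s assume "s \<in> {(of_int \<lceil>real N * t\<rceil> - 1) / real N<..<t}"
    then have "real N * s < real N * t" "of_int \<lceil>real N * t\<rceil> - 1 < real N * s"
      using N by (auto simp: pos_divide_less_eq mult.commute)
    then show "\<lfloor>real N * s\<rfloor> = \<lceil>real N * t\<rceil> - 1" by linarith
  qed
  show ?thesis
    unfolding cadlag_on_def
  proof (intro conjI allI impI)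
    fix t
    show "((\<lambda>s. c (nat \<lfloor>real N * s\<rfloor>)) \<longlongrightarrow> c (nat \<lfloor>real N * t\<rfloor>)) (at_right t)"
      using right[of t] by (intro tendsto_eventually) (auto elim: eventually_mono)
    show "\<exists>l. ((\<lambda>s. c (nat \<lfloor>real N * s\<rfloor>)) \<longlongrightarrow> l) (at_left t)"
      using left[of t]
      by (intro exI[of _ "c (nat (\<lceil>real N * t\<rceil> - 1))"] tendsto_eventually) (auto elim: eventually_mono)
  qed
qed

text \<open>A step path depends continuously on its finitely many values, even for the supremum norm. So
  measurability with respect to the Skorohod Borel sets reduces to measurability of the coefficients.\<close>

lemma random_element_step:
  fixes c :: "nat \<Rightarrow> 'a \<Rightarrow> real"
  assumes ab: "a \<le> b" and c: "\<And>k. k \<le> nat \<lfloor>real N * b\<rfloor> \<Longrightarrow> c k \<in> borel_measurable P"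
    and X: "\<And>\<omega> s. \<omega> \<in> space P \<Longrightarrow> s \<in> {a..b} \<Longrightarrow> X \<omega> s = c (nat \<lfloor>real N * s\<rfloor>) \<omega>"
  shows "random_element a b P X"
proof -
  let ?n = "nat \<lfloor>real N * b\<rfloor>"
  interpret Metric_space "skorohod_space a b" "skorohod_dist a b" by (rule skorohod_metric_space[OF ab])
  define F where "F v = restrict (\<lambda>s. v (nat \<lfloor>real N * s\<rfloor>)) {a..b}" for v :: "nat \<Rightarrow> real"
  have F: "F v \<in> skorohod_space a b" for v
    by (simp add: F_def restrict_in_skorohod_space cadlag_on_step)
  \<comment> \<open>Only the coefficients that the path uses are known to be measurable; the others are set to zero.\<close>
  define V where "V \<omega> k = (if k \<le> ?n then c k \<omega> else 0)" for \<omega> k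
  have idx: "nat \<lfloor>real N * s\<rfloor> \<le> ?n" if "s \<in> {a..b}" for s
    using that by (intro nat_mono floor_mono mult_left_mono) auto
  have XF: "restrict (X \<omega>) {a..b} = F (V \<omega>)" if "\<omega> \<in> space P" for \<omega>
    using X[OF that] idx by (auto simp: F_def V_def restrict_def fun_eq_iff)
  have V: "V \<in> borel_measurable P"
  proof (rule measurable_coordinatewise_then_product)
    show "(\<lambda>\<omega>. V \<omega> k) \<in> borel_measurable P" for k
      using c by (cases "k \<le> ?n") (simp_all add: V_def)
  qed
  have "open (F -` U)" if U: "openin (skorohod_topology a b) U" for U
  proof (subst openin_subopen[where U=euclidean, simplified open_openin[symmetric]], rule ballI)
    fix v assume "v \<in> F -` U"
    then have "F v \<in> U" by simp
    then obtain r where r: "r > 0" "mball (F v) r \<subseteq> U"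
      using U unfolding skorohod_topology_def openin_mtopology by blast
    define T where "T = (\<Inter>k\<le>?n. {w. dist (w k) (v k) < r / 2})"
    have "open T" unfolding T_def
      by (intro open_INT ballI open_Collect_less continuous_intros) auto
    moreover have "v \<in> T" using r by (simp add: T_def)
    moreover have "T \<subseteq> F -` U"
    proof
      fix w assume w: "w \<in> T"
      have "skorohod_dist a b (F v) (F w) \<le> r / 2"
      proof (rule skorohod_dist_le_sup_dist[OF F F])
        fix t assume t: "t \<in> {a..b}"
        have "dist (w (nat \<lfloor>real N * t\<rfloor>)) (v (nat \<lfloor>real N * t\<rfloor>)) < r / 2"
          using w idx[OF t] by (simp add: T_def)
        then show "\<bar>F v t - F w t\<bar> \<le> r / 2"
          using t by (simp add: F_def dist_real_def abs_minus_commute)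
      qed (use r in simp)
      then have "F w \<in> mball (F v) r" using F r by simp
      then show "w \<in> F -` U" using r by blast
    qed
    ultimately show "\<exists>T. open T \<and> v \<in> T \<and> T \<subseteq> F -` U" by blast
  qed
  then have FV: "V -` (F -` U) \<inter> space P \<in> sets P" if "openin (skorohod_topology a b) U" for U
    using measurable_sets[OF V, of "F -` U"] that by simp
  have "(\<lambda>\<omega>. F (V \<omega>)) \<in> P \<rightarrow>\<^sub>M skorohod_borel a b"
    using F FV by (intro measurable_skorohod_borelI[OF ab]) (auto simp: vimage_def)
  also have "?this \<longleftrightarrow> random_element a b P X"
    unfolding random_element_def using XF by (intro measurable_cong) simp
  finally show ?thesis .
qed



section \<open>The limit functional\<close>

lemma set_integrable_bounded_mult:
  fixes q k :: "real \<Rightarrow> real"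
  assumes q: "(\<lambda>t. indicator {a..b} t * q t) \<in> borel_measurable borel"
    and k: "k \<in> borel_measurable borel"
    and C: "\<And>t. t \<in> {a..b} \<Longrightarrow> \<bar>q t\<bar> \<le> C" and D: "\<And>t. t \<in> {a..b} \<Longrightarrow> \<bar>k t\<bar> \<le> D"
    and A: "A \<in> sets borel" "A \<subseteq> {a..b}"
  shows "set_integrable lborel A (\<lambda>t. q t * k t)"
proof (rule set_integrable_subset)
  show "set_integrable lborel {a..b} (\<lambda>t. q t * k t)"
    unfolding set_integrable_def
  proof (rule integrableI_bounded_set[where A="{a..b}" and B="\<bar>C\<bar> * \<bar>D\<bar>"])
    have "(\<lambda>t. (indicator {a..b} t * q t) * k t) \<in> borel_measurable lborel"
      using q k by measurable
    then show "(\<lambda>t. indicator {a..b} t *\<^sub>R (q t * k t)) \<in> borel_measurable lborel"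
      by (simp add: mult.assoc)
    show "AE t in lborel. t \<in> {a..b} \<longrightarrow> norm (indicator {a..b} t *\<^sub>R (q t * k t)) \<le> \<bar>C\<bar> * \<bar>D\<bar>"
    proof (intro AE_I2 impI)
      fix t assume t: "t \<in> {a..b}"
      have "\<bar>q t\<bar> * \<bar>k t\<bar> \<le> \<bar>C\<bar> * \<bar>D\<bar>" using C[OF t] D[OF t] by (intro mult_mono) auto
      then show "norm (indicator {a..b} t *\<^sub>R (q t * k t)) \<le> \<bar>C\<bar> * \<bar>D\<bar>" using t by (simp add: abs_mult)
    qed
  qed (auto simp: emeasure_lborel_Icc_eq)
qed (use A in auto)

lemma set_integral_abs_le:
  fixes f :: "real \<Rightarrow> real"
  assumes "set_integrable lborel A f" "A \<in> sets borel" "emeasure lborel A < \<infinity>"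
    and "\<And>t. t \<in> A \<Longrightarrow> \<bar>f t\<bar> \<le> C"
  shows "\<bar>LBINT t:A. f t\<bar> \<le> C * measure lborel A"
proof -
  have "\<bar>LBINT t:A. f t\<bar> \<le> (LBINT t:A. \<bar>f t\<bar>)"
    using set_integral_norm_bound[OF assms(1)] by simp
  also have "\<dots> \<le> (LBINT t:A. C)"
    using assms by (intro set_integral_mono set_integrable_abs) (auto simp: set_integrable_def)
  also have "\<dots> = C * measure lborel A"
    using assms by (simp add: set_integral_const)
  finally show ?thesis .
qed

definition smoothed_integral :: "(real \<Rightarrow> real) \<Rightarrow> real \<Rightarrow> (real \<Rightarrow> real) \<Rightarrow> real \<Rightarrow> real" where
  "smoothed_integral K \<zeta> q s = (LBINT r:{0..s}. q r * K (\<zeta> * (r - s)))"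

locale smoothing_kernel =
  fixes K :: "real \<Rightarrow> real" and L \<zeta> :: real
  assumes K_Lipschitz: "L-lipschitz_on UNIV K" and \<zeta>_nonneg: "0 \<le> \<zeta>"
begin

lemma L_nonneg: "0 \<le> L"
  using K_Lipschitz by (rule lipschitz_on_nonneg)

lemma K_diff: "\<bar>K x - K y\<bar> \<le> L * \<bar>x - y\<bar>"
  using lipschitz_onD[OF K_Lipschitz, of x y] by (simp add: dist_real_def)

lemma K_borel [measurable]: "K \<in> borel_measurable borel"
  by (rule borel_measurable_continuous_onI[OF lipschitz_on_continuous_on[OF K_Lipschitz]])

text \<open>A bound of the kernel on the only range that matters: \<open>\<zeta> * (r - s)\<close> with \<open>r\<close> and \<open>s\<close> in the unit
  interval.\<close>

definition K_bound :: real where "K_bound = \<bar>K 0\<bar> + L * \<zeta>"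

lemma K_bound_nonneg: "0 \<le> K_bound"
  using L_nonneg \<zeta>_nonneg by (simp add: K_bound_def)

lemma K_le_bound:
  assumes "r \<in> {0..1}" "s \<in> {0..1}"
  shows "\<bar>K (\<zeta> * (r - s))\<bar> \<le> K_bound"
proof -
  have "\<bar>K (\<zeta> * (r - s)) - K 0\<bar> \<le> L * \<bar>\<zeta> * (r - s)\<bar>" using K_diff[of "\<zeta> * (r - s)" 0] by simp
  also have "\<dots> \<le> L * (\<zeta> * 1)"
    unfolding abs_mult using assms \<zeta>_nonneg L_nonneg by (intro mult_left_mono mult_mono) auto
  finally show ?thesis unfolding K_bound_def by linarith
qed

context
  fixes q :: "real \<Rightarrow> real" and C :: real
  assumes q_meas: "(\<lambda>t. indicator {0..1} t * q t) \<in> borel_measurable borel"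
    and q_bound: "\<And>t. t \<in> {0..1} \<Longrightarrow> \<bar>q t\<bar> \<le> C"
begin

lemma q_bound_nonneg: "0 \<le> C"
  using q_bound[of 0] by (meson abs_ge_zero atLeastAtMost_iff order_trans order_refl zero_le_one)

lemma smoothing_integrable:
  assumes "A \<in> sets borel" "A \<subseteq> {0..1}" "s \<in> {0..1}"
  shows "set_integrable lborel A (\<lambda>r. q r * K (\<zeta> * (r - s)))"
  using q_bound K_le_bound[OF _ assms(3)] assms(1,2)
  by (intro set_integrable_bounded_mult[OF q_meas]) auto

text \<open>Moving \<open>s\<close> changes the integrand through the Lipschitz kernel, and the domain of integration by an
  interval of length \<open>s' - s\<close>. Both changes are of order \<open>s' - s\<close>.\<close>

lemma smoothed_integral_Lipschitz:
  assumes "0 \<le> s" "s \<le> s'" "s' \<le> 1"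
  shows "\<bar>smoothed_integral K \<zeta> q s' - smoothed_integral K \<zeta> q s\<bar> \<le> C * (L * \<zeta> + K_bound) * (s' - s)"
proof -
  note C = q_bound_nonneg
  have int: "set_integrable lborel A (\<lambda>r. q r * K (\<zeta> * (r - t)))"
    if "A \<in> sets borel" "A \<subseteq> {0..1}" "t \<in> {s, s'}" for A t
    using that assms by (intro smoothing_integrable) auto
  have "smoothed_integral K \<zeta> q s' =
      (LBINT r:{0..s}. q r * K (\<zeta> * (r - s'))) + (LBINT r:{s<..s'}. q r * K (\<zeta> * (r - s')))"
    unfolding smoothed_integral_def using assms
    by (subst set_integral_Un[symmetric]) (auto intro!: int simp: ivl_disj_un)
  moreover have "(LBINT r:{0..s}. q r * K (\<zeta> * (r - s'))) - smoothed_integral K \<zeta> q s =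
      (LBINT r:{0..s}. q r * K (\<zeta> * (r - s')) - q r * K (\<zeta> * (r - s)))"
    unfolding smoothed_integral_def using assms by (intro set_integral_diff(2)[symmetric] int) auto
  moreover have "\<bar>LBINT r:{0..s}. q r * K (\<zeta> * (r - s')) - q r * K (\<zeta> * (r - s))\<bar>
      \<le> C * (L * \<zeta> * (s' - s)) * measure lborel {0..s}"
  proof (rule set_integral_abs_le)
    fix r assume r: "r \<in> {0..s}"
    have "\<bar>K (\<zeta> * (r - s')) - K (\<zeta> * (r - s))\<bar> \<le> L * \<bar>\<zeta> * (r - s') - \<zeta> * (r - s)\<bar>" by (rule K_diff)
    also have "\<zeta> * (r - s') - \<zeta> * (r - s) = - (\<zeta> * (s' - s))" by (simp add: algebra_simps)
    finally have "\<bar>K (\<zeta> * (r - s')) - K (\<zeta> * (r - s))\<bar> \<le> L * \<zeta> * (s' - s)"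
      using \<zeta>_nonneg assms by (simp add: abs_mult)
    then show "\<bar>q r * K (\<zeta> * (r - s')) - q r * K (\<zeta> * (r - s))\<bar> \<le> C * (L * \<zeta> * (s' - s))"
      unfolding right_diff_distrib[symmetric] abs_mult
      using q_bound[of r] r assms C by (intro mult_mono) auto
  qed (use assms in \<open>auto intro!: int set_integral_diff simp: emeasure_lborel_Icc_eq\<close>)
  moreover have "C * (L * \<zeta> * (s' - s)) * measure lborel {0..s} \<le> C * (L * \<zeta> * (s' - s)) * 1"
    using assms C L_nonneg \<zeta>_nonneg by (intro mult_left_mono) auto
  moreover have "\<bar>LBINT r:{s<..s'}. q r * K (\<zeta> * (r - s'))\<bar> \<le> C * K_bound * measure lborel {s<..s'}"
  proof (rule set_integral_abs_le)
    fix r assume r: "r \<in> {s<..s'}"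
    show "\<bar>q r * K (\<zeta> * (r - s'))\<bar> \<le> C * K_bound"
      unfolding abs_mult using q_bound[of r] K_le_bound[of r s'] r assms C by (intro mult_mono) auto
  qed (use assms in \<open>auto intro!: int simp: emeasure_lborel_Ioc\<close>)
  moreover have "measure lborel {s<..s'} = s' - s" using assms by simp
  ultimately show ?thesis by (simp add: algebra_simps)
qed

lemma smoothed_integral_continuous_on: "continuous_on {0..1} (smoothed_integral K \<zeta> q)"
proof (rule lipschitz_on_continuous_on)
  let ?M = "C * (L * \<zeta> + K_bound)"
  note C = q_bound_nonneg
  show "?M-lipschitz_on {0..1} (smoothed_integral K \<zeta> q)"
  proof (rule lipschitz_onI)
    fix s s' :: real assume s: "s \<in> {0..1}" "s' \<in> {0..1}"
    show "dist (smoothed_integral K \<zeta> q s) (smoothed_integral K \<zeta> q s') \<le> ?M * dist s s'"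
      using smoothed_integral_Lipschitz[of s s'] smoothed_integral_Lipschitz[of s' s] s
      by (cases "s \<le> s'") (auto simp: dist_real_def abs_minus_commute)
  qed (use C L_nonneg \<zeta>_nonneg K_bound_nonneg in auto)
qed

lemma smoothed_integral_bound:
  assumes s: "s \<in> {0..1}"
  shows "\<bar>smoothed_integral K \<zeta> q s\<bar> \<le> C * K_bound"
proof -
  note C = q_bound_nonneg
  have "\<bar>smoothed_integral K \<zeta> q s\<bar> \<le> C * K_bound * measure lborel {0..s}"
    unfolding smoothed_integral_def
  proof (rule set_integral_abs_le)
    fix r assume r: "r \<in> {0..s}"
    show "\<bar>q r * K (\<zeta> * (r - s))\<bar> \<le> C * K_bound"
      unfolding abs_mult using q_bound[of r] K_le_bound[of r s] r s C by (intro mult_mono) auto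
  qed (use s in \<open>auto intro!: smoothing_integrable simp: emeasure_lborel_Icc_eq\<close>)
  also have "\<dots> \<le> C * K_bound * 1"
    using s C K_bound_nonneg by (intro mult_left_mono) auto
  finally show ?thesis by simp
qed

end

lemma smoothed_integral_diff:
  assumes q: "(\<lambda>t. indicator {0..1} t * q t) \<in> borel_measurable borel"
    "\<And>t. t \<in> {0..1} \<Longrightarrow> \<bar>q t\<bar> \<le> C"
    and p: "(\<lambda>t. indicator {0..1} t * p t) \<in> borel_measurable borel"
    "\<And>t. t \<in> {0..1} \<Longrightarrow> \<bar>p t\<bar> \<le> C"
    and s: "s \<in> {0..1}"
  shows "\<bar>smoothed_integral K \<zeta> q s - smoothed_integral K \<zeta> p s\<bar>
      \<le> K_bound * (LBINT r:{0..1}. \<bar>q r - p r\<bar>)"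
proof -
  have "set_integrable lborel {0..1} (\<lambda>r. q r * 1)"
    by (rule set_integrable_bounded_mult[OF q(1) _ q(2), where D=1]) auto
  moreover have "set_integrable lborel {0..1} (\<lambda>r. p r * 1)"
    by (rule set_integrable_bounded_mult[OF p(1) _ p(2), where D=1]) auto
  ultimately have int: "set_integrable lborel {0..1} (\<lambda>r. \<bar>q r - p r\<bar>)"
    by (intro set_integrable_abs set_integral_diff) simp_all
  have diff: "smoothed_integral K \<zeta> q s - smoothed_integral K \<zeta> p s =
      (LBINT r:{0..s}. q r * K (\<zeta> * (r - s)) - p r * K (\<zeta> * (r - s)))"
    unfolding smoothed_integral_def using s
    by (intro set_integral_diff(2)[symmetric] smoothing_integrable[OF q] smoothing_integrable[OF p]) auto
  have "\<bar>smoothed_integral K \<zeta> q s - smoothed_integral K \<zeta> p s\<bar> \<le> (LBINT r:{0..s}. \<bar>q r * K (\<zeta> * (r - s)) - p r * K (\<zeta> * (r - s))\<bar>)"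
    unfolding diff using s set_integral_norm_bound[of lborel "{0..s}"
        "\<lambda>r. q r * K (\<zeta> * (r - s)) - p r * K (\<zeta> * (r - s))"]
      set_integral_diff(1)[OF smoothing_integrable[OF q] smoothing_integrable[OF p], of "{0..s}" s s]
    by auto
  also have "\<dots> \<le> (LBINT r:{0..s}. K_bound * \<bar>q r - p r\<bar>)"
  proof (rule set_integral_mono)
    show "set_integrable lborel {0..s} (\<lambda>r. K_bound * \<bar>q r - p r\<bar>)"
      using s by (intro set_integrable_mult_right set_integrable_subset[OF int]) auto
    show "set_integrable lborel {0..s} (\<lambda>r. \<bar>q r * K (\<zeta> * (r - s)) - p r * K (\<zeta> * (r - s))\<bar>)"
      using s by (intro set_integrable_abs set_integral_diff smoothing_integrable[OF q] smoothing_integrable[OF p]) auto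
    fix r assume "r \<in> {0..s}"
    then have "\<bar>K (\<zeta> * (r - s))\<bar> \<le> K_bound" using s by (intro K_le_bound) auto
    then have "\<bar>q r - p r\<bar> * \<bar>K (\<zeta> * (r - s))\<bar> \<le> \<bar>q r - p r\<bar> * K_bound" by (intro mult_left_mono) auto
    then show "\<bar>q r * K (\<zeta> * (r - s)) - p r * K (\<zeta> * (r - s))\<bar> \<le> K_bound * \<bar>q r - p r\<bar>"
      by (simp add: left_diff_distrib[symmetric] abs_mult mult.commute)
  qed
  also have "\<dots> \<le> (LBINT r:{0..1}. K_bound * \<bar>q r - p r\<bar>)"
    unfolding set_lebesgue_integral_def
  proof (rule integral_mono)
    show "integrable lborel (\<lambda>r. indicator {0..s} r *\<^sub>R (K_bound * \<bar>q r - p r\<bar>))"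
      "integrable lborel (\<lambda>r. indicator {0..1} r *\<^sub>R (K_bound * \<bar>q r - p r\<bar>))"
      unfolding set_integrable_def[symmetric] using s
      by (intro set_integrable_mult_right set_integrable_subset[OF int]; simp)+
    show "indicator {0..s} r *\<^sub>R (K_bound * \<bar>q r - p r\<bar>) \<le> indicator {0..1} r *\<^sub>R (K_bound * \<bar>q r - p r\<bar>)"
      for r using s K_bound_nonneg by (auto simp: indicator_def)
  qed
  also have "\<dots> = K_bound * (LBINT r:{0..1}. \<bar>q r - p r\<bar>)" by simp
  finally show ?thesis .
qed

end

lemma cadlag_add_square:
  assumes "cadlag_on 0 1 x" "cadlag_on 0 1 y"
  shows "(\<lambda>t. indicator {0..1} t * (x t + y t)\<^sup>2) \<in> borel_measurable borel"
proof -
  have "(\<lambda>t. (indicator {0..1} t * x t + indicator {0..1} t * y t)\<^sup>2) \<in> borel_measurable borel"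
    using assms[THEN cadlag_on_borel_measurable] by measurable
  also have "(\<lambda>t. (indicator {0..1} t * x t + indicator {0..1} t * y t)\<^sup>2) =
      (\<lambda>t. indicator {0..1} t * (x t + y t)\<^sup>2)"
    by (auto simp: indicator_def fun_eq_iff)
  finally show ?thesis .
qed

lemma cadlag_on_bound:
  assumes "cadlag_on a b x"
  obtains C where "0 \<le> C" "\<And>t. t \<in> {a..b} \<Longrightarrow> \<bar>x t\<bar> \<le> C"
proof -
  obtain C where "\<And>t. t \<in> {a..b} \<Longrightarrow> \<bar>x t\<bar> \<le> C"
    using cadlag_bounded[OF assms] unfolding bounded_iff by fastforce
  then have "\<bar>x t\<bar> \<le> \<bar>C\<bar>" if "t \<in> {a..b}" for t using that by force
  then show ?thesis using that[of "\<bar>C\<bar>"] by simp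
qed

lemma abs_add_square_le:
  fixes x y :: real
  assumes "\<bar>x\<bar> \<le> A" "\<bar>y\<bar> \<le> B"
  shows "\<bar>(x + y)\<^sup>2\<bar> \<le> (A + B)\<^sup>2"
proof -
  have "\<bar>x + y\<bar> \<le> \<bar>A + B\<bar>" using assms by linarith
  then show ?thesis by (simp add: abs_le_square_iff)
qed

text \<open>The map that sends a path \<open>\<sigma> B\<close> of the limiting partial sums to the limit process; \<open>v\<close> stands for
  the second moment of the errors.\<close>

definition limit_map ::
  "(real \<Rightarrow> real) \<Rightarrow> real \<Rightarrow> real \<Rightarrow> (real \<Rightarrow> real) \<Rightarrow> real \<Rightarrow> (real \<Rightarrow> real) \<Rightarrow> real \<Rightarrow> real" where
  "limit_map K \<zeta> v \<mu> \<kappa> x =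
     restrict (\<lambda>s. 1 / (s * v) * \<zeta> * smoothed_integral K \<zeta> (\<lambda>r. (\<mu> r + x r)\<^sup>2) s) {\<kappa>..1}"

context smoothing_kernel
begin

lemma limit_path_continuous:
  assumes \<mu>: "cadlag_on 0 1 \<mu>" and x: "cadlag_on 0 1 x" and \<kappa>: "0 < \<kappa>" and v: "0 < v"
  shows "continuous_on {\<kappa>..1} (\<lambda>s. 1 / (s * v) * \<zeta> * smoothed_integral K \<zeta> (\<lambda>r. (\<mu> r + x r)\<^sup>2) s)"
proof -
  obtain A where A: "\<And>t. t \<in> {0..1} \<Longrightarrow> \<bar>\<mu> t\<bar> \<le> A" using cadlag_on_bound[OF \<mu>] by blast
  obtain B where B: "\<And>t. t \<in> {0..1} \<Longrightarrow> \<bar>x t\<bar> \<le> B" using cadlag_on_bound[OF x] by blast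
  have "continuous_on {0..1} (smoothed_integral K \<zeta> (\<lambda>r. (\<mu> r + x r)\<^sup>2))"
    by (rule smoothed_integral_continuous_on[OF cadlag_add_square[OF \<mu> x] abs_add_square_le[OF A B]])
  then have "continuous_on {\<kappa>..1} (smoothed_integral K \<zeta> (\<lambda>r. (\<mu> r + x r)\<^sup>2))"
    by (rule continuous_on_subset) (use \<kappa> in auto)
  then show ?thesis using \<kappa> v by (intro continuous_intros) auto
qed

lemma limit_map_in_skorohod_space:
  assumes "cadlag_on 0 1 \<mu>" "x \<in> skorohod_space 0 1" "0 < \<kappa>" "0 < v"
  shows "limit_map K \<zeta> v \<mu> \<kappa> x \<in> skorohod_space \<kappa> 1"
  unfolding limit_map_def restrict_in_skorohod_space
  using assms by (intro continuous_on_imp_cadlag_on[OF limit_path_continuous]) (auto simp: skorohod_space_def)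

text \<open>Skorohod convergence gives pointwise convergence off the countable set of discontinuities of the
  limit, and hence convergence in mean by dominated convergence.\<close>

lemma square_integral_tendsto:
  assumes \<mu>: "cadlag_on 0 1 \<mu>" and x: "x \<in> skorohod_space 0 1" and xs: "\<And>n. xs n \<in> skorohod_space 0 1"
    and lim: "(\<lambda>n. skorohod_dist 0 1 (xs n) x) \<longlonglongrightarrow> 0"
    and A: "\<And>t. t \<in> {0..1} \<Longrightarrow> \<bar>\<mu> t\<bar> \<le> A" and B: "\<And>n t. t \<in> {0..1} \<Longrightarrow> \<bar>xs n t\<bar> \<le> B"
    and B': "\<And>t. t \<in> {0..1} \<Longrightarrow> \<bar>x t\<bar> \<le> B"
  shows "(\<lambda>n. LBINT r:{0..1}. \<bar>(\<mu> r + xs n r)\<^sup>2 - (\<mu> r + x r)\<^sup>2\<bar>) \<longlonglongrightarrow> 0"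
proof -
  let ?f = "\<lambda>n r. indicator {0..1} r *\<^sub>R \<bar>(\<mu> r + xs n r)\<^sup>2 - (\<mu> r + x r)\<^sup>2\<bar>"
  have cx: "cadlag_on 0 1 x" and cxs: "\<And>n. cadlag_on 0 1 (xs n)"
    using x xs by (auto simp: skorohod_space_def)
  have "(\<lambda>n. \<integral>r. ?f n r \<partial>lborel) \<longlonglongrightarrow> (\<integral>r. 0 \<partial>(lborel :: real measure))"
  proof (rule integral_dominated_convergence[where w="\<lambda>r. indicator {0..1} r *\<^sub>R (2 * (A + B)\<^sup>2)"])
    show "(\<lambda>r. 0) \<in> borel_measurable lborel" by simp
    show "?f n \<in> borel_measurable lborel" for n
    proof -
      have "(\<lambda>r. \<bar>indicator {0..1} r * (\<mu> r + xs n r)\<^sup>2 - indicator {0..1} r * (\<mu> r + x r)\<^sup>2\<bar>)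
          \<in> borel_measurable lborel"
        using cadlag_add_square[OF \<mu> cxs[of n]] cadlag_add_square[OF \<mu> cx] by measurable
      also have "(\<lambda>r. \<bar>indicator {0..1} r * (\<mu> r + xs n r)\<^sup>2 - indicator {0..1} r * (\<mu> r + x r)\<^sup>2\<bar>) = ?f n"
        by (auto simp: indicator_def fun_eq_iff)
      finally show ?thesis .
    qed
    show "integrable lborel (\<lambda>r::real. indicator {0..1} r *\<^sub>R (2 * (A + B)\<^sup>2))"
      by (intro integrable_scaleR_left integrable_real_indicator) (auto simp: emeasure_lborel_Icc_eq)
    show "AE r in lborel. norm (?f n r) \<le> indicator {0..1} r *\<^sub>R (2 * (A + B)\<^sup>2)" for n
    proof (rule AE_I2)
      fix r :: real
      show "norm (?f n r) \<le> indicator {0..1} r *\<^sub>R (2 * (A + B)\<^sup>2)"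
      proof (cases "r \<in> {0..1}")
        case True
        have "\<bar>(\<mu> r + xs n r)\<^sup>2\<bar> \<le> (A + B)\<^sup>2" "\<bar>(\<mu> r + x r)\<^sup>2\<bar> \<le> (A + B)\<^sup>2"
          using A[OF True] B[OF True] B'[OF True] by (intro abs_add_square_le; simp)+
        moreover have "0 \<le> (\<mu> r + xs n r)\<^sup>2" "0 \<le> (\<mu> r + x r)\<^sup>2" by simp_all
        ultimately have "\<bar>(\<mu> r + xs n r)\<^sup>2 - (\<mu> r + x r)\<^sup>2\<bar> \<le> 2 * (A + B)\<^sup>2" by linarith
        then show ?thesis using True by simp
      qed simp
    qed
    have "countable ({0, 1} \<union> {t\<in>{0<..<1}. \<not> isCont x t})"
      using cadlag_on_countable_discontinuities[OF cx] by simp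
    then have "AE r in lborel. r \<notin> {0, 1} \<union> {t\<in>{0<..<1}. \<not> isCont x t}"
      by (intro AE_not_in countable_imp_null_set_lborel)
    then show "AE r in lborel. (\<lambda>n. ?f n r) \<longlonglongrightarrow> 0"
    proof eventually_elim
      case (elim r)
      show ?case
      proof (cases "r \<in> {0..1}")
        case True
        then have "(\<lambda>n. xs n r) \<longlonglongrightarrow> x r"
          using elim by (intro skorohod_convergence_pointwise[OF _ x xs lim]) auto
        then have "(\<lambda>n. \<bar>(\<mu> r + xs n r)\<^sup>2 - (\<mu> r + x r)\<^sup>2\<bar>) \<longlonglongrightarrow> \<bar>(\<mu> r + x r)\<^sup>2 - (\<mu> r + x r)\<^sup>2\<bar>"
          by (intro tendsto_intros)
        then show ?thesis using True by simp
      qed simp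
    qed
  qed
  then show ?thesis by (simp add: set_lebesgue_integral_def)
qed

text \<open>Continuity holds at every path, not only at continuous ones: the path enters only through an
  integral, which is controlled by the \<open>L\<^sup>1\<close> distance of the squares, uniformly in \<open>s\<close>.\<close>

lemma limit_map_continuous:
  assumes \<mu>: "cadlag_on 0 1 \<mu>" and \<kappa>: "0 < \<kappa>" "\<kappa> \<le> 1" and v: "0 < v"
  shows "continuous_map (skorohod_topology 0 1) (skorohod_topology \<kappa> 1) (limit_map K \<zeta> v \<mu> \<kappa>)"
  unfolding continuous_map_skorohod_iff[OF zero_le_one \<kappa>(2)]
proof (intro conjI ballI allI impI)
  let ?H = "limit_map K \<zeta> v \<mu> \<kappa>"
  show "?H ` skorohod_space 0 1 \<subseteq> skorohod_space \<kappa> 1"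
    using limit_map_in_skorohod_space[OF \<mu> _ \<kappa>(1) v] by auto
  fix x and e :: real assume x: "x \<in> skorohod_space 0 1" and e: "e > 0"
  interpret D: Metric_space "skorohod_space 0 1" "skorohod_dist 0 1" by (rule skorohod_metric_space) simp
  obtain A where A: "\<And>t. t \<in> {0..1} \<Longrightarrow> \<bar>\<mu> t\<bar> \<le> A" using cadlag_on_bound[OF \<mu>] by blast
  obtain B where B: "\<And>t. t \<in> {0..1} \<Longrightarrow> \<bar>x t\<bar> \<le> B"
    using cadlag_on_bound[of 0 1 x] x by (auto simp: skorohod_space_def)
  show "\<exists>r>0. \<forall>y. y \<in> skorohod_space 0 1 \<and> skorohod_dist 0 1 x y < r
      \<longrightarrow> skorohod_dist \<kappa> 1 (?H x) (?H y) < e"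
  proof (rule ccontr)
    assume contra: "\<not> ?thesis"
    have "\<exists>y. y \<in> skorohod_space 0 1 \<and> skorohod_dist 0 1 x y < 1 / real (Suc n)
        \<and> e \<le> skorohod_dist \<kappa> 1 (?H x) (?H y)" for n
      using contra by (metis not_less of_nat_0_less_iff zero_less_Suc zero_less_divide_1_iff)
    \<comment> \<open>Paths that violate continuity at the radii \<open>1 / (n + 1)\<close> form a sequence to which dominated convergence applies.\<close>
    then obtain xs where xs: "\<And>n. xs n \<in> skorohod_space 0 1"
      "\<And>n. skorohod_dist 0 1 x (xs n) < 1 / real (Suc n)"
      "\<And>n. e \<le> skorohod_dist \<kappa> 1 (?H x) (?H (xs n))" by metis
    have lim: "(\<lambda>n. skorohod_dist 0 1 (xs n) x) \<longlonglongrightarrow> 0"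
    proof (rule tendsto_sandwich[where f="\<lambda>_. 0" and h="\<lambda>n. 1 / real (Suc n)"])
      show "\<forall>\<^sub>F n in sequentially. skorohod_dist 0 1 (xs n) x \<le> 1 / real (Suc n)"
        using xs(2) by (intro always_eventually allI) (metis D.commute less_imp_le)
    qed (auto simp: LIMSEQ_Suc lim_1_over_n[THEN LIMSEQ_Suc] simp del: of_nat_Suc)
    have Bn: "\<bar>xs n t\<bar> \<le> B + 1" if t: "t \<in> {0..1}" for n t
    proof -
      have "skorohod_dist 0 1 (xs n) x < 1"
      proof -
        have "1 / real (Suc n) \<le> 1" by simp
        then show ?thesis using xs(2)[of n] D.commute[of x "xs n"] by linarith
      qed
      from skorohod_dist_less_time_change[OF xs(1) x _ this]
      obtain l where l: "l \<in> time_changes 0 1" "\<bar>xs n t - x (l t)\<bar> \<le> 1" using t by fastforce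
      then have "l t \<in> {0..1}" using t by (auto simp: time_changes_def)
      then show ?thesis using B[of "l t"] l(2) by linarith
    qed
    have Bx: "\<bar>x t\<bar> \<le> B + 1" if "t \<in> {0..1}" for t using B[OF that] by simp
    let ?q = "\<lambda>x r. (\<mu> r + x r)\<^sup>2"
    have cx: "cadlag_on 0 1 x" and cxs: "\<And>n. cadlag_on 0 1 (xs n)"
      using x xs(1) by (auto simp: skorohod_space_def)
    define I where "I n = (LBINT r:{0..1}. \<bar>?q (xs n) r - ?q x r\<bar>)" for n
    have "(\<lambda>n. \<zeta> / (\<kappa> * v) * (K_bound * I n)) \<longlonglongrightarrow> \<zeta> / (\<kappa> * v) * (K_bound * 0)"
      unfolding I_def by (intro tendsto_intros square_integral_tendsto[OF \<mu> x xs(1) lim A Bn Bx])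
    then have "\<forall>\<^sub>F n in sequentially. \<zeta> / (\<kappa> * v) * (K_bound * I n) < e"
      using e by (intro order_tendstoD) auto
    then obtain n where n: "\<zeta> / (\<kappa> * v) * (K_bound * I n) < e"
      by (meson eventually_happens trivial_limit_sequentially)
    have "skorohod_dist \<kappa> 1 (?H x) (?H (xs n)) \<le> \<zeta> / (\<kappa> * v) * (K_bound * I n)"
    proof (rule skorohod_dist_le_sup_dist)
      show "?H x \<in> skorohod_space \<kappa> 1" "?H (xs n) \<in> skorohod_space \<kappa> 1"
        using limit_map_in_skorohod_space[OF \<mu> _ \<kappa>(1) v] x xs(1) by auto
      have I0: "0 \<le> I n" unfolding I_def set_lebesgue_integral_def by (intro integral_nonneg_AE) auto
      then show "0 \<le> \<zeta> / (\<kappa> * v) * (K_bound * I n)" using \<zeta>_nonneg \<kappa> v K_bound_nonneg by simp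
      fix s assume s: "s \<in> {\<kappa>..1}"
      have "\<bar>smoothed_integral K \<zeta> (?q (xs n)) s - smoothed_integral K \<zeta> (?q x) s\<bar> \<le> K_bound * I n"
        unfolding I_def using s \<kappa>
        by (intro smoothed_integral_diff[OF cadlag_add_square[OF \<mu> cxs[of n]] abs_add_square_le[OF A Bn[of _ n]]
              cadlag_add_square[OF \<mu> cx] abs_add_square_le[OF A Bx]]) auto
      moreover have "\<zeta> / (s * v) \<le> \<zeta> / (\<kappa> * v)"
        using s \<kappa> v \<zeta>_nonneg by (intro divide_left_mono mult_right_mono) auto
      ultimately have "\<zeta> / (s * v) * \<bar>smoothed_integral K \<zeta> (?q (xs n)) s - smoothed_integral K \<zeta> (?q x) s\<bar>
          \<le> \<zeta> / (\<kappa> * v) * (K_bound * I n)"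
        using \<zeta>_nonneg \<kappa> v by (intro mult_mono) auto
      moreover have "?H x s - ?H (xs n) s =
          - (\<zeta> / (s * v) * (smoothed_integral K \<zeta> (?q (xs n)) s - smoothed_integral K \<zeta> (?q x) s))"
        using s by (simp add: limit_map_def algebra_simps)
      moreover have "0 \<le> \<zeta> / (s * v)" using s \<kappa> v \<zeta>_nonneg by simp
      ultimately show "\<bar>?H x s - ?H (xs n) s\<bar> \<le> \<zeta> / (\<kappa> * v) * (K_bound * I n)"
        by (simp only: abs_minus_cancel abs_mult abs_of_nonneg)
    qed
    then show False using xs(3)[of n] n by linarith
  qed
qed

end



section \<open>Riemann sums\<close>

lemma step_integral_estimate:
  fixes g :: "real \<Rightarrow> real" and v :: "nat \<Rightarrow> real"
  assumes N: "0 < N" and g: "set_integrable lborel {0..<real n / real N} g"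
    and near: "\<And>i r. i < n \<Longrightarrow> real i / real N \<le> r \<Longrightarrow> r < real (Suc i) / real N \<Longrightarrow> \<bar>g r - v i\<bar> \<le> e"
  shows "\<bar>(LBINT r:{0..<real n / real N}. g r) - (\<Sum>i<n. v i) / real N\<bar> \<le> e * (real n / real N)"
  using g near
proof (induction n)
  case 0
  then show ?case by (simp add: set_lebesgue_integral_def)
next
  case (Suc n)
  let ?a = "real n / real N" and ?b = "real (Suc n) / real N"
  have ab: "0 \<le> ?a" "?a \<le> ?b" "?b - ?a = 1 / real N"
    using N by (auto simp: divide_right_mono diff_divide_distrib[symmetric])
  have int: "set_integrable lborel {0..<?a} g" "set_integrable lborel {?a..<?b} g"
    using ab by (intro set_integrable_subset[OF Suc.prems(1)]; auto intro: order_trans[OF ab(1)])+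
  have split: "{0..<?b} = {0..<?a} \<union> {?a..<?b}"
    using ab by (auto intro: order_trans[OF ab(1)])
  have "(LBINT r:{0..<?b}. g r) = (LBINT r:{0..<?a}. g r) + (LBINT r:{?a..<?b}. g r)"
    unfolding split by (rule set_integral_Un[OF _ int]) auto
  moreover have "(LBINT r:{?a..<?b}. g r - v n) = (LBINT r:{?a..<?b}. g r) - v n / real N"
    using ab int N
    by (subst set_integral_diff) (auto simp: set_integrable_def set_integral_const emeasure_lborel_Ico)
  moreover have "\<bar>LBINT r:{?a..<?b}. g r - v n\<bar> \<le> e * measure lborel {?a..<?b}"
  proof (rule set_integral_abs_le)
    show "set_integrable lborel {?a..<?b} (\<lambda>r. g r - v n)"
      using int ab by (intro set_integral_diff) (auto simp: set_integrable_def emeasure_lborel_Ico)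
    show "\<bar>g t - v n\<bar> \<le> e" if "t \<in> {?a..<?b}" for t using Suc.prems(2)[of n t] that by simp
  qed (use ab in \<open>auto simp: emeasure_lborel_Ico\<close>)
  moreover have "e * measure lborel {?a..<?b} = e * (1 / real N)" using ab by simp
  moreover have "\<bar>(LBINT r:{0..<?a}. g r) - (\<Sum>i<n. v i) / real N\<bar> \<le> e * ?a"
    using Suc.prems(2) by (intro Suc.IH int) auto
  ultimately have "\<bar>(LBINT r:{0..<?b}. g r) - ((\<Sum>i<n. v i) / real N + v n / real N)\<bar>
      \<le> e * ?a + e * (1 / real N)" by linarith
  also have "e * ?a + e * (1 / real N) = e * ?b" by (simp add: add_divide_distrib distrib_left)
  finally show ?case by (simp add: add_divide_distrib)
qed

context smoothing_kernel
begin

text \<open>Replacing \<open>\<zeta>\<close> by a nearby \<open>c\<close> and the time lag \<open>r - s\<close> by its discretisation \<open>d\<close>; here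
  \<open>c\<close> will be \<open>N / h\<close> and \<open>\<delta>\<close> will be \<open>1 / N\<close>.\<close>

lemma kernel_perturbation:
  assumes r: "r \<in> {0..1}" and s: "s \<in> {0..1}" and c: "0 \<le> c" and d: "\<bar>(r - s) - d\<bar> \<le> \<delta>"
  shows "\<bar>\<zeta> * K (\<zeta> * (r - s)) - c * K (c * d)\<bar>
    \<le> \<bar>\<zeta> - c\<bar> * K_bound + c * (L * (\<bar>\<zeta> - c\<bar> + c * \<delta>))"
proof -
  have 1: "\<bar>(\<zeta> - c) * (r - s)\<bar> \<le> \<bar>\<zeta> - c\<bar> * 1"
    unfolding abs_mult using r s by (intro mult_left_mono) auto
  have 2: "\<bar>c * ((r - s) - d)\<bar> \<le> c * \<delta>" using c d by (simp add: abs_mult mult_left_mono)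
  have 3: "\<bar>\<zeta> * (r - s) - c * d\<bar> \<le> \<bar>(\<zeta> - c) * (r - s)\<bar> + \<bar>c * ((r - s) - d)\<bar>"
    using abs_triangle_ineq[of "(\<zeta> - c) * (r - s)" "c * ((r - s) - d)"] by (simp add: algebra_simps)
  have arg: "\<bar>\<zeta> * (r - s) - c * d\<bar> \<le> \<bar>\<zeta> - c\<bar> + c * \<delta>"
    using order_trans[OF 3 add_mono[OF 1 2]] by simp
  have "\<bar>K (\<zeta> * (r - s)) - K (c * d)\<bar> \<le> L * \<bar>\<zeta> * (r - s) - c * d\<bar>" by (rule K_diff)
  also have "\<dots> \<le> L * (\<bar>\<zeta> - c\<bar> + c * \<delta>)" using arg L_nonneg by (rule mult_left_mono)
  finally have "\<bar>c * (K (\<zeta> * (r - s)) - K (c * d))\<bar> \<le> c * (L * (\<bar>\<zeta> - c\<bar> + c * \<delta>))"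
    using c by (simp add: abs_mult mult_left_mono)
  moreover have "\<bar>(\<zeta> - c) * K (\<zeta> * (r - s))\<bar> \<le> \<bar>\<zeta> - c\<bar> * K_bound"
    unfolding abs_mult by (intro mult_left_mono K_le_bound r s) auto
  moreover have "\<zeta> * K (\<zeta> * (r - s)) - c * K (c * d) =
      (\<zeta> - c) * K (\<zeta> * (r - s)) + c * (K (\<zeta> * (r - s)) - K (c * d))" by (simp add: algebra_simps)
  ultimately show ?thesis by linarith
qed

text \<open>The terms stem, in this order, from the distance \<open>\<eta>\<close> between the squared path and its discrete
  version, from the discretised kernel, from the piece of the integral between \<open>\<lfloor>Ns\<rfloor> / N\<close> and \<open>s\<close>, and from
  the last term of the sum, whose cell \<open>[n/N, (n+1)/N)\<close> reaches beyond \<open>s\<close>.\<close>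

definition riemann_error :: "real \<Rightarrow> real \<Rightarrow> nat \<Rightarrow> real \<Rightarrow> real" where
  "riemann_error C c N \<eta> =
     \<zeta> * K_bound * \<eta> + C * (\<bar>\<zeta> - c\<bar> * K_bound + c * (L * (\<bar>\<zeta> - c\<bar> + c * (1 / real N))))
     + \<zeta> * (C * K_bound) / real N + c * C * \<bar>K 0\<bar> / real N"

lemma riemann_error_tendsto:
  assumes "c \<longlonglongrightarrow> \<zeta>" "\<eta> \<longlonglongrightarrow> 0"
  shows "(\<lambda>N. riemann_error C (c N) N (\<eta> N)) \<longlonglongrightarrow> 0"
proof -
  have "(\<lambda>N. riemann_error C (c N) N (\<eta> N)) \<longlonglongrightarrow>
     \<zeta> * K_bound * 0 + C * (\<bar>\<zeta> - \<zeta>\<bar> * K_bound + \<zeta> * (L * (\<bar>\<zeta> - \<zeta>\<bar> + \<zeta> * 0))) + 0 + 0"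
    unfolding riemann_error_def
    by (intro tendsto_intros assms lim_1_over_n real_tendsto_divide_at_top[OF _ filterlim_real_sequentially])
       (auto intro!: tendsto_intros assms)
  then show ?thesis by simp
qed

text \<open>On the cell \<open>[i/N, (i+1)/N)\<close> the integrand is close to the \<open>i\<close>-th summand. The cells cover
  \<open>[0, n/N)\<close> with the indices \<open>0, \<dots>, n - 1\<close>, whereas the sum runs over \<open>1, \<dots>, n\<close>: the term of index
  \<open>0\<close> vanishes because partial sums start at zero, and the term of index \<open>n\<close> is of order \<open>1 / N\<close>.\<close>

lemma smoothed_integral_riemann_sum:
  fixes w :: "nat \<Rightarrow> real"
  assumes q: "(\<lambda>t. indicator {0..1} t * q t) \<in> borel_measurable borel"
    "\<And>t. t \<in> {0..1} \<Longrightarrow> \<bar>q t\<bar> \<le> C"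
    and w: "w 0 = 0" "\<And>i. i \<le> N \<Longrightarrow> \<bar>w i\<bar> \<le> C"
    and near: "\<And>t. t \<in> {0..1} \<Longrightarrow> \<bar>q t - w (nat \<lfloor>real N * t\<rfloor>)\<bar> \<le> \<eta>"
    and N: "0 < N" and c: "0 \<le> c" and s: "s \<in> {0..1}"
  defines "n \<equiv> nat \<lfloor>real N * s\<rfloor>"
  shows "\<bar>\<zeta> * smoothed_integral K \<zeta> q s - c / real N * (\<Sum>i=1..n. w i * K (c * ((real i - real n) / real N)))\<bar>
    \<le> riemann_error C c N \<eta>"
proof -
  define k where "k i = c * K (c * ((real i - real n) / real N))" for i
  define e where "e = \<zeta> * K_bound * \<eta> + C * (\<bar>\<zeta> - c\<bar> * K_bound + c * (L * (\<bar>\<zeta> - c\<bar> + c * (1 / real N))))"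
  let ?g = "\<lambda>r. \<zeta> * (q r * K (\<zeta> * (r - s)))" and ?a = "real n / real N"
  have C: "0 \<le> C" using w(2)[of 0] by simp
  have \<eta>: "0 \<le> \<eta>" using near[of 0] by (meson abs_ge_zero atLeastAtMost_iff order_trans order_refl zero_le_one)
  have Ns: "0 \<le> real N * s" using s by simp
  then have n_floor: "real n \<le> real N * s" "real N * s < real n + 1" unfolding n_def by linarith+
  have a: "0 \<le> ?a" "?a \<le> s" "s - ?a \<le> 1 / real N"
  proof -
    show "0 \<le> ?a" by simp
    show "?a \<le> s" using n_floor(1) N by (simp add: pos_divide_le_eq mult.commute)
    have "s \<le> (real n + 1) / real N" using n_floor(2) N by (simp add: pos_le_divide_eq mult.commute)
    then show "s - ?a \<le> 1 / real N" by (simp add: add_divide_distrib)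
  qed
  have nN: "n \<le> N"
  proof -
    have "real N * s \<le> real N * 1" using s by (intro mult_left_mono) auto
    then show ?thesis using n_floor(1) by linarith
  qed
  have e0: "0 \<le> e"
    unfolding e_def using C \<eta> c \<zeta>_nonneg L_nonneg K_bound_nonneg by (intro add_nonneg_nonneg mult_nonneg_nonneg) auto
  have int: "set_integrable lborel A ?g" if "A \<in> sets borel" "A \<subseteq> {0..1}" for A
    using smoothing_integrable[OF q that s] by simp
  have near': "\<bar>?g r - w i * k i\<bar> \<le> e"
    if i: "i < n" "real i / real N \<le> r" "r < real (Suc i) / real N" for i r
  proof -
    have "real (Suc i) / real N \<le> ?a" using i(1) by (intro divide_right_mono) auto
    then have r: "r \<in> {0..1}" using i a s by (auto intro: order_trans[of 0 "real i / real N"])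
    have Nr: "real i \<le> real N * r" "real N * r < real i + 1"
      using i N by (auto simp: divide_simps mult.commute)
    then have fl: "nat \<lfloor>real N * r\<rfloor> = i" by linarith
    have "real i / real N \<le> r" "r \<le> real i / real N + 1 / real N"
      using i(2,3) by (auto simp: add_divide_distrib)
    then have d: "\<bar>(r - s) - (real i - real n) / real N\<bar> \<le> 1 / real N"
      unfolding diff_divide_distrib using a by linarith
    have 1: "\<bar>w i\<bar> * \<bar>\<zeta> * K (\<zeta> * (r - s)) - k i\<bar>
        \<le> C * (\<bar>\<zeta> - c\<bar> * K_bound + c * (L * (\<bar>\<zeta> - c\<bar> + c * (1 / real N))))"
      unfolding k_def using kernel_perturbation[OF r s c d] w(2)[of i] i(1) nN C by (intro mult_mono) auto
    have 2: "\<bar>\<zeta> * K (\<zeta> * (r - s))\<bar> * \<bar>q r - w i\<bar> \<le> \<zeta> * K_bound * \<eta>"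
      using near[OF r] K_le_bound[OF r s] \<zeta>_nonneg K_bound_nonneg
      unfolding fl by (intro mult_mono) (auto simp: abs_mult mult_left_mono)
    have 3: "?g r - w i * k i =
        (\<zeta> * K (\<zeta> * (r - s))) * (q r - w i) + w i * (\<zeta> * K (\<zeta> * (r - s)) - k i)"
      by (simp add: algebra_simps)
    show ?thesis
      unfolding 3 e_def
      by (rule order_trans[OF abs_triangle_ineq]) (use add_mono[OF 2 1] in \<open>simp only: abs_mult\<close>)
  qed
  have "\<bar>(LBINT r:{0..<?a}. ?g r) - (\<Sum>i<n. w i * k i) / real N\<bar> \<le> e * ?a"
    using a s by (intro step_integral_estimate[OF N int near']) auto
  also have "\<dots> \<le> e * 1" using a s by (intro mult_left_mono e0) auto
  finally have main: "\<bar>(LBINT r:{0..<?a}. ?g r) - (\<Sum>i<n. w i * k i) / real N\<bar> \<le> e" by simp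
  have split: "{0..s} = {0..<?a} \<union> {?a..s}"
    using a by (auto intro: order_trans[OF a(1)])
  have "\<zeta> * smoothed_integral K \<zeta> q s = (LBINT r:{0..s}. ?g r)"
    unfolding smoothed_integral_def by simp
  also have "\<dots> = (LBINT r:{0..<?a}. ?g r) + (LBINT r:{?a..s}. ?g r)"
    unfolding split using a s by (intro set_integral_Un int) auto
  finally have total: "\<zeta> * smoothed_integral K \<zeta> q s = (LBINT r:{0..<?a}. ?g r) + (LBINT r:{?a..s}. ?g r)" .
  have "\<bar>LBINT r:{?a..s}. ?g r\<bar> \<le> \<zeta> * (C * K_bound) * measure lborel {?a..s}"
  proof (rule set_integral_abs_le)
    fix r assume r: "r \<in> {?a..s}"
    then have "r \<in> {0..1}" using a s by (auto intro: order_trans[OF a(1)])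
    then have "\<bar>q r\<bar> * \<bar>K (\<zeta> * (r - s))\<bar> \<le> C * K_bound"
      using q(2) K_le_bound s C by (intro mult_mono) auto
    then show "\<bar>?g r\<bar> \<le> \<zeta> * (C * K_bound)"
      using \<zeta>_nonneg by (simp add: abs_mult mult_left_mono)
  qed (use a s in \<open>auto intro!: int intro: order_trans[OF a(1)] simp: emeasure_lborel_Icc_eq\<close>)
  also have "\<dots> \<le> \<zeta> * (C * K_bound) * (1 / real N)"
    using a C \<zeta>_nonneg K_bound_nonneg by (intro mult_left_mono) auto
  finally have edge: "\<bar>LBINT r:{?a..s}. ?g r\<bar> \<le> \<zeta> * (C * K_bound) / real N" by simp
  have "c / real N * (\<Sum>i=1..n. w i * K (c * ((real i - real n) / real N))) = (\<Sum>i=1..n. w i * k i) / real N"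
    by (simp add: k_def sum_distrib_left sum_divide_distrib algebra_simps)
  also have "(\<Sum>i=1..n. w i * k i) = (\<Sum>i<n. w i * k i) + w n * k n"
  proof -
    have "(\<Sum>i=1..n. w i * k i) = (\<Sum>i\<in>{0..n}. w i * k i)"
      using w(1) by (intro sum.mono_neutral_left) (auto simp: not_less_eq_eq)
    then show ?thesis by (simp add: atLeast0AtMost lessThan_Suc_atMost[symmetric])
  qed
  finally have sum_eq: "c / real N * (\<Sum>i=1..n. w i * K (c * ((real i - real n) / real N))) =
      (\<Sum>i<n. w i * k i) / real N + w n * k n / real N" by (simp add: add_divide_distrib)
  have "\<bar>w n\<bar> * \<bar>k n\<bar> \<le> C * (c * \<bar>K 0\<bar>)"
    using w(2)[OF nN] c C by (intro mult_mono) (auto simp: k_def abs_mult)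
  then have last: "\<bar>w n * k n / real N\<bar> \<le> c * C * \<bar>K 0\<bar> / real N"
    using N by (simp add: abs_mult divide_right_mono mult.commute mult.left_commute)
  show ?thesis
    unfolding total sum_eq riemann_error_def using main edge last unfolding e_def by linarith
qed

end

text \<open>The condition on \<open>d\<close> keeps the denominator \<open>V\<close> above \<open>\<kappa> * v / 2\<close>. A positive lower
  bound \<open>\<kappa>\<close> on the times makes the estimate uniform in \<open>s\<close>.\<close>

lemma ratio_estimate:
  fixes A V G :: real
  assumes G: "\<bar>A - G\<bar> \<le> a" "\<bar>G\<bar> \<le> g" and V: "\<bar>V - s * v\<bar> \<le> d" and s: "\<kappa> \<le> s"
    and \<kappa>: "0 < \<kappa>" and v: "0 < v" and d: "d \<le> \<kappa> * v / 2"
  shows "\<bar>A / V - 1 / (s * v) * G\<bar> \<le> 2 * a / (\<kappa> * v) + 2 * g * d / (\<kappa> * v)\<^sup>2"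
proof -
  have sv: "\<kappa> * v \<le> s * v" "0 < \<kappa> * v" using s v \<kappa> by (auto intro: mult_right_mono)
  then have V_low: "\<kappa> * v / 2 \<le> V" using V d by linarith
  then have V0: "0 < V" using sv by linarith
  have s0: "0 < s" using s \<kappa> by linarith
  have eq: "A / V - 1 / (s * v) * G = (A - G) / V + G * (s * v - V) / (V * (s * v))"
    using V0 s0 v by (simp add: field_simps)
  have 1: "\<bar>(A - G) / V\<bar> \<le> a / (\<kappa> * v / 2)"
    unfolding abs_divide using G V_low sv V0 by (intro frac_le) auto
  have 2: "\<bar>G * (s * v - V) / (V * (s * v))\<bar> \<le> g * d / ((\<kappa> * v / 2) * (\<kappa> * v))"
    unfolding abs_divide abs_mult[of G]
  proof (rule frac_le)
    show "0 \<le> g * d" using G V by (intro mult_nonneg_nonneg) linarith+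
    show "\<bar>G\<bar> * \<bar>s * v - V\<bar> \<le> g * d" using G V by (intro mult_mono) (auto simp: abs_minus_commute)
    show "0 < \<kappa> * v / 2 * (\<kappa> * v)" using \<kappa> v by simp
    have "\<kappa> * v / 2 * (\<kappa> * v) \<le> V * (s * v)"
      by (rule mult_mono[OF V_low sv(1)]) (use V0 sv(2) in linarith)+
    then show "\<kappa> * v / 2 * (\<kappa> * v) \<le> \<bar>V * (s * v)\<bar>" by linarith
  qed
  have eq': "2 * a / (\<kappa> * v) + 2 * g * d / (\<kappa> * v)\<^sup>2 =
      a / (\<kappa> * v / 2) + g * d / ((\<kappa> * v / 2) * (\<kappa> * v))"
    by (simp add: power2_eq_square mult.commute)
  show ?thesis
    unfolding eq eq' by (rule order_trans[OF abs_triangle_ineq add_mono[OF 1 2]])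
qed

section \<open>A uniform law of large numbers\<close>

lemma tendsto_average_zero:
  fixes g :: "nat \<Rightarrow> real"
  assumes "g \<longlonglongrightarrow> 0"
  shows "(\<lambda>n. (\<Sum>k<n. g k) / real n) \<longlonglongrightarrow> 0"
proof (rule LIMSEQ_I)
  fix e :: real assume e: "e > 0"
  obtain k0 where k0: "\<And>k. k \<ge> k0 \<Longrightarrow> \<bar>g k\<bar> < e / 2"
    using LIMSEQ_D[OF assms, of "e / 2"] e by auto
  define S where "S = (\<Sum>k<k0. \<bar>g k\<bar>)"
  obtain n0 :: nat where n0: "2 * S / e < real n0" using reals_Archimedean2 by blast
  show "\<exists>no. \<forall>n\<ge>no. norm ((\<Sum>k<n. g k) / real n - 0) < e"
  proof (intro exI allI impI)
    fix n assume n: "n \<ge> max (Suc k0) n0"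
    have "\<bar>\<Sum>k<n. g k\<bar> \<le> (\<Sum>k<n. \<bar>g k\<bar>)" by (rule sum_abs)
    also have "(\<Sum>k<n. \<bar>g k\<bar>) = S + (\<Sum>k\<in>{k0..<n}. \<bar>g k\<bar>)"
    proof -
      have "{..<n} = {..<k0} \<union> {k0..<n}" using n by auto
      then show ?thesis unfolding S_def by (simp add: sum.union_disjoint ivl_disj_int)
    qed
    also have "(\<Sum>k\<in>{k0..<n}. \<bar>g k\<bar>) \<le> (\<Sum>k\<in>{k0..<n}. e / 2)"
      using k0 by (intro sum_mono) (auto intro: less_imp_le)
    also have "\<dots> \<le> real n * (e / 2)" using e by (simp add: mult_right_mono)
    also have "S < real n * (e / 2)"
    proof -
      have "2 * S / e < real n" using n0 n by (meson le_less_trans less_le_trans max.cobounded2 of_nat_le_iff)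
      then show ?thesis using e by (simp add: pos_divide_less_eq)
    qed
    finally have "\<bar>\<Sum>k<n. g k\<bar> < real n * e" by (simp add: mult.commute)
    then show "norm ((\<Sum>k<n. g k) / real n - 0) < e"
      using n by (simp add: pos_divide_less_eq mult.commute)
  qed
qed

lemma integrable_mult_of_squares:
  fixes X Y :: "'a \<Rightarrow> real"
  assumes [measurable]: "X \<in> borel_measurable P" "Y \<in> borel_measurable P"
    and "integrable P (\<lambda>\<omega>. (X \<omega>)\<^sup>2)" "integrable P (\<lambda>\<omega>. (Y \<omega>)\<^sup>2)"
  shows "integrable P (\<lambda>\<omega>. X \<omega> * Y \<omega>)"
proof (rule Bochner_Integration.integrable_bound)
  show "integrable P (\<lambda>\<omega>. (X \<omega>)\<^sup>2 + (Y \<omega>)\<^sup>2)" using assms by simp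
  show "AE \<omega> in P. norm (X \<omega> * Y \<omega>) \<le> norm ((X \<omega>)\<^sup>2 + (Y \<omega>)\<^sup>2)"
  proof (rule AE_I2)
    fix \<omega>
    have "2 * \<bar>X \<omega> * Y \<omega>\<bar> \<le> (X \<omega>)\<^sup>2 + (Y \<omega>)\<^sup>2"
      using sum_squares_bound[of "\<bar>X \<omega>\<bar>" "\<bar>Y \<omega>\<bar>"] by (simp add: abs_mult)
    then show "norm (X \<omega> * Y \<omega>) \<le> norm ((X \<omega>)\<^sup>2 + (Y \<omega>)\<^sup>2)" by simp
  qed
qed simp

text \<open>Every distance \<open>k < n\<close> is realised by at most two indices \<open>j\<close>, one on either side of \<open>i\<close>.\<close>

lemma sum_distance_le:
  fixes g :: "nat \<Rightarrow> real"
  assumes g: "\<And>k. 0 \<le> g k" and i: "i \<in> {1..n}"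
  shows "(\<Sum>j=1..n. g (if i \<le> j then j - i else i - j)) \<le> 2 * (\<Sum>k<n. g k)"
proof -
  have "{1..n} = {1..<i} \<union> {i..n}" using i by auto
  then have "(\<Sum>j=1..n. g (if i \<le> j then j - i else i - j)) =
      (\<Sum>j\<in>{1..<i}. g (if i \<le> j then j - i else i - j)) + (\<Sum>j\<in>{i..n}. g (if i \<le> j then j - i else i - j))"
    by (metis (no_types, lifting) finite_atLeastAtMost finite_atLeastLessThan ivl_disj_int_two(7) sum.union_disjoint)
  also have "(\<Sum>j\<in>{1..<i}. g (if i \<le> j then j - i else i - j)) = (\<Sum>j\<in>{1..<i}. g (i - j))"
    by (intro sum.cong) auto
  also have "\<dots> = sum g ((\<lambda>j. i - j) ` {1..<i})"
    by (subst sum.reindex) (auto simp: inj_on_def)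
  also have "\<dots> \<le> (\<Sum>k<n. g k)" using i by (intro sum_mono2 g) auto
  also have "(\<Sum>j\<in>{i..n}. g (if i \<le> j then j - i else i - j)) = (\<Sum>j\<in>{i..n}. g (j - i))"
    by (intro sum.cong) auto
  also have "\<dots> = sum g ((\<lambda>j. j - i) ` {i..n})"
    by (subst sum.reindex) (auto simp: inj_on_def)
  also have "\<dots> \<le> (\<Sum>k<n. g k)" using i by (intro sum_mono2 g) auto
  finally show ?thesis by simp
qed



lemma covariance_commute: "covariance P X Y = covariance P Y X"
  by (simp add: covariance_def mult.commute)

context prob_space
begin

context
  fixes v :: "nat \<Rightarrow> 'a \<Rightarrow> real" and a :: real
  assumes v: "weakly_stationary M v" and a: "a = expectation (v 1)"
begin

lemma stationary_measurable: "1 \<le> n \<Longrightarrow> v n \<in> borel_measurable M"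
  using v by (simp add: weakly_stationary_def)

lemma stationary_integrable:
  assumes "1 \<le> n"
  shows "integrable M (v n)"
  using v assms square_integrable_imp_integrable[of "v n"] by (simp add: weakly_stationary_def)

lemma stationary_expectation:
  assumes "1 \<le> n"
  shows "expectation (v n) = a"
proof -
  have "\<forall>n\<ge>1. expectation (v n) = expectation (v 1)" using v unfolding weakly_stationary_def by blast
  then show ?thesis using assms a by blast
qed

lemma stationary_centred_square_integrable:
  assumes "1 \<le> n"
  shows "integrable M (\<lambda>\<omega>. (v n \<omega> - a)\<^sup>2)"
proof -
  have "integrable M (\<lambda>\<omega>. (v n \<omega>)\<^sup>2)" using v assms by (simp add: weakly_stationary_def)
  then have "integrable M (\<lambda>\<omega>. (v n \<omega>)\<^sup>2 - 2 * a * v n \<omega> + a\<^sup>2)"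
    using stationary_integrable[OF assms] by simp
  then show ?thesis by (simp add: power2_diff algebra_simps)
qed

lemma stationary_centred_mult_integrable:
  assumes "1 \<le> i" "1 \<le> j"
  shows "integrable M (\<lambda>\<omega>. (v i \<omega> - a) * (v j \<omega> - a))"
  using assms stationary_measurable stationary_centred_square_integrable
  by (intro integrable_mult_of_squares) auto

lemma stationary_centred_mult_expectation:
  assumes "1 \<le> i" "1 \<le> j"
  shows "(\<integral>\<omega>. (v i \<omega> - a) * (v j \<omega> - a) \<partial>M) =
    covariance M (v 1) (v (1 + (if i \<le> j then j - i else i - j)))"
proof -
  have shift: "\<forall>n\<ge>1. \<forall>k. covariance M (v n) (v (n + k)) = covariance M (v 1) (v (1 + k))"
    using v unfolding weakly_stationary_def by blast
  have "(\<integral>\<omega>. (v i \<omega> - a) * (v j \<omega> - a) \<partial>M) = covariance M (v i) (v j)"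
    using assms by (simp add: covariance_def stationary_expectation)
  also have "\<dots> = covariance M (v 1) (v (1 + (if i \<le> j then j - i else i - j)))"
  proof (cases "i \<le> j")
    case True
    then show ?thesis using shift[rule_format, OF assms(1), of "j - i"] by simp
  next
    case False
    then show ?thesis using shift[rule_format, OF assms(2), of "i - j"] covariance_commute[of M "v i"] by simp
  qed
  finally show ?thesis .
qed

text \<open>The second moment is the double sum of the covariances, each of which depends on the distance of its
  two indices only.\<close>

lemma stationary_sum_second_moment:
  defines "g \<equiv> \<lambda>k. \<bar>covariance M (v 1) (v (1 + k))\<bar>"
  shows "integrable M (\<lambda>\<omega>. (\<Sum>i=1..n. v i \<omega> - a)\<^sup>2)"
    and "(\<integral>\<omega>. (\<Sum>i=1..n. v i \<omega> - a)\<^sup>2 \<partial>M) \<le> real n * (2 * (\<Sum>k<n. g k))"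
proof -
  have sq: "(\<Sum>i=1..n. v i \<omega> - a)\<^sup>2 = (\<Sum>i=1..n. \<Sum>j=1..n. (v i \<omega> - a) * (v j \<omega> - a))" for \<omega>
    by (simp add: power2_eq_square sum_product)
  show "integrable M (\<lambda>\<omega>. (\<Sum>i=1..n. v i \<omega> - a)\<^sup>2)"
    unfolding sq by (intro Bochner_Integration.integrable_sum stationary_centred_mult_integrable) auto
  have "(\<integral>\<omega>. (\<Sum>i=1..n. v i \<omega> - a)\<^sup>2 \<partial>M) =
      (\<Sum>i=1..n. \<Sum>j=1..n. \<integral>\<omega>. (v i \<omega> - a) * (v j \<omega> - a) \<partial>M)"
    unfolding sq
    by (subst Bochner_Integration.integral_sum;
        (intro Bochner_Integration.integrable_sum stationary_centred_mult_integrable sum.cong refl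
          Bochner_Integration.integral_sum)?; simp)+
  also have "\<dots> \<le> (\<Sum>i=1..n. \<Sum>j=1..n. g (if i \<le> j then j - i else i - j))"
    by (intro sum_mono) (auto simp: stationary_centred_mult_expectation g_def)
  also have "\<dots> \<le> (\<Sum>i=1..n. 2 * (\<Sum>k<n. g k))"
    by (intro sum_mono sum_distance_le) (auto simp: g_def)
  finally show "(\<integral>\<omega>. (\<Sum>i=1..n. v i \<omega> - a)\<^sup>2 \<partial>M) \<le> real n * (2 * (\<Sum>k<n. g k))" by simp
qed

text \<open>The Cauchy-Schwarz inequality, in the form that the variance of the absolute value is
  non-negative.\<close>

lemma stationary_average_L1:
  defines "g \<equiv> \<lambda>k. \<bar>covariance M (v 1) (v (1 + k))\<bar>"
  assumes N: "0 < N" and n: "n \<le> N"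
  shows "integrable M (\<lambda>\<omega>. \<bar>\<Sum>i=1..n. v i \<omega> - a\<bar> / real N)"
    and "(\<integral>\<omega>. \<bar>\<Sum>i=1..n. v i \<omega> - a\<bar> / real N \<partial>M) \<le> sqrt (2 * ((\<Sum>k<N. g k) / real N))"
proof -
  let ?S = "\<lambda>\<omega>. \<Sum>i=1..n. v i \<omega> - a"
  have int: "integrable M ?S" using stationary_integrable by (intro Bochner_Integration.integrable_sum) simp
  then show "integrable M (\<lambda>\<omega>. \<bar>?S \<omega>\<bar> / real N)" by simp
  have sq: "integrable M (\<lambda>\<omega>. (\<bar>?S \<omega>\<bar>)\<^sup>2)" using stationary_sum_second_moment(1) by simp
  have "0 \<le> variance (\<lambda>\<omega>. \<bar>?S \<omega>\<bar>)" by (rule variance_positive)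
  also have "\<dots> = expectation (\<lambda>\<omega>. \<bar>?S \<omega>\<bar>\<^sup>2) - (expectation (\<lambda>\<omega>. \<bar>?S \<omega>\<bar>))\<^sup>2"
    by (rule variance_eq[OF integrable_abs[OF int] sq])
  finally have "(expectation (\<lambda>\<omega>. \<bar>?S \<omega>\<bar>))\<^sup>2 \<le> expectation (\<lambda>\<omega>. (?S \<omega>)\<^sup>2)"
    by (simp only: power2_abs diff_ge_0_iff_ge)
  also have "\<dots> \<le> real n * (2 * (\<Sum>k<n. g k))" unfolding g_def by (rule stationary_sum_second_moment(2))
  also have "\<dots> \<le> real N * (2 * (\<Sum>k<N. g k))"
    using n by (intro mult_mono sum_mono2 sum_nonneg mult_nonneg_nonneg) (auto simp: g_def)
  finally have "(expectation (\<lambda>\<omega>. \<bar>?S \<omega>\<bar>))\<^sup>2 / (real N)\<^sup>2 \<le> real N * (2 * (\<Sum>k<N. g k)) / (real N)\<^sup>2"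
    by (rule divide_right_mono) simp
  also have "\<dots> = 2 * ((\<Sum>k<N. g k) / real N)" using N by (simp add: power2_eq_square)
  finally have "(expectation (\<lambda>\<omega>. \<bar>?S \<omega>\<bar>) / real N)\<^sup>2 \<le> 2 * ((\<Sum>k<N. g k) / real N)"
    by (simp add: power_divide)
  then show "(\<integral>\<omega>. \<bar>?S \<omega>\<bar> / real N \<partial>M) \<le> sqrt (2 * ((\<Sum>k<N. g k) / real N))"
    by (simp add: real_le_rsqrt)
qed

end
end

text \<open>The sums of the non-negative \<open>x i\<close> are monotone in \<open>n\<close> and their centring is linear, so the deviation
  at \<open>n\<close> is controlled by the deviations at the two neighbouring points of the grid \<open>j * N div p\<close>, up to \<open>a\<close>
  times the mesh, which rounding enlarges by at most one.\<close>

lemma monotone_sum_grid_bound: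
  fixes x :: "nat \<Rightarrow> real"
  assumes x: "\<And>i. 1 \<le> i \<Longrightarrow> 0 \<le> x i" and a: "0 \<le> a" and p: "0 < p" and N: "0 < N" and n: "n \<le> N"
  defines "D \<equiv> \<lambda>n. (\<Sum>i=1..n. x i - a)"
  shows "\<bar>D n\<bar> / real N \<le> (\<Sum>j\<le>p. \<bar>D (j * N div p)\<bar> / real N) + a * (1 / real p + 1 / real N)"
proof -
  have le_sum: "\<bar>D (j * N div p)\<bar> / real N \<le> (\<Sum>j\<le>p. \<bar>D (j * N div p)\<bar> / real N)" if "j \<le> p" for j
    using that by (intro member_le_sum[where f="\<lambda>j. \<bar>D (j * N div p)\<bar> / real N"]) auto
  have ex: "0 \<le> a * (1 / real p + 1 / real N)" using a by simp
  show ?thesis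
  \<comment> \<open>The right end point is itself a grid point, and has no right neighbour in the grid.\<close>
  proof (cases "n = N")
    case True
    then show ?thesis using le_sum[of p] p ex by simp
  next
    case False
    define j where "j = n * p div N"
    define l where "l = j * N div p"
    define u where "u = Suc j * N div p"
    have "n * p < N * p" using False n p by simp
    then have j: "j < p" unfolding j_def using N by (simp add: less_mult_imp_div_less mult.commute)
    have "j * N \<le> n * p" unfolding j_def by (rule div_times_less_eq_dividend)
    then have "l \<le> n * p div p" unfolding l_def by (rule div_le_mono)
    then have l: "l \<le> n" using p by simp
    have "n * p < Suc j * N" unfolding j_def using N by (simp add: dividend_less_div_times)
    then have "n * p div p \<le> u" unfolding u_def by (intro div_le_mono) simp
    then have u: "n \<le> u" using p by simp
    have gap: "real u - real l \<le> real N / real p + 1"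
    proof -
      have "real u \<le> real (Suc j * N) / real p" unfolding u_def by (rule of_nat_div_le_of_nat)
      moreover have "real (j * N) / real p < real l + 1"
      proof -
        have "j * N < (l + 1) * p" unfolding l_def using p by (simp add: dividend_less_div_times)
        then have "real (j * N) < (real l + 1) * real p" by (metis of_nat_1 of_nat_add of_nat_less_iff of_nat_mult)
        then show ?thesis using p by (simp add: pos_divide_less_eq)
      qed
      ultimately show ?thesis by (simp add: add_divide_distrib algebra_simps)
    qed
    have mono: "D k + a * real k \<le> D k' + a * real k'" if "k \<le> k'" for k k'
    proof -
      have "D k + a * real k = (\<Sum>i=1..k. x i)" for k unfolding D_def by (simp add: sum_subtractf)
      moreover have "(\<Sum>i=1..k. x i) \<le> (\<Sum>i=1..k'. x i)" using that x by (intro sum_mono2) auto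
      ultimately show ?thesis by simp
    qed
    have "a * real n \<le> a * real u" "a * real l \<le> a * real n" using l u a by (auto intro: mult_left_mono)
    then have "\<bar>D n\<bar> \<le> max \<bar>D l\<bar> \<bar>D u\<bar> + (a * real u - a * real l)"
      using mono[OF l] mono[OF u] by linarith
    moreover have "a * real u - a * real l \<le> a * (real N / real p + 1)"
      unfolding right_diff_distrib[symmetric] using gap a by (rule mult_left_mono)
    ultimately have "\<bar>D n\<bar> \<le> max \<bar>D l\<bar> \<bar>D u\<bar> + a * (real N / real p + 1)" by linarith
    then have "\<bar>D n\<bar> / real N \<le> (max \<bar>D l\<bar> \<bar>D u\<bar> + a * (real N / real p + 1)) / real N"
      by (rule divide_right_mono) (rule of_nat_0_le_iff)
    also have "\<dots> = max \<bar>D l\<bar> \<bar>D u\<bar> / real N + a * (1 / real p + 1 / real N)"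
      using N p by (simp add: field_simps)
    also have "max \<bar>D l\<bar> \<bar>D u\<bar> / real N \<le> (\<Sum>j\<le>p. \<bar>D (j * N div p)\<bar> / real N)"
      using le_sum[of j] le_sum[of "Suc j"] j by (simp add: l_def u_def max_def)
    finally show ?thesis by simp
  qed
qed

text \<open>Since the covariances tend to zero, so do their averages, and thus the deviation at each fixed
  fraction of \<open>N\<close> tends to zero in mean. Non-negativity turns this into a statement uniform in \<open>n \<le> N\<close>
  through a grid of fixed size.\<close>

lemma uniform_law_of_large_numbers:
  fixes v :: "nat \<Rightarrow> 'a \<Rightarrow> real"
  assumes P: "prob_space P" and v: "weakly_stationary P v"
    and nonneg: "\<And>n \<omega>. 0 \<le> v n \<omega>"
    and cov: "(\<lambda>k. covariance P (v 1) (v (1 + k))) \<longlonglongrightarrow> 0"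
    and e: "0 < e" and d: "0 < d"
  shows "eventually_likely P d (\<lambda>N \<omega>. \<forall>n\<le>N. \<bar>\<Sum>i=1..n. v i \<omega> - (\<integral>\<omega>. v 1 \<omega> \<partial>P)\<bar> / real N \<le> e)"
proof -
  interpret prob_space P by fact
  define a where "a = expectation (v 1)"
  have a: "0 \<le> a" unfolding a_def using nonneg by simp
  define D where "D n \<omega> = (\<Sum>i=1..n. v i \<omega> - a)" for n \<omega>
  define g where "g k = \<bar>covariance P (v 1) (v (1 + k))\<bar>" for k
  \<comment> \<open>A grid this fine has a mesh that costs at most \<open>e / 2\<close> as soon as \<open>N \<ge> p\<close>.\<close>
  obtain p :: nat where p: "4 * a / e < real p" "0 < p"
    using reals_Archimedean2[of "max 0 (4 * a / e)"] by auto
  define W where "W N \<omega> = (\<Sum>j\<le>p. \<bar>D (j * N div p) \<omega>\<bar> / real N)" for N \<omega>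
  have grid: "j * N div p \<le> N" if "j \<le> p" for j N
  proof -
    have "j * N div p \<le> p * N div p" using that by (intro div_le_mono mult_le_mono1)
    then show ?thesis using p(2) by simp
  qed
  have int: "integrable P (\<lambda>\<omega>. \<bar>D (j * N div p) \<omega>\<bar> / real N)"
    and le: "0 < N \<Longrightarrow> (\<integral>\<omega>. \<bar>D (j * N div p) \<omega>\<bar> / real N \<partial>P) \<le> sqrt (2 * ((\<Sum>k<N. g k) / real N))"
    if "j \<le> p" for j N
    using stationary_average_L1[OF v refl, of N "j * N div p"] grid[OF that]
    by (cases "N = 0"; simp add: D_def a_def g_def)+
  have W_int: "integrable P (W N)" for N
    unfolding W_def using int by (intro Bochner_Integration.integrable_sum) auto
  have "(\<lambda>N. \<integral>\<omega>. W N \<omega> \<partial>P) \<longlonglongrightarrow> 0"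
  proof (rule tendsto_sandwich)
    show "\<forall>\<^sub>F N in sequentially. 0 \<le> (\<integral>\<omega>. W N \<omega> \<partial>P)"
      by (intro always_eventually allI integral_nonneg_AE) (simp add: W_def sum_nonneg)
    show "\<forall>\<^sub>F N in sequentially. (\<integral>\<omega>. W N \<omega> \<partial>P) \<le> (\<Sum>j\<le>p. sqrt (2 * ((\<Sum>k<N. g k) / real N)))"
      using eventually_gt_at_top[of 0]
    proof eventually_elim
      case (elim N)
      have "(\<integral>\<omega>. W N \<omega> \<partial>P) = (\<Sum>j\<le>p. \<integral>\<omega>. \<bar>D (j * N div p) \<omega>\<bar> / real N \<partial>P)"
        unfolding W_def using int by (intro Bochner_Integration.integral_sum) auto
      also have "\<dots> \<le> (\<Sum>j\<le>p. sqrt (2 * ((\<Sum>k<N. g k) / real N)))"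
        using le elim by (intro sum_mono) auto
      finally show ?case .
    qed
    have "g \<longlonglongrightarrow> 0" unfolding g_def using cov by (rule tendsto_rabs_zero)
    then have "(\<lambda>N. \<Sum>j\<le>p. sqrt (2 * ((\<Sum>k<N. g k) / real N))) \<longlonglongrightarrow> (\<Sum>j\<le>p. sqrt (2 * 0))"
      by (intro tendsto_intros tendsto_average_zero)
    then show "(\<lambda>N. \<Sum>j\<le>p. sqrt (2 * ((\<Sum>k<N. g k) / real N))) \<longlonglongrightarrow> 0" by simp
  qed simp
  then have "eventually_likely P d (\<lambda>N \<omega>. W N \<omega> \<le> e / 2)"
    using e d by (intro eventually_likely_L1[OF P W_int]) (auto simp: W_def sum_nonneg)
  then show ?thesis
  proof (rule eventually_likely_mono)
    show "\<forall>\<^sub>F N in sequentially. \<forall>\<omega>\<in>space P. W N \<omega> \<le> e / 2 \<longrightarrow>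
        (\<forall>n\<le>N. \<bar>\<Sum>i=1..n. v i \<omega> - expectation (v 1)\<bar> / real N \<le> e)"
      using eventually_ge_at_top[of p]
    proof eventually_elim
      case (elim N)
      have "a * (1 / real p) \<le> e / 4" using p e by (simp add: field_simps)
      moreover have "a * (1 / real N) \<le> a * (1 / real p)"
        using elim p a by (intro mult_left_mono divide_left_mono) auto
      ultimately have small: "a * (1 / real p + 1 / real N) \<le> e / 2"
        unfolding distrib_left by linarith
      have "\<bar>D n \<omega>\<bar> / real N \<le> e" if W: "W N \<omega> \<le> e / 2" and n: "n \<le> N" for n \<omega>
      proof -
        have "\<bar>D n \<omega>\<bar> / real N \<le> W N \<omega> + a * (1 / real p + 1 / real N)"
          unfolding D_def W_def using elim p(2) n nonneg a
          by (intro monotone_sum_grid_bound) auto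
        then show ?thesis using W small by linarith
      qed
      then show ?case unfolding D_def a_def by blast
    qed
  qed
qed

section \<open>The second moment of the errors is positive\<close>

lemma brownian_motion_end_nonzero:
  assumes "brownian_motion Q B"
  shows "\<not> (AE \<omega> in Q. B \<omega> 1 = 0)"
proof
  assume zero: "AE \<omega> in Q. B \<omega> 1 = 0"
  interpret Q: prob_space Q using assms by (simp add: brownian_motion_def)
  let ?X = "\<lambda>\<omega>. B \<omega> 1 - B \<omega> 0"
  have X: "distributed Q lborel ?X (normal_density 0 (sqrt (1 - 0)))"
  proof -
    have "\<forall>s t. 0 \<le> s \<and> s < t \<and> t \<le> 1 \<longrightarrow>
        distributed Q lborel (\<lambda>\<omega>. B \<omega> t - B \<omega> s) (normal_density 0 (sqrt (t - s)))"
      using assms unfolding brownian_motion_def by (elim conjE)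
    from this[rule_format, of 0 1] show ?thesis by simp
  qed
  have "AE \<omega> in Q. B \<omega> 0 = 0" using assms by (simp add: brownian_motion_def)
  with zero have "AE \<omega> in Q. ?X \<omega> \<in> {0}" by eventually_elim simp
  moreover have X_meas: "?X \<in> Q \<rightarrow>\<^sub>M lborel" using X by (rule distributed_measurable)
  ultimately have "emeasure (distr Q lborel ?X) {0} = 1"
    using Q.emeasure_eq_1_AE[of "?X -` {0} \<inter> space Q"] measurable_sets[OF X_meas, of "{0}"]
    by (subst emeasure_distr) auto
  moreover have "emeasure (distr Q lborel ?X) {0} = 0"
  proof -
    have "AE x in lborel. x \<notin> {0 :: real}" by (intro AE_not_in countable_imp_null_set_lborel) simp
    then have "AE x in lborel. x \<in> {0 :: real} \<longrightarrow> ennreal (normal_density 0 (sqrt (1 - 0)) x) = 0"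
      by eventually_elim simp
    then have "{0 :: real} \<in> null_sets (density lborel (normal_density 0 (sqrt (1 - 0))))"
      by (subst null_sets_density_iff) auto
    then show ?thesis unfolding distributed_distr_eq_density[OF X] by (rule null_setsD1)
  qed
  ultimately show False by simp
qed

text \<open>If the second moment vanished, all errors would be almost surely zero, and so would the limit of their
  partial sums at time \<open>1\<close>, which is a non-degenerate Gaussian variable.\<close>

lemma limit_variance_positive:
  assumes P: "prob_space P" and B: "brownian_motion Q B" and \<sigma>: "0 < \<sigma>"
    and wc: "weakly_converges 0 1 P (partial_sum_process u) Q (scaled_path \<sigma> B)"
    and u: "weakly_stationary P u" and u2: "weakly_stationary P (\<lambda>n \<omega>. (u n \<omega>)\<^sup>2)"
  shows "0 < (\<integral>\<omega>. (u 1 \<omega>)\<^sup>2 \<partial>P)"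
proof (rule ccontr)
  assume "\<not> 0 < (\<integral>\<omega>. (u 1 \<omega>)\<^sup>2 \<partial>P)"
  moreover have "0 \<le> (\<integral>\<omega>. (u 1 \<omega>)\<^sup>2 \<partial>P)" by (intro integral_nonneg_AE) simp
  ultimately have zero: "(\<integral>\<omega>. (u 1 \<omega>)\<^sup>2 \<partial>P) = 0" by linarith
  interpret Q: prob_space Q using B by (simp add: brownian_motion_def)
  have u_zero: "AE \<omega> in P. u n \<omega> = 0" if n: "1 \<le> n" for n
  proof -
    have "(\<integral>\<omega>. (u n \<omega>)\<^sup>2 \<partial>P) = 0"
      using u2 n zero unfolding weakly_stationary_def by metis
    moreover have "integrable P (\<lambda>\<omega>. (u n \<omega>)\<^sup>2)"
      using u n by (simp add: weakly_stationary_def)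
    ultimately have "AE \<omega> in P. (u n \<omega>)\<^sup>2 = 0"
      by (subst (asm) integral_nonneg_eq_0_iff_AE) auto
    then show ?thesis by eventually_elim simp
  qed
  \<comment> \<open>A bounded continuous functional that detects whether the end point is zero.\<close>
  define f where "f x = min 1 \<bar>x 1\<bar>" for x :: "real \<Rightarrow> real"
  have f: "continuous_map (skorohod_topology 0 1) euclideanreal f"
  proof (rule continuous_map_skorohod_Lipschitz)
    fix x y assume "x \<in> skorohod_space 0 1" "y \<in> skorohod_space 0 1"
    from skorohod_dist_right_end[OF this] show "\<bar>f x - f y\<bar> \<le> 1 * skorohod_dist 0 1 x y"
      unfolding f_def by (simp add: min_def) linarith
  qed simp
  have bd: "\<bar>f x\<bar> \<le> 1" for x by (simp add: f_def)
  have "(\<lambda>N. \<integral>\<omega>. f (restrict (partial_sum_process u N \<omega>) {0..1}) \<partial>P)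
      \<longlonglongrightarrow> (\<integral>\<omega>. f (restrict (scaled_path \<sigma> B \<omega>) {0..1}) \<partial>Q)"
  proof -
    have "bounded (f ` skorohod_space 0 1)" using bd by (auto simp: bounded_iff)
    then show ?thesis using wc f unfolding weakly_converges_def by blast
  qed
  moreover have "(\<integral>\<omega>. f (restrict (partial_sum_process u N \<omega>) {0..1}) \<partial>P) = 0" for N
  proof -
    have "AE \<omega> in P. \<forall>n. 1 \<le> n \<longrightarrow> u n \<omega> = 0" using u_zero by (simp add: AE_all_countable)
    then have "AE \<omega> in P. f (restrict (partial_sum_process u N \<omega>) {0..1}) = 0"
      by eventually_elim (simp add: f_def partial_sum_process_def)
    then show ?thesis by (rule integral_eq_zero_AE)
  qed
  ultimately have "(\<integral>\<omega>. f (restrict (scaled_path \<sigma> B \<omega>) {0..1}) \<partial>Q) = 0"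
    by (simp add: LIMSEQ_const_iff)
  moreover have "integrable Q (\<lambda>\<omega>. f (restrict (scaled_path \<sigma> B \<omega>) {0..1}))"
    using wc bd by (intro bounded_continuous_map_expectation[OF _ Q.prob_space_axioms _ f])
      (auto simp: weakly_converges_def)
  ultimately have "AE \<omega> in Q. f (restrict (scaled_path \<sigma> B \<omega>) {0..1}) = 0"
    by (subst (asm) integral_nonneg_eq_0_iff_AE) (auto simp: f_def)
  then have "AE \<omega> in Q. B \<omega> 1 = 0"
    by eventually_elim (use \<sigma> in \<open>auto simp: f_def scaled_path_def min_def split: if_splits\<close>)
  then show False using brownian_motion_end_nonzero[OF B] by blast
qed

section \<open>The detector\<close>

text \<open>The powers of \<open>n\<close> and \<open>N\<close> cancel, which leaves a Riemann sum over an average of squares. If the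
  denominator vanishes, both sides are zero by the convention for division.\<close>

lemma U_process_eq:
  fixes y :: "nat \<Rightarrow> real"
  assumes N: "0 < N" and h: "0 < h" and s: "1 / real N \<le> s"
  defines "n \<equiv> nat \<lfloor>real N * s\<rfloor>"
  shows "real_of_int \<lfloor>real N * s\<rfloor> * U_process K h N y s =
    (real N / h / real N * (\<Sum>i=1..n. (\<Sum>j=1..i. y j)\<^sup>2 / real N * K (real N / h * ((real i - real n) / real N)))) /
    ((\<Sum>j=1..n. (y j)\<^sup>2) / real N)"
proof -
  define T where "T = (\<Sum>i=1..n. (\<Sum>j=1..i. y j)\<^sup>2 * K ((real i - real n) / h))"
  define W where "W = (\<Sum>j=1..n. (y j)\<^sup>2)"
  have Ns: "1 \<le> real N * s" using s N by (simp add: pos_divide_le_eq mult.commute)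
  then have n: "real_of_int \<lfloor>real N * s\<rfloor> = real n" "0 < real n" unfolding n_def by linarith+
  have "(\<Sum>i=1..n. (\<Sum>j=1..i. y j)\<^sup>2 * scaled_kernel K h (real i - real n)) = T / h"
    by (simp add: T_def scaled_kernel_def sum_divide_distrib)
  then have "U_process K h N y s = (1 / real n ^ 3 * (T / h)) / (1 / real n ^ 2 * W)"
    using s by (simp add: U_process_def Let_def n_def[symmetric] W_def)
  then have "real_of_int \<lfloor>real N * s\<rfloor> * U_process K h N y s = (T / h) / W"
    using n by (simp add: power2_eq_square power3_eq_cube)
  also have "\<dots> = (T / h / real N) / (W / real N)" using N by simp
  also have "T / h / real N = real N / h / real N *
      (\<Sum>i=1..n. (\<Sum>j=1..i. y j)\<^sup>2 / real N * K (real N / h * ((real i - real n) / real N)))"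
    using N by (simp add: T_def sum_divide_distrib sum_distrib_left mult.commute)
  finally show ?thesis unfolding W_def .
qed

lemma detector_random_element:
  assumes \<kappa>: "0 < \<kappa>" "\<kappa> < 1"
    and Y: "\<And>n \<omega>. 1 \<le> n \<Longrightarrow> n \<le> N \<Longrightarrow> \<omega> \<in> space P \<Longrightarrow> Y n \<omega> = m n + u n \<omega>"
    and u: "\<And>n. 1 \<le> n \<Longrightarrow> u n \<in> borel_measurable P"
  shows "random_element \<kappa> 1 P (\<lambda>\<omega> s. real_of_int \<lfloor>real N * s\<rfloor> * U_process K h N (\<lambda>n. Y n \<omega>) s)"
proof (rule random_element_step[where N=N and c="\<lambda>k \<omega>. real k *
    ((1 / real k ^ 3 * (\<Sum>i=1..k. (\<Sum>j=1..i. m j + u j \<omega>)\<^sup>2 * scaled_kernel K h (real i - real k))) /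
     (1 / real k ^ 2 * (\<Sum>j=1..k. (m j + u j \<omega>)\<^sup>2)))"])
  show "\<kappa> \<le> 1" using \<kappa> by simp
  have [measurable]: "(\<lambda>\<omega>. \<Sum>j=1..i. m j + u j \<omega>) \<in> borel_measurable P" for i
    using u by (intro borel_measurable_sum borel_measurable_add) auto
  have [measurable]: "(\<lambda>\<omega>. \<Sum>j=1..i. (m j + u j \<omega>)\<^sup>2) \<in> borel_measurable P" for i
    using u by (intro borel_measurable_sum borel_measurable_power borel_measurable_add) auto
  show "(\<lambda>\<omega>. real k *
    ((1 / real k ^ 3 * (\<Sum>i=1..k. (\<Sum>j=1..i. m j + u j \<omega>)\<^sup>2 * scaled_kernel K h (real i - real k))) /
     (1 / real k ^ 2 * (\<Sum>j=1..k. (m j + u j \<omega>)\<^sup>2)))) \<in> borel_measurable P" for k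
    by measurable
  fix \<omega> s assume \<omega>: "\<omega> \<in> space P" and s: "s \<in> {\<kappa>..1}"
  define k where "k = nat \<lfloor>real N * s\<rfloor>"
  have "real N * s \<le> real N * 1" using s by (intro mult_left_mono) auto
  moreover have "0 \<le> real N * s" using s \<kappa> by simp
  ultimately have k: "real_of_int \<lfloor>real N * s\<rfloor> = real k" "k \<le> N" unfolding k_def by linarith+
  show "real_of_int \<lfloor>real N * s\<rfloor> * U_process K h N (\<lambda>n. Y n \<omega>) s = real (nat \<lfloor>real N * s\<rfloor>) *
    ((1 / real (nat \<lfloor>real N * s\<rfloor>) ^ 3 * (\<Sum>i=1..nat \<lfloor>real N * s\<rfloor>. (\<Sum>j=1..i. m j + u j \<omega>)\<^sup>2 *
        scaled_kernel K h (real i - real (nat \<lfloor>real N * s\<rfloor>)))) /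
     (1 / real (nat \<lfloor>real N * s\<rfloor>) ^ 2 * (\<Sum>j=1..nat \<lfloor>real N * s\<rfloor>. (m j + u j \<omega>)\<^sup>2)))"
    unfolding k_def[symmetric] k(1)
  proof (cases "k = 0")
    case False
    then have "1 \<le> real N * s" using k(1) by linarith
    then have "\<not> s < 1 / real N" using False k(2) by (simp add: pos_less_divide_eq mult.commute not_less)
    moreover have "(\<Sum>j=1..i. Y j \<omega>) = (\<Sum>j=1..i. m j + u j \<omega>)" if "i \<le> k" for i
      using that k(2) Y \<omega> by (intro sum.cong) auto
    moreover have "(\<Sum>j=1..k. (Y j \<omega>)\<^sup>2) = (\<Sum>j=1..k. (m j + u j \<omega>)\<^sup>2)"
      using k(2) Y \<omega> by (intro sum.cong) auto
    ultimately show "real k * U_process K h N (\<lambda>n. Y n \<omega>) s = real k *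
      ((1 / real k ^ 3 * (\<Sum>i=1..k. (\<Sum>j=1..i. m j + u j \<omega>)\<^sup>2 * scaled_kernel K h (real i - real k))) /
       (1 / real k ^ 2 * (\<Sum>j=1..k. (m j + u j \<omega>)\<^sup>2)))"
      by (simp add: U_process_def Let_def k_def[symmetric])
  qed simp
qed

text \<open>By \<open>2 * \<bar>u\<bar> \<le> 1 + u\<^sup>2\<close> and \<open>m \<le> M\<close>, the change of each square is at most
  \<open>m * (1 + u\<^sup>2 + M)\<close>. The \<open>m N j\<close> add up to order \<open>sqrt N\<close> only, so after division by \<open>N\<close> the total
  vanishes in mean.\<close>

lemma drift_square_negligible:
  fixes u :: "nat \<Rightarrow> 'a \<Rightarrow> real" and m :: "nat \<Rightarrow> nat \<Rightarrow> real"
  assumes P: "prob_space P" and u: "weakly_stationary P u" and u2: "weakly_stationary P (\<lambda>n \<omega>. (u n \<omega>)\<^sup>2)"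
    and m: "\<And>N n. 1 \<le> n \<Longrightarrow> n \<le> N \<Longrightarrow> 0 \<le> m N n \<and> m N n \<le> M"
    and lim: "(\<lambda>N. (\<Sum>i=1..N. m N i) / sqrt (real N)) \<longlonglongrightarrow> l"
    and e: "0 < e" and d: "0 < d"
  shows "eventually_likely P d
    (\<lambda>N \<omega>. \<forall>n\<le>N. \<bar>(\<Sum>j=1..n. (m N j + u j \<omega>)\<^sup>2) - (\<Sum>j=1..n. (u j \<omega>)\<^sup>2)\<bar> / real N \<le> e)"
proof -
  interpret prob_space P by fact
  define v where "v = expectation (\<lambda>\<omega>. (u 1 \<omega>)\<^sup>2)"
  define W where "W N \<omega> = (\<Sum>j=1..N. m N j * (1 + (u j \<omega>)\<^sup>2 + M)) / real N" for N \<omega>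
  have v: "expectation (\<lambda>\<omega>. (u n \<omega>)\<^sup>2) = v" if "1 \<le> n" for n
    using u2 that unfolding weakly_stationary_def v_def by blast
  have int: "integrable P (\<lambda>\<omega>. (u n \<omega>)\<^sup>2)" if "1 \<le> n" for n
    using u that unfolding weakly_stationary_def by blast
  have W_int: "integrable P (W N)" for N
    unfolding W_def using int by (intro integrable_divide Bochner_Integration.integrable_sum) auto
  have W_nonneg: "0 \<le> W N \<omega>" for N \<omega>
    unfolding W_def
  proof (intro divide_nonneg_nonneg sum_nonneg mult_nonneg_nonneg)
    fix j assume "j \<in> {1..N}"
    then have "0 \<le> m N j \<and> m N j \<le> M" using m by simp
    then show "0 \<le> m N j" "0 \<le> 1 + (u j \<omega>)\<^sup>2 + M" by auto
  qed simp
  have EW: "expectation (W N) = (1 + v + M) * ((\<Sum>i=1..N. m N i) / sqrt (real N) * (1 / sqrt (real N)))" for N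
  proof -
    have "expectation (W N) = (\<Sum>j=1..N. m N j * (1 + v + M)) / real N"
    proof -
      have "expectation (\<lambda>\<omega>. \<Sum>j=1..N. m N j * (1 + (u j \<omega>)\<^sup>2 + M)) =
          (\<Sum>j=1..N. expectation (\<lambda>\<omega>. m N j * (1 + (u j \<omega>)\<^sup>2 + M)))"
        using int by (intro Bochner_Integration.integral_sum) auto
      also have "\<dots> = (\<Sum>j=1..N. m N j * (1 + v + M))"
        using int v by (intro sum.cong) (auto simp: prob_space)
      finally show ?thesis unfolding W_def by simp
    qed
    also have "\<dots> = (1 + v + M) * ((\<Sum>i=1..N. m N i) / real N)"
      by (simp add: sum_distrib_right[symmetric])
    also have "(\<Sum>i=1..N. m N i) / real N = (\<Sum>i=1..N. m N i) / sqrt (real N) * (1 / sqrt (real N))"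
      by simp
    finally show ?thesis .
  qed
  have "(\<lambda>N. 1 / sqrt (real N)) \<longlonglongrightarrow> 0"
    by (intro real_tendsto_divide_at_top[OF tendsto_const]
        filterlim_compose[OF sqrt_at_top filterlim_real_sequentially])
  then have "(\<lambda>N. expectation (W N)) \<longlonglongrightarrow> (1 + v + M) * (l * 0)"
    unfolding EW by (intro tendsto_intros lim)
  then have "eventually_likely P d (\<lambda>N \<omega>. W N \<omega> \<le> e)"
    using e d W_nonneg by (intro eventually_likely_L1[OF P W_int]) auto
  then show ?thesis
  proof (rule eventually_likely_mono, intro always_eventually allI ballI impI)
    fix N \<omega> n assume W: "W N \<omega> \<le> e" and n: "n \<le> N"
    have le: "\<bar>(m N j + u j \<omega>)\<^sup>2 - (u j \<omega>)\<^sup>2\<bar> \<le> m N j * (1 + (u j \<omega>)\<^sup>2 + M)"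
      and nonneg: "0 \<le> m N j * (1 + (u j \<omega>)\<^sup>2 + M)" if "j \<in> {1..N}" for j
    proof -
      have mj: "0 \<le> m N j" "m N j \<le> M" using m that by auto
      have "2 * \<bar>u j \<omega>\<bar> \<le> 1 + (u j \<omega>)\<^sup>2"
        using sum_squares_bound[of 1 "\<bar>u j \<omega>\<bar>"] by simp
      then have "\<bar>2 * u j \<omega> + m N j\<bar> \<le> 1 + (u j \<omega>)\<^sup>2 + M" using mj by linarith
      then have "m N j * \<bar>2 * u j \<omega> + m N j\<bar> \<le> m N j * (1 + (u j \<omega>)\<^sup>2 + M)"
        using mj(1) by (rule mult_left_mono)
      moreover have "(m N j + u j \<omega>)\<^sup>2 - (u j \<omega>)\<^sup>2 = m N j * (2 * u j \<omega> + m N j)"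
        by (simp add: power2_eq_square algebra_simps)
      ultimately show "\<bar>(m N j + u j \<omega>)\<^sup>2 - (u j \<omega>)\<^sup>2\<bar> \<le> m N j * (1 + (u j \<omega>)\<^sup>2 + M)"
        using mj(1) by (simp add: abs_mult)
      then show "0 \<le> m N j * (1 + (u j \<omega>)\<^sup>2 + M)" by linarith
    qed
    have "\<bar>(\<Sum>j=1..n. (m N j + u j \<omega>)\<^sup>2) - (\<Sum>j=1..n. (u j \<omega>)\<^sup>2)\<bar>
        \<le> (\<Sum>j=1..n. \<bar>(m N j + u j \<omega>)\<^sup>2 - (u j \<omega>)\<^sup>2\<bar>)"
      unfolding sum_subtractf[symmetric] by (rule sum_abs)
    also have "\<dots> \<le> (\<Sum>j=1..n. m N j * (1 + (u j \<omega>)\<^sup>2 + M))"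
      using n by (intro sum_mono le) auto
    also have "\<dots> \<le> (\<Sum>j=1..N. m N j * (1 + (u j \<omega>)\<^sup>2 + M))"
      using n nonneg by (intro sum_mono2) auto
    finally have "\<bar>(\<Sum>j=1..n. (m N j + u j \<omega>)\<^sup>2) - (\<Sum>j=1..n. (u j \<omega>)\<^sup>2)\<bar> / real N \<le> W N \<omega>"
      unfolding W_def by (rule divide_right_mono) simp
    then show "\<bar>(\<Sum>j=1..n. (m N j + u j \<omega>)\<^sup>2) - (\<Sum>j=1..n. (u j \<omega>)\<^sup>2)\<bar> / real N \<le> e"
      using W by linarith
  qed
qed



text \<open>The supremum dominates its members because the set is bounded; an unbounded set of reals would
  have an unspecified supremum.\<close>

lemma sup_distance_bound:
  assumes \<mu>: "cadlag_on 0 1 \<mu>" and t: "t \<in> {0..1}"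
  shows "\<bar>(\<Sum>i=1..nat \<lfloor>real N * t\<rfloor>. m i) / sqrt (real N) - \<mu> t\<bar>
    \<le> (SUP s\<in>{0..1}. \<bar>(\<Sum>i=1..nat \<lfloor>real N * s\<rfloor>. m i) / sqrt (real N) - \<mu> s\<bar>)"
proof (rule cSUP_upper[OF t])
  let ?f = "\<lambda>s. (\<Sum>i=1..nat \<lfloor>real N * s\<rfloor>. m i) / sqrt (real N)"
  have "cadlag_on 0 1 ?f"
    by (rule cadlag_on_step[where c="\<lambda>n. (\<Sum>i=1..n. m i) / sqrt (real N)"])
  then obtain C where C: "\<And>s. s \<in> {0..1} \<Longrightarrow> \<bar>?f s\<bar> \<le> C" using cadlag_on_bound by blast
  obtain A where A: "\<And>s. s \<in> {0..1} \<Longrightarrow> \<bar>\<mu> s\<bar> \<le> A" using cadlag_on_bound[OF \<mu>] by blast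
  show "bdd_above ((\<lambda>s. \<bar>?f s - \<mu> s\<bar>) ` {0..1})"
  proof (rule bdd_aboveI2)
    fix s :: real assume s: "s \<in> {0..1}"
    show "\<bar>?f s - \<mu> s\<bar> \<le> C + A" using C[OF s] A[OF s] by linarith
  qed
qed

lemma abs_square_diff_le:
  fixes a b :: real
  assumes "\<bar>a - b\<bar> \<le> \<eta>" "\<bar>b\<bar> \<le> D" "\<bar>a\<bar> \<le> D'"
  shows "\<bar>b\<^sup>2 - a\<^sup>2\<bar> \<le> \<eta> * (D + D')"
proof -
  have "b\<^sup>2 - a\<^sup>2 = - ((a - b) * (a + b))" by (simp add: power2_eq_square algebra_simps)
  then have "\<bar>b\<^sup>2 - a\<^sup>2\<bar> = \<bar>a - b\<bar> * \<bar>a + b\<bar>" by (simp only: abs_minus_cancel abs_mult)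
  also have "\<dots> \<le> \<eta> * (D + D')" using assms by (intro mult_mono) linarith+
  finally show ?thesis .
qed

context smoothing_kernel
begin

text \<open>The deterministic core: for a single outcome whose partial sums are bounded by \<open>R\<close> and whose averages
  of squares are close to their expected values, the detector is close to the limit functional of its partial sum
  path \<open>x\<close>, with an error bound that is the same for all such outcomes and all \<open>s\<close>.\<close>

lemma detector_estimate:
  fixes m z :: "nat \<Rightarrow> real"
  assumes \<mu>: "cadlag_on 0 1 \<mu>" "\<And>t. t \<in> {0..1} \<Longrightarrow> \<bar>\<mu> t\<bar> \<le> A"
    and x_eq: "\<And>t. t \<in> {0..1} \<Longrightarrow> x t = (\<Sum>i=1..nat \<lfloor>real N * t\<rfloor>. z i) / sqrt (real N)"
    and x: "\<And>t. t \<in> {0..1} \<Longrightarrow> \<bar>x t\<bar> \<le> R"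
    and m: "\<And>t. t \<in> {0..1} \<Longrightarrow> \<bar>(\<Sum>i=1..nat \<lfloor>real N * t\<rfloor>. m i) / sqrt (real N) - \<mu> t\<bar> \<le> \<eta>" and \<eta>: "\<eta> \<le> 1"
    and lln: "\<And>n. n \<le> N \<Longrightarrow> \<bar>\<Sum>i=1..n. (z i)\<^sup>2 - v\<bar> / real N \<le> \<delta>"
    and drift: "\<And>n. n \<le> N \<Longrightarrow> \<bar>(\<Sum>j=1..n. (m j + z j)\<^sup>2) - (\<Sum>j=1..n. (z j)\<^sup>2)\<bar> / real N \<le> \<delta>"
    and N: "1 / real N \<le> \<kappa>" "0 < N" and h: "0 < h" and v: "0 < v" and \<kappa>: "0 < \<kappa>"
    and \<delta>: "v / real N \<le> \<delta>" "3 * \<delta> \<le> \<kappa> * v / 2" and s: "s \<in> {\<kappa>..1}"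
    and y: "\<And>n. 1 \<le> n \<Longrightarrow> n \<le> N \<Longrightarrow> y n = m n + z n"
  defines "C \<equiv> (A + R + 1)\<^sup>2"
  shows "\<bar>real_of_int \<lfloor>real N * s\<rfloor> * U_process K h N y s -
      1 / (s * v) * \<zeta> * smoothed_integral K \<zeta> (\<lambda>r. (\<mu> r + x r)\<^sup>2) s\<bar>
    \<le> 2 * riemann_error C (real N / h) N (\<eta> * (2 * (A + R) + 1)) / (\<kappa> * v)
      + 2 * (\<zeta> * (C * K_bound)) * (3 * \<delta>) / (\<kappa> * v)\<^sup>2"
proof -
  define n where "n = nat \<lfloor>real N * s\<rfloor>"
  define w where "w i = (\<Sum>j=1..i. y j)\<^sup>2 / real N" for i
  let ?q = "\<lambda>r. (\<mu> r + x r)\<^sup>2"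
  have \<eta>0: "0 \<le> \<eta>" using m[of 0] by (meson abs_ge_zero atLeastAtMost_iff order_trans order_refl zero_le_one)
  have AR: "0 \<le> A" "0 \<le> R"
    using \<mu>(2)[of 0] x[of 0] by (meson abs_ge_zero atLeastAtMost_iff order_trans order_refl zero_le_one)+
  have cx: "cadlag_on 0 1 x"
    by (rule cadlag_on_cong[OF cadlag_on_step[where N=N and c="\<lambda>n. (\<Sum>i=1..n. z i) / sqrt (real N)"]])
       (simp add: x_eq)
  have AR2: "(A + R)\<^sup>2 \<le> C" unfolding C_def using AR by (intro power_mono) auto
  have q_bound: "\<bar>?q t\<bar> \<le> C" if "t \<in> {0..1}" for t
    using abs_add_square_le[OF \<mu>(2)[OF that] x[OF that]] AR2 by linarith
  have w_eq: "w i = ((\<Sum>j=1..i. m j) / sqrt (real N) + (\<Sum>j=1..i. z j) / sqrt (real N))\<^sup>2" if "i \<le> N" for i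
  proof -
    have "(\<Sum>j=1..i. y j) = (\<Sum>j=1..i. m j) + (\<Sum>j=1..i. z j)"
      unfolding sum.distrib[symmetric] using that y by (intro sum.cong) auto
    then show ?thesis unfolding w_def add_divide_distrib[symmetric] power_divide by simp
  qed
  have index: "nat \<lfloor>real N * t\<rfloor> \<le> N" if "t \<in> {0..1}" for t
  proof -
    have "real N * t \<le> real N * 1" using that by (intro mult_left_mono) auto
    then show ?thesis by linarith
  qed
  have mt: "\<bar>(\<Sum>j=1..nat \<lfloor>real N * t\<rfloor>. m j) / sqrt (real N)\<bar> \<le> A + 1" if "t \<in> {0..1}" for t
    using m[OF that] \<mu>(2)[OF that] \<eta> by linarith
  have w_bound: "\<bar>w i\<bar> \<le> C" if i: "i \<le> N" for i
  proof -
    have t: "real i / real N \<in> {0..1}" using i N by simp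
    have "\<bar>w i\<bar> \<le> (A + 1 + R)\<^sup>2"
      unfolding w_eq[OF i] using mt[OF t] x[OF t] x_eq[OF t] N by (intro abs_add_square_le) simp_all
    then show ?thesis by (simp add: C_def algebra_simps)
  qed
  have near: "\<bar>?q t - w (nat \<lfloor>real N * t\<rfloor>)\<bar> \<le> \<eta> * (2 * (A + R) + 1)" if t: "t \<in> {0..1}" for t
  proof -
    let ?a = "(\<Sum>j=1..nat \<lfloor>real N * t\<rfloor>. m j) / sqrt (real N) + x t" and ?b = "\<mu> t + x t"
    have "\<bar>?b\<^sup>2 - ?a\<^sup>2\<bar> \<le> \<eta> * ((A + R) + (A + R + 1))"
      using m[OF t] mt[OF t] \<mu>(2)[OF t] x[OF t] by (intro abs_square_diff_le) linarith+
    then show ?thesis using w_eq[OF index[OF t]] x_eq[OF t] by (simp add: algebra_simps)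
  qed
  have s01: "s \<in> {0..1}" using s \<kappa> by simp
  have w0: "w 0 = 0" by (simp add: w_def)
  have c: "0 \<le> real N / h" using h by simp
  define T where "T = real N / h / real N * (\<Sum>i=1..n. w i * K (real N / h * ((real i - real n) / real N)))"
  define V where "V = (\<Sum>j=1..n. (y j)\<^sup>2) / real N"
  have "1 / real N \<le> s" using s N(1) by simp
  then have U: "real_of_int \<lfloor>real N * s\<rfloor> * U_process K h N y s = T / V"
    unfolding T_def V_def w_def n_def by (rule U_process_eq[OF N(2) h])
  have T: "\<bar>\<zeta> * smoothed_integral K \<zeta> ?q s - T\<bar>
      \<le> riemann_error C (real N / h) N (\<eta> * (2 * (A + R) + 1))"
    unfolding T_def n_def
    by (rule smoothed_integral_riemann_sum[OF cadlag_add_square[OF \<mu>(1) cx] q_bound w0 w_bound near N(2) c s01])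
  have nN: "n \<le> N" unfolding n_def by (rule index[OF s01])
  \<comment> \<open>The three contributions are the rounding of \<open>N * s\<close>, the law of large numbers and the drift.\<close>
  have V: "\<bar>V - s * v\<bar> \<le> 3 * \<delta>"
  proof -
    have "0 \<le> real N * s" using s01 by simp
    then have "real n \<le> real N * s" "real N * s < real n + 1" unfolding n_def by linarith+
    then have "real n / real N \<le> s" "s \<le> real n / real N + 1 / real N"
      using N(2) by (auto simp: add_divide_distrib[symmetric] pos_divide_le_eq pos_le_divide_eq mult.commute)
    then have "real n / real N * v \<le> s * v" "s * v \<le> (real n / real N + 1 / real N) * v"
      using v by (intro mult_right_mono; simp)+
    then have 1: "\<bar>real n / real N * v - s * v\<bar> \<le> \<delta>" using \<delta>(1) by (simp add: distrib_right)
    have "\<bar>(\<Sum>i=1..n. (z i)\<^sup>2 - v) / real N\<bar> \<le> \<delta>" using lln[OF nN] by simp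
    moreover have "(\<Sum>i=1..n. (z i)\<^sup>2 - v) / real N = (\<Sum>i=1..n. (z i)\<^sup>2) / real N - real n / real N * v"
      by (simp add: sum_subtractf diff_divide_distrib)
    ultimately have 2: "\<bar>(\<Sum>i=1..n. (z i)\<^sup>2) / real N - real n / real N * v\<bar> \<le> \<delta>" by (simp only:)
    have "(\<Sum>j=1..n. (y j)\<^sup>2) = (\<Sum>j=1..n. (m j + z j)\<^sup>2)" using nN y by (intro sum.cong) auto
    then have "V - (\<Sum>i=1..n. (z i)\<^sup>2) / real N = ((\<Sum>j=1..n. (m j + z j)\<^sup>2) - (\<Sum>j=1..n. (z j)\<^sup>2)) / real N"
      unfolding V_def by (simp add: diff_divide_distrib)
    then have 3: "\<bar>V - (\<Sum>i=1..n. (z i)\<^sup>2) / real N\<bar> \<le> \<delta>" using drift[OF nN] by simp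
    show ?thesis using 1 2 3 by linarith
  qed
  have G: "\<bar>\<zeta> * smoothed_integral K \<zeta> ?q s\<bar> \<le> \<zeta> * (C * K_bound)"
    unfolding abs_mult abs_of_nonneg[OF \<zeta>_nonneg]
    using smoothed_integral_bound[OF cadlag_add_square[OF \<mu>(1) cx] q_bound s01] \<zeta>_nonneg
    by (intro mult_left_mono) auto
  have "\<bar>T / V - 1 / (s * v) * (\<zeta> * smoothed_integral K \<zeta> ?q s)\<bar>
    \<le> 2 * riemann_error C (real N / h) N (\<eta> * (2 * (A + R) + 1)) / (\<kappa> * v)
      + 2 * (\<zeta> * (C * K_bound)) * (3 * \<delta>) / (\<kappa> * v)\<^sup>2"
    using T s by (intro ratio_estimate[OF _ G V _ \<kappa> v \<delta>(2)]) (auto simp: abs_minus_commute)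
  then show ?thesis unfolding U by (simp only: mult.assoc)
qed

end

lemma weakly_converges_cong_limit:
  assumes "\<And>\<omega>. restrict (Z \<omega>) {a..b} = restrict (Z' \<omega>) {a..b}"
  shows "weakly_converges a b P X Q Z \<longleftrightarrow> weakly_converges a b P X Q Z'"
  unfolding weakly_converges_def random_element_def assms ..

lemma U2_limit_eq:
  assumes "0 < \<kappa>"
  shows "restrict (U2_limit K \<zeta> v \<sigma> \<mu> B \<omega>) {\<kappa>..1} =
    limit_map K \<zeta> v \<mu> \<kappa> (restrict (scaled_path \<sigma> B \<omega>) {0..1})"
proof (rule ext)
  fix s
  have "smoothed_integral K \<zeta> (\<lambda>r. (\<mu> r + restrict (scaled_path \<sigma> B \<omega>) {0..1} r)\<^sup>2) s =
      (LBINT r:{0..s}. (\<mu> r + \<sigma> * B \<omega> r)\<^sup>2 * K (\<zeta> * (r - s)))" if "s \<in> {\<kappa>..1}"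
    unfolding smoothed_integral_def using that assms
    by (intro set_lebesgue_integral_cong) (auto simp: scaled_path_def)
  then show "restrict (U2_limit K \<zeta> v \<sigma> \<mu> B \<omega>) {\<kappa>..1} s =
      limit_map K \<zeta> v \<mu> \<kappa> (restrict (scaled_path \<sigma> B \<omega>) {0..1}) s"
    by (simp add: limit_map_def U2_limit_def restrict_def)
qed

theorem theorem2p3:
  fixes P :: "'a measure" and u :: "nat \<Rightarrow> 'a \<Rightarrow> real"
    and Q :: "'b measure" and B :: "'b \<Rightarrow> real \<Rightarrow> real"
    and m :: "nat \<Rightarrow> nat \<Rightarrow> real" and M :: real
    and Y :: "nat \<Rightarrow> nat \<Rightarrow> 'a \<Rightarrow> real"
    and K :: "real \<Rightarrow> real" and h :: "nat \<Rightarrow> real"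
    and \<sigma> \<zeta> \<kappa> :: real and \<mu> :: "real \<Rightarrow> real"
  assumes "prob_space P" and "brownian_motion Q B"
    and "admissible_kernel K"
    and "\<forall>N\<ge>1. 0 < h N" and "(\<lambda>N. real N / h N) \<longlonglongrightarrow> \<zeta>" and "1 \<le> \<zeta>"
    and "\<forall>N n. 1 \<le> n \<and> n \<le> N \<longrightarrow> (\<forall>\<omega>\<in>space P. Y N n \<omega> = m N n + u n \<omega>)"
    and "weakly_stationary P u" and "\<forall>n\<ge>1. (\<integral>\<omega>. u n \<omega> \<partial>P) = 0" and "I0_series P u Q B"
    and "weakly_stationary P (\<lambda>n \<omega>. (u n \<omega>)\<^sup>2)"
    and "(\<lambda>k. covariance P (\<lambda>\<omega>. (u 1 \<omega>)\<^sup>2) (\<lambda>\<omega>. (u (1 + k) \<omega>)\<^sup>2)) \<longlonglongrightarrow> 0"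
    and "\<forall>N n. 1 \<le> n \<and> n \<le> N \<longrightarrow> 0 \<le> m N n \<and> m N n \<le> M"
    and "0 < \<sigma>" and "weakly_converges 0 1 P (partial_sum_process u) Q (scaled_path \<sigma> B)"
    and "cadlag_on 0 1 \<mu>" and "continuous (at 0 within {0..1}) \<mu>"
    and "(\<lambda>N. SUP s\<in>{0..1}. \<bar>(\<Sum>i=1..nat \<lfloor>real N * s\<rfloor>. m N i) / sqrt (real N) - \<mu> s\<bar>) \<longlonglongrightarrow> 0"
    and "0 < \<kappa>" and "\<kappa> < 1"
  shows "weakly_converges \<kappa> 1 P
           (\<lambda>N \<omega> s. real_of_int \<lfloor>real N * s\<rfloor> * U_process K (h N) N (\<lambda>n. Y N n \<omega>) s)
           Q (U2_limit K \<zeta> (\<integral>\<omega>. (u 1 \<omega>)\<^sup>2 \<partial>P) \<sigma> \<mu> B)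
       \<and> (continuous_on {0..1} \<mu> \<longrightarrow>
           (AE \<omega> in Q. continuous_on {\<kappa>..1} (U2_limit K \<zeta> (\<integral>\<omega>. (u 1 \<omega>)\<^sup>2 \<partial>P) \<sigma> \<mu> B \<omega>)))"
proof -
  note P = assms(1) and BM = assms(2) and wc = assms(15) and \<mu> = assms(16) and \<kappa> = assms(19,20)
  have Q: "prob_space Q" using BM by (simp add: brownian_motion_def)
  obtain L where L: "L-lipschitz_on UNIV K" using assms(3) by (auto simp: admissible_kernel_def)
  interpret smoothing_kernel K L \<zeta>
    using L assms(6) by unfold_locales auto
  define v where "v = (\<integral>\<omega>. (u 1 \<omega>)\<^sup>2 \<partial>P)"
  have v: "0 < v"
    unfolding v_def by (rule limit_variance_positive[OF P BM assms(14) wc assms(8) assms(11)])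
  let ?H = "limit_map K \<zeta> v \<mu> \<kappa>"
  let ?X = "\<lambda>N \<omega> s. real_of_int \<lfloor>real N * s\<rfloor> * U_process K (h N) N (\<lambda>n. Y N n \<omega>) s"
  let ?S = "\<lambda>N \<omega>. restrict (partial_sum_process u N \<omega>) {0..1}"
  obtain A where A: "\<And>t. t \<in> {0..1} \<Longrightarrow> \<bar>\<mu> t\<bar> \<le> A" using cadlag_on_bound[OF \<mu>] by blast
  define \<eta> where "\<eta> N = (SUP s\<in>{0..1}. \<bar>(\<Sum>i=1..nat \<lfloor>real N * s\<rfloor>. m N i) / sqrt (real N) - \<mu> s\<bar>)" for N
  have \<eta>: "\<eta> \<longlonglongrightarrow> 0" unfolding \<eta>_def by (rule assms(18))
  have \<eta>_bound: "\<bar>(\<Sum>i=1..nat \<lfloor>real N * t\<rfloor>. m N i) / sqrt (real N) - \<mu> t\<bar> \<le> \<eta> N" if "t \<in> {0..1}" for N t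
    unfolding \<eta>_def by (rule sup_distance_bound[OF \<mu> that])
  have m_lim: "(\<lambda>N. (\<Sum>i=1..N. m N i) / sqrt (real N)) \<longlonglongrightarrow> \<mu> 1"
  proof (rule Lim_transform_bound[OF _ \<eta>, THEN LIM_zero_cancel])
    show "\<forall>\<^sub>F N in sequentially. norm ((\<Sum>i=1..N. m N i) / sqrt (real N) - \<mu> 1) \<le> norm (\<eta> N)"
    proof (intro always_eventually allI)
      fix N
      show "norm ((\<Sum>i=1..N. m N i) / sqrt (real N) - \<mu> 1) \<le> norm (\<eta> N)"
        using \<eta>_bound[of 1 N] by simp
    qed
  qed
  have limit: "weakly_converges \<kappa> 1 P (\<lambda>N \<omega>. ?H (?S N \<omega>)) Q (\<lambda>\<omega>. ?H (restrict (scaled_path \<sigma> B \<omega>) {0..1}))"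
    using \<kappa> v by (intro weakly_converges_continuous_mapping[OF _ _ wc] limit_map_continuous \<mu>) auto
  have "weakly_converges \<kappa> 1 P ?X Q (\<lambda>\<omega>. ?H (restrict (scaled_path \<sigma> B \<omega>) {0..1}))"
  proof (rule weakly_converges_Slutsky[OF _ P Q limit])
    show "\<kappa> \<le> 1" using \<kappa> by simp
    show "random_element \<kappa> 1 P (?X N)" for N
      using assms(7,8) by (intro detector_random_element[OF \<kappa>]) (auto simp: weakly_stationary_def)
    fix e d :: real assume e: "0 < e" and d: "0 < d"
    obtain R where R: "eventually_likely P (d / 3) (\<lambda>N \<omega>. \<forall>t\<in>{0..1}. \<bar>partial_sum_process u N \<omega> t\<bar> \<le> R)"
      using weakly_converges_tight[OF zero_le_one P Q wc, of "d / 3"] d by auto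
    define C where "C = (A + R + 1)\<^sup>2"
    define g where "g = \<zeta> * (C * K_bound)"
    have g: "0 \<le> g" unfolding g_def C_def using \<zeta>_nonneg K_bound_nonneg by simp
    \<comment> \<open>The first bound keeps the denominator away from zero, the second one makes its fluctuation cost at most \<open>e / 2\<close>.\<close>
    define \<delta> where "\<delta> = min (\<kappa> * v / 6) (e * (\<kappa> * v)\<^sup>2 / (12 * (g + 1)))"
    have \<delta>: "0 < \<delta>" "3 * \<delta> \<le> \<kappa> * v / 2" unfolding \<delta>_def using \<kappa> v e g by auto
    have \<delta>_small: "2 * g * (3 * \<delta>) / (\<kappa> * v)\<^sup>2 \<le> e / 2"
    proof -
      have "\<delta> * (12 * (g + 1)) \<le> e * (\<kappa> * v)\<^sup>2"
        using g by (subst pos_le_divide_eq[symmetric]) (auto simp: \<delta>_def)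
      moreover have "g * \<delta> \<le> (g + 1) * \<delta>" using \<delta> by (intro mult_right_mono) auto
      ultimately have "2 * g * (3 * \<delta>) \<le> e / 2 * (\<kappa> * v)\<^sup>2" by (simp add: algebra_simps)
      moreover have "0 < (\<kappa> * v)\<^sup>2" using \<kappa> v by simp
      ultimately show ?thesis by (simp add: pos_divide_le_eq)
    qed
    have lln: "eventually_likely P (d / 3)
        (\<lambda>N \<omega>. \<forall>n\<le>N. \<bar>\<Sum>i=1..n. (u i \<omega>)\<^sup>2 - v\<bar> / real N \<le> \<delta>)"
      unfolding v_def using \<delta> d
      by (intro uniform_law_of_large_numbers[OF P assms(11) _ assms(12)]) auto
    have drift: "eventually_likely P (d / 3)
        (\<lambda>N \<omega>. \<forall>n\<le>N. \<bar>(\<Sum>j=1..n. (m N j + u j \<omega>)\<^sup>2) - (\<Sum>j=1..n. (u j \<omega>)\<^sup>2)\<bar> / real N \<le> \<delta>)"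
      using \<delta> d assms(13) by (intro drift_square_negligible[OF P assms(8,11) _ m_lim]) auto
    have likely: "eventually_likely P d (\<lambda>N \<omega>. (\<forall>t\<in>{0..1}. \<bar>partial_sum_process u N \<omega> t\<bar> \<le> R) \<and>
        (\<forall>n\<le>N. \<bar>\<Sum>i=1..n. (u i \<omega>)\<^sup>2 - v\<bar> / real N \<le> \<delta>) \<and>
        (\<forall>n\<le>N. \<bar>(\<Sum>j=1..n. (m N j + u j \<omega>)\<^sup>2) - (\<Sum>j=1..n. (u j \<omega>)\<^sup>2)\<bar> / real N \<le> \<delta>))"
      using eventually_likely_conj[OF R eventually_likely_conj[OF lln drift P] P] by simp
    define \<rho> where "\<rho> N = riemann_error C (real N / h N) N (\<eta> N * (2 * (A + R) + 1))" for N
    have "(\<lambda>N. \<eta> N * (2 * (A + R) + 1)) \<longlonglongrightarrow> 0" using tendsto_mult_right[OF \<eta>] by simp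
    then have "\<rho> \<longlonglongrightarrow> 0" unfolding \<rho>_def by (rule riemann_error_tendsto[OF assms(5)])
    then have "(\<lambda>N. 2 * \<rho> N / (\<kappa> * v)) \<longlonglongrightarrow> 2 * 0 / (\<kappa> * v)"
      using \<kappa> v by (intro tendsto_intros) auto
    then have ev_\<rho>: "\<forall>\<^sub>F N in sequentially. 2 * \<rho> N / (\<kappa> * v) < e / 2"
      using e by (intro order_tendstoD) auto
    have ev_\<eta>: "\<forall>\<^sub>F N in sequentially. \<eta> N < 1" using \<eta> by (intro order_tendstoD) auto
    have ev_v: "\<forall>\<^sub>F N in sequentially. v / real N < \<delta>"
      using \<delta>(1) real_tendsto_divide_at_top[OF tendsto_const filterlim_real_sequentially, of v]
      by (intro order_tendstoD) auto
    have ev_\<kappa>: "\<forall>\<^sub>F N in sequentially. 1 / real N < \<kappa>"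
      using \<kappa>(1) lim_1_over_n by (intro order_tendstoD) auto
    show "eventually_likely P d (\<lambda>N \<omega>. \<forall>s\<in>{\<kappa>..1}. \<bar>?X N \<omega> s - ?H (?S N \<omega>) s\<bar> \<le> e)"
    proof (rule eventually_likely_mono[OF likely])
      show "\<forall>\<^sub>F N in sequentially. \<forall>\<omega>\<in>space P. ((\<forall>t\<in>{0..1}. \<bar>partial_sum_process u N \<omega> t\<bar> \<le> R) \<and>
        (\<forall>n\<le>N. \<bar>\<Sum>i=1..n. (u i \<omega>)\<^sup>2 - v\<bar> / real N \<le> \<delta>) \<and>
        (\<forall>n\<le>N. \<bar>(\<Sum>j=1..n. (m N j + u j \<omega>)\<^sup>2) - (\<Sum>j=1..n. (u j \<omega>)\<^sup>2)\<bar> / real N \<le> \<delta>)) \<longrightarrow>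
        (\<forall>s\<in>{\<kappa>..1}. \<bar>?X N \<omega> s - ?H (?S N \<omega>) s\<bar> \<le> e)"
        using ev_\<rho> ev_\<eta> ev_v ev_\<kappa> eventually_gt_at_top[of 0]
      proof eventually_elim
        case (elim N)
        show ?case
        proof (intro ballI impI, elim conjE)
          fix \<omega> s assume \<omega>: "\<omega> \<in> space P" and s: "s \<in> {\<kappa>..1}"
            and likely: "\<forall>t\<in>{0..1}. \<bar>partial_sum_process u N \<omega> t\<bar> \<le> R"
              "\<forall>n\<le>N. \<bar>\<Sum>i=1..n. (u i \<omega>)\<^sup>2 - v\<bar> / real N \<le> \<delta>"
              "\<forall>n\<le>N. \<bar>(\<Sum>j=1..n. (m N j + u j \<omega>)\<^sup>2) - (\<Sum>j=1..n. (u j \<omega>)\<^sup>2)\<bar> / real N \<le> \<delta>"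
          have hN: "0 < h N" using assms(4) elim(5) by simp
          have "\<bar>?X N \<omega> s - 1 / (s * v) * \<zeta> * smoothed_integral K \<zeta> (\<lambda>r. (\<mu> r + ?S N \<omega> r)\<^sup>2) s\<bar>
            \<le> 2 * riemann_error ((A + R + 1)\<^sup>2) (real N / h N) N (\<eta> N * (2 * (A + R) + 1)) / (\<kappa> * v)
              + 2 * (\<zeta> * ((A + R + 1)\<^sup>2 * K_bound)) * (3 * \<delta>) / (\<kappa> * v)\<^sup>2"
          proof (rule detector_estimate[where x="?S N \<omega>" and z="\<lambda>n. u n \<omega>" and m="m N" and \<mu>=\<mu>])
            show "?S N \<omega> t = (\<Sum>i=1..nat \<lfloor>real N * t\<rfloor>. u i \<omega>) / sqrt (real N)" if "t \<in> {0..1}" for t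
              using that by (simp add: partial_sum_process_def)
            show "\<bar>?S N \<omega> t\<bar> \<le> R" if "t \<in> {0..1}" for t using likely(1) that by simp
            show "Y N n \<omega> = m N n + u n \<omega>" if "1 \<le> n" "n \<le> N" for n using assms(7) that \<omega> by blast
            show "\<bar>\<Sum>i=1..n. (u i \<omega>)\<^sup>2 - v\<bar> / real N \<le> \<delta>" if "n \<le> N" for n
              using likely(2) that by blast
            show "\<bar>(\<Sum>j=1..n. (m N j + u j \<omega>)\<^sup>2) - (\<Sum>j=1..n. (u j \<omega>)\<^sup>2)\<bar> / real N \<le> \<delta>" if "n \<le> N" for n
              using likely(3) that by blast
          qed (use elim A \<mu> \<eta>_bound \<delta>(2) v \<kappa> hN s in auto)
          also have "\<dots> \<le> e"
            using elim(1) \<delta>_small unfolding \<rho>_def g_def C_def by linarith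
          finally show "\<bar>?X N \<omega> s - ?H (?S N \<omega>) s\<bar> \<le> e"
            using s by (simp add: limit_map_def)
        qed
      qed
    qed
  qed
  also have "?this \<longleftrightarrow> weakly_converges \<kappa> 1 P ?X Q (U2_limit K \<zeta> v \<sigma> \<mu> B)"
  proof (rule weakly_converges_cong_limit)
    show "restrict (?H (restrict (scaled_path \<sigma> B \<omega>) {0..1})) {\<kappa>..1} = restrict (U2_limit K \<zeta> v \<sigma> \<mu> B \<omega>) {\<kappa>..1}" for \<omega>
      unfolding U2_limit_eq[OF \<kappa>(1)] by (simp add: limit_map_def)
  qed
  finally have "weakly_converges \<kappa> 1 P ?X Q (U2_limit K \<zeta> v \<sigma> \<mu> B)" .
  moreover have "AE \<omega> in Q. continuous_on {\<kappa>..1} (U2_limit K \<zeta> v \<sigma> \<mu> B \<omega>)"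
  proof (rule AE_I2)
    fix \<omega> assume "\<omega> \<in> space Q"
    then have "continuous_on {0..1} (B \<omega>)" using BM by (simp add: brownian_motion_def)
    then have "cadlag_on 0 1 (scaled_path \<sigma> B \<omega>)"
      unfolding scaled_path_def by (intro continuous_on_imp_cadlag_on continuous_intros)
    from limit_path_continuous[OF \<mu> this \<kappa>(1) v]
    show "continuous_on {\<kappa>..1} (U2_limit K \<zeta> v \<sigma> \<mu> B \<omega>)"
      unfolding U2_limit_def smoothed_integral_def scaled_path_def .
  qed
  ultimately show ?thesis unfolding v_def by blast
qed

end
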